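(* Let $V^{[*]}$ be a dg vertex operator algebra. There is a natural transformation $\varphi:\eta_{W_\bullet}\circ R^{[*]}(-)\to\operatorname{gr}_*A(-)$ of functors from the category of graded dg $V^{[*]}$-modules to the category of graded $\operatorname{gr}_*A(V^{[*]})$-modules such that, for any graded dg $V^{[*]}$-module $M^{[*]}$, the morphism $$\varphi_{M^{[*]}}:\eta_{W_\bullet}(R^{[*]}(M^{[*]}))\to\operatorname{gr}_*A(M^{[*]}),$$ $$m+C_2(M^{[*]})_{\operatorname{wt}(m)}+\left((\operatorname{Ker}\eta_{W_\bullet})R^{[*]}(M^{[*]})\right)_{\operatorname{wt}(m)}\mapsto m+O(M^{[*]})+\bigoplus_{n<\operatorname{wt}(m)}M^{[*]}(n)$$ (for $m$ weight homogeneous) is a surjective morphism of weight graded differential filtered $\operatorname{gr}_*A(V^{[*]})$-modules.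
   Context: All vector spaces are over $\mathbb C$. A (cochain) complex $V^{[*]}=\bigoplus_{p\in\mathbb Z}V^{[p]}$ has a differential $d_V$ of degree $+1$ with $d_V^2=0$; $|v|=p$ for $v\in V^{[p]}$. $\operatorname{End}^{[*]}(V^{[*]})=\bigoplus_p\operatorname{End}^{[p]}(V^{[*]})$, where $\operatorname{End}^{[p]}$ is the space of linear maps of degree $p$. A dg vertex algebra $(V^{[*]},d_V,Y(\cdot,x),\mathbf 1)$ is a complex with a linear map $v\mapsto Y(v,x)=\sum_{n\in\mathbb Z}v_nx^{-n-1}\in\operatorname{End}^{[*]}(V^{[*]})[[x,x^{-1}]]$ such that for $v\in V^{[p]}$ one has $v_n\in\operatorname{End}^{[p-2n-2]}(V^{[*]})$ and $(d_Vv)_n=d_V\circ v_n-(-1)^{p}v_n\circ d_V$, and a vector $\mathbf 1\in V^{[0]}$ with $d_V\mathbf 1=0$, such that: $u_nv=0$ for $n$ sufficiently large; $Y(\mathbf 1,x)=\operatorname{id}$; $Y(v,x)\mathbf 1\in V^{[*]}[[x]]$ with constant term $v$; and (Jacobi identity) for homogeneous $u,v$ and all $l,m,n\in\mathbb Z$, $$\sum_{i\ge0}(-1)^i\binom li\left(u_{m+l-i}v_{n+i}-(-1)^{l}(-1)^{|u||v|}v_{n+l-i}u_{m+i}\right)=\sum_{i\ge0}\binom mi(u_{l+i}v)_{m+n-i}.$$ A dg vertex operator algebra is a dg vertex algebra with $\omega\in V^{[4]}$, $d_V\omega=0$, such that, writing $Y(\omega,x)=\sum_nL(n)x^{-n-2}$: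 $[L(m),L(n)]=(m-n)L(m+n)+\frac1{12}(m^3-m)\delta_{m+n,0}c_V$ for some $c_V\in\mathbb C$; $L(0)$ is semisimple with $V^{[*]}=\bigoplus_{n\in\frac12\mathbb Z}V_n^{[*]}$, $V_n^{[*]}$ the eigenspace of eigenvalue (weight) $n$, $\omega\in V_2^{[*]}$, $\dim V_n^{[*]}<\infty$, $V_n^{[*]}=0$ for $n\ll0$; and $L(-1)v=v_{-2}\mathbf 1$. Write $\operatorname{wt}(u)=n$ for $u\in V_n^{[*]}$. A weak dg module over $V^{[*]}$ is a complex $(M^{[*]},d_M)$ with a linear map $v\mapsto Y_M(v,x)=\sum_nv_nx^{-n-1}\in\operatorname{End}^{[*]}(M^{[*]})[[x,x^{-1}]]$ such that for $v\in V^{[p]}$, $v_n\in\operatorname{End}^{[p-2n-2]}(M^{[*]})$ and $(d_Vv)_n=d_M\circ v_n-(-1)^pv_n\circ d_M$; $v_nm=0$ for $n$ sufficiently large; $Y_M(\mathbf 1,x)=\operatorname{id}$; and the displayed Jacobi identity holds for operators on $M^{[*]}$. A graded dg module is a weak dg module with a decomposition $M^{[*]}=\bigoplus_{n\in\frac12\mathbb Z}M^{[*]}(n)$ into subcomplexes such that $u_m(M^{[*]}(r))\subseteq M^{[*]}(r+n-m-1)$ for $u\in V_n^{[*]}$; $\operatorname{wt}(m)=n$ for $m\in M^{[*]}(n)$. Morphisms of graded dg modules are chain maps $f$ with $f(v_nm)=v_nf(m)$ preserving the decomposition. $C_2$-algebra: $C_2^{[*]}(V^{[*]})=\operatorname{Span}\{u_{-2}v\}$,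 $C_2^{[*]}(M^{[*]})=\operatorname{Span}\{v_{-2}m\}$ (graded by degree and weight; subscript $n$ denotes weight $n$ part), $R^{[*]}(V^{[*]})=V^{[*]}/C_2^{[*]}(V^{[*]})$ is a weight graded dg algebra with $\overline u\cdot\overline v=\overline{u_{-1}v}$, and $R^{[*]}(M^{[*]})=M^{[*]}/C_2^{[*]}(M^{[*]})$ is a weight graded dg module over it with $\overline v\cdot\overline m=\overline{v_{-1}m}$; both are filtered by cohomological degree, $F^p=\bigoplus_{q\le p}$. Zhu algebra: for $u\in V^{[*]}$ weight homogeneous and $m$ in $V^{[*]}$ or $M^{[*]}$, put $u\ast_lm=\sum_{n\ge0}\binom{\operatorname{wt}(u)}{n}u_{n-1}m$ and $u\circ m=\sum_{n\ge0}\binom{\operatorname{wt}(u)}{n}u_{n-2}m$ (extended linearly). $O(V^{[*]})$, $O(M^{[*]})$ are the spans of all $u\circ v$, resp. $u\circ m$; $A(V^{[*]})=V^{[*]}/O(V^{[*]})$ is an associative algebra under $\ast=\ast_l$, $A(M^{[*]})=M^{[*]}/O(M^{[*]})$ a left $A(V^{[*]})$-module via $\ast_l$; $d_V,d_M$ descend. $F^p$ denotes the image of the part of cohomological degree $\le p$, $W_n$ the image of the part of weight $\le n$, $W_{<n}=\bigcup_{m<n}W_m$. For $X=A(V^{[*]})$ or $A(M^{[*]})$: $\operatorname{gr}_nX=W_nX/W_{<n}X$, $\operatorname{gr}_*X=\bigoplus_{n\in\frac12\mathbb Z}\operatorname{gr}_nX$ with induced structures, and $F^p\operatorname{gr}_nX$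 is the image of $F^pX\cap W_nX$. $\eta_{W_\bullet}:R^{[*]}(V^{[*]})\to\operatorname{gr}_*A(V^{[*]})$ is the surjective algebra morphism sending the class of $u\in V_n^{[*]}$ to the class of $u$ in $\operatorname{gr}_nA(V^{[*]})$. For a weight graded differential filtered $R^{[*]}(V^{[*]})$-module $W$, $\eta_{W_\bullet}(W)=\operatorname{gr}_*A(V^{[*]})\otimes_{R^{[*]}(V^{[*]})}W\cong W/((\operatorname{Ker}\eta_{W_\bullet})W)$ with induced weight grading, filtration and differential. A differential filtered vector space $(X,F^\bullet X,d_X)$ is a vector space with an increasing $\mathbb Z$-indexed filtration with $\bigcap_iF^iX=0$, $\bigcup_iF^iX=X$, and a linear map $d_X$ with $d_XF^iX\subseteq F^{i+1}X$, $d_X^2F^iX\subseteq F^{i+1}X$; $|x|=\min\{i\mid x\in F^iX\}$ for $x\neq 0$. A differential filtered algebra $A$ has an associative product with $F^iA\ast F^jA\subseteq F^{i+j}A$ and $d_A(a\ast b)-(d_Aa\ast b+(-1)^{|a|}a\ast d_Ab)\in F^{|a|+|b|}A$. A left differential filtered $A$-module $X$ is a differential filtered vector space and left $A$-module with $F^iA\ast F^jX\subseteq F^{i+j}X$ and $d_X(a\ast x)-(d_Aa\ast x+(-1)^{|a|}a\ast d_Xx)\in F^{|a|+|x|}X$. A morphism $f:X\to Y$ is an $A$-linear map with $f(F^iX)\subseteq F^iY$ and $(f\circ d_X-d_Y\circ f)(F^iX)\subseteq F^iY$; weight graded morphisms also preserve the weight grading. *)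

theory Defs
  imports Complex_Main "HOL-Library.Groups_Big_Fun" "HOL-Library.FuncSet" "HOL-Algebra.Module"
    "HOL-Algebra.AbelCoset"
begin

section \<open>Linear algebra inside an ambient complex vector space\<close>

definition half_ints :: "rat set" where
  "half_ints = range (\<lambda>k::int. of_int k / 2)"

text \<open>\<open>f\<close> is the family of components of \<open>x\<close> with respect to the subspaces \<open>S i\<close>, \<open>i \<in> I\<close>.\<close>

definition components :: "'i set \<Rightarrow> ('i \<Rightarrow> 'a::ab_group_add set) \<Rightarrow> 'a \<Rightarrow> ('i \<Rightarrow> 'a) \<Rightarrow> bool" where
  "components I S x f \<longleftrightarrow>
     (\<forall>i\<in>I. f i \<in> S i) \<and> (\<forall>i. i \<notin> I \<longrightarrow> f i = 0) \<and> finite {i. f i \<noteq> 0} \<and> x = Sum_any f"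

definition component :: "'i set \<Rightarrow> ('i \<Rightarrow> 'a::ab_group_add set) \<Rightarrow> 'a \<Rightarrow> 'i \<Rightarrow> 'a" where
  "component I S x = (THE f. components I S x f)"

definition direct_decomposition ::
  "(complex \<Rightarrow> 'a::ab_group_add \<Rightarrow> 'a) \<Rightarrow> 'i set \<Rightarrow> ('i \<Rightarrow> 'a set) \<Rightarrow> 'a set \<Rightarrow> bool" where
  "direct_decomposition s I S U \<longleftrightarrow>
     module.subspace s U \<and> (\<forall>i\<in>I. module.subspace s (S i) \<and> S i \<subseteq> U) \<and>
     (\<forall>x\<in>U. \<exists>!f. components I S x f)"

definition linear_between ::
  "(complex \<Rightarrow> 'a::ab_group_add \<Rightarrow> 'a) \<Rightarrow> 'a set \<Rightarrow>
   (complex \<Rightarrow> 'b::ab_group_add \<Rightarrow> 'b) \<Rightarrow> 'b set \<Rightarrow> ('a \<Rightarrow> 'b) \<Rightarrow> bool" where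
  "linear_between s S t T f \<longleftrightarrow>
     f ` S \<subseteq> T \<and> (\<forall>x\<in>S. \<forall>y\<in>S. f (x + y) = f x + f y) \<and> (\<forall>c. \<forall>x\<in>S. f (s c x) = t c (f x))"


section \<open>dg vertex operator algebras\<close>

text \<open>The whole type \<open>'v\<close> is the underlying space, \<open>va_deg V p\<close> is the part of cohomological
  degree \<open>p\<close>, and \<open>va_Y V u n v\<close> is \<open>u\<^sub>n v\<close>.\<close>

record 'v dg_va =
  va_scale :: "complex \<Rightarrow> 'v \<Rightarrow> 'v"
  va_deg :: "int \<Rightarrow> 'v set"
  va_diff :: "'v \<Rightarrow> 'v"
  va_Y :: "'v \<Rightarrow> int \<Rightarrow> 'v \<Rightarrow> 'v"
  va_vac :: "'v"

record 'v dg_voa = "'v dg_va" +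
  voa_omega :: "'v"

text \<open>The Jacobi identity for operators \<open>act u n\<close> on a space \<open>S\<close> with scalar multiplication \<open>s\<close>.
  By the truncation axioms only finitely many summands are nonzero, so \<^const>\<open>Sum_any\<close>
  (the sum over the support) is the intended sum.\<close>

definition jacobi_identity ::
  "('v::ab_group_add, 'z) dg_va_scheme \<Rightarrow> (complex \<Rightarrow> 'm::ab_group_add \<Rightarrow> 'm) \<Rightarrow> 'm set \<Rightarrow>
   ('v \<Rightarrow> int \<Rightarrow> 'm \<Rightarrow> 'm) \<Rightarrow> bool" where
  "jacobi_identity V s S act \<longleftrightarrow>
     (\<forall>p q. \<forall>u\<in>va_deg V p. \<forall>v\<in>va_deg V q. \<forall>(l::int) (m::int) (n::int). \<forall>w\<in>S.
        Sum_any (\<lambda>i::nat. s ((-1) ^ i * (of_int l gchoose i))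
            (act u (m + l - int i) (act v (n + int i) w)
             - s ((-1) powi l * (-1) powi (p * q)) (act v (n + l - int i) (act u (m + int i) w))))
        = Sum_any (\<lambda>i::nat. s (of_int m gchoose i)
            (act (va_Y V u (l + int i) v) (m + n - int i) w)))"

locale dg_vertex_algebra =
  fixes V :: "('v::ab_group_add, 'z) dg_va_scheme"
  assumes vector_space: "vector_space (va_scale V)"
    and degree_decomposition: "direct_decomposition (va_scale V) UNIV (va_deg V) UNIV"
    and diff_linear: "Vector_Spaces.linear (va_scale V) (va_scale V) (va_diff V)"
    and diff_degree: "va_diff V ` va_deg V p \<subseteq> va_deg V (p + 1)"
    and diff_diff: "va_diff V (va_diff V v) = 0"
    and Y_linear_left: "Vector_Spaces.linear (va_scale V) (va_scale V) (\<lambda>u. va_Y V u n v)"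
    and Y_linear_right: "Vector_Spaces.linear (va_scale V) (va_scale V) (va_Y V u n)"
    and Y_degree: "u \<in> va_deg V p \<Longrightarrow> va_Y V u n ` va_deg V q \<subseteq> va_deg V (q + (p - 2 * n - 2))"
    and Y_diff: "u \<in> va_deg V p \<Longrightarrow>
       va_Y V (va_diff V u) n v
       = va_diff V (va_Y V u n v) - va_scale V ((-1) powi p) (va_Y V u n (va_diff V v))"
    and vac_degree: "va_vac V \<in> va_deg V 0"
    and diff_vac: "va_diff V (va_vac V) = 0"
    and truncation: "\<exists>N. \<forall>n\<ge>N. va_Y V u n v = 0"
    and Y_vac: "va_Y V (va_vac V) n v = (if n = -1 then v else 0)"
    and creation_regular: "n \<ge> 0 \<Longrightarrow> va_Y V v n (va_vac V) = 0"
    and creation: "va_Y V v (-1) (va_vac V) = v"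
    and jacobi: "jacobi_identity V (va_scale V) UNIV (va_Y V)"

definition voa_L :: "('v, 'z) dg_voa_scheme \<Rightarrow> int \<Rightarrow> 'v \<Rightarrow> 'v" where
  "voa_L V n = va_Y V (voa_omega V) (n + 1)"

definition voa_wt :: "('v, 'z) dg_voa_scheme \<Rightarrow> rat \<Rightarrow> 'v set" where
  "voa_wt V n = {v. voa_L V 0 v = va_scale V (of_rat n) v}"

locale dg_vertex_operator_algebra = dg_vertex_algebra V
  for V :: "('v::ab_group_add, 'z) dg_voa_scheme" +
  assumes omega_degree: "voa_omega V \<in> va_deg V 4"
    and diff_omega: "va_diff V (voa_omega V) = 0"
    and virasoro: "\<exists>c::complex. \<forall>m n v.
       voa_L V m (voa_L V n v) - voa_L V n (voa_L V m v)
       = va_scale V (of_int (m - n)) (voa_L V (m + n) v)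
         + va_scale V (if m + n = 0 then 1 / 12 * of_int (m ^ 3 - m) * c else 0) v"
    and weight_decomposition: "direct_decomposition (va_scale V) half_ints (voa_wt V) UNIV"
    and omega_weight: "voa_omega V \<in> voa_wt V 2"
    and weight_finite_dimensional:
      "n \<in> half_ints \<Longrightarrow> \<exists>B. finite B \<and> voa_wt V n = module.span (va_scale V) B"
    and weight_bounded_below: "\<exists>N. \<forall>n\<in>half_ints. n < N \<longrightarrow> voa_wt V n = {0}"
    and L_minus_one: "voa_L V (-1) v = va_Y V v (-2) (va_vac V)"


section \<open>Graded dg modules\<close>

text \<open>The underlying space \<open>mod_space M\<close> is a subspace of an arbitrary ambient complex vector space
  with additive group \<open>'m\<close> and scalar multiplication \<open>mod_scale M\<close>, so that modules of different
  sizes are objects of one category; the values of the operations off \<open>mod_space M\<close> are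
  irrelevant. \<open>mod_deg M p\<close> is the part of cohomological degree \<open>p\<close> and \<open>mod_wt M n\<close> the part of
  weight \<open>n \<in> half_ints\<close>.\<close>

record ('v, 'm) dg_mod =
  mod_space :: "'m set"
  mod_scale :: "complex \<Rightarrow> 'm \<Rightarrow> 'm"
  mod_deg :: "int \<Rightarrow> 'm set"
  mod_diff :: "'m \<Rightarrow> 'm"
  mod_Y :: "'v \<Rightarrow> int \<Rightarrow> 'm \<Rightarrow> 'm"
  mod_wt :: "rat \<Rightarrow> 'm set"

locale weak_dg_module =
  fixes V :: "('v::ab_group_add, 'z) dg_voa_scheme" and M :: "('v, 'm::ab_group_add) dg_mod"
  assumes vector_space: "vector_space (mod_scale M)"
    and degree_decomposition: "direct_decomposition (mod_scale M) UNIV (mod_deg M) (mod_space M)"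
    and diff_linear:
      "linear_between (mod_scale M) (mod_space M) (mod_scale M) (mod_space M) (mod_diff M)"
    and diff_degree: "mod_diff M ` mod_deg M p \<subseteq> mod_deg M (p + 1)"
    and diff_diff: "x \<in> mod_space M \<Longrightarrow> mod_diff M (mod_diff M x) = 0"
    and Y_linear_left: "x \<in> mod_space M \<Longrightarrow>
       Vector_Spaces.linear (va_scale V) (mod_scale M) (\<lambda>u. mod_Y M u n x)"
    and Y_linear_right:
      "linear_between (mod_scale M) (mod_space M) (mod_scale M) (mod_space M) (mod_Y M u n)"
    and Y_degree: "u \<in> va_deg V p \<Longrightarrow> mod_Y M u n ` mod_deg M q \<subseteq> mod_deg M (q + (p - 2 * n - 2))"
    and Y_diff: "u \<in> va_deg V p \<Longrightarrow> x \<in> mod_space M \<Longrightarrow>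
       mod_Y M (va_diff V u) n x
       = mod_diff M (mod_Y M u n x) - mod_scale M ((-1) powi p) (mod_Y M u n (mod_diff M x))"
    and truncation: "x \<in> mod_space M \<Longrightarrow> \<exists>N. \<forall>n\<ge>N. mod_Y M u n x = 0"
    and Y_vac: "x \<in> mod_space M \<Longrightarrow> mod_Y M (va_vac V) n x = (if n = -1 then x else 0)"
    and jacobi: "jacobi_identity V (mod_scale M) (mod_space M) (mod_Y M)"

locale graded_dg_module = weak_dg_module V M
  for V :: "('v::ab_group_add, 'z) dg_voa_scheme" and M :: "('v, 'm::ab_group_add) dg_mod" +
  assumes weight_decomposition:
      "direct_decomposition (mod_scale M) half_ints (mod_wt M) (mod_space M)"
    and weight_subcomplex_graded: "n \<in> half_ints \<Longrightarrow>
       direct_decomposition (mod_scale M) UNIV (\<lambda>p. mod_wt M n \<inter> mod_deg M p) (mod_wt M n)"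
    and weight_subcomplex_diff: "n \<in> half_ints \<Longrightarrow> mod_diff M ` mod_wt M n \<subseteq> mod_wt M n"
    and Y_weight: "n \<in> half_ints \<Longrightarrow> r \<in> half_ints \<Longrightarrow> u \<in> voa_wt V n \<Longrightarrow>
       mod_Y M u m ` mod_wt M r \<subseteq> mod_wt M (r + n - of_int m - 1)"

definition graded_dg_module_hom ::
  "('v, 'm::ab_group_add) dg_mod \<Rightarrow> ('v, 'm) dg_mod \<Rightarrow> ('m \<Rightarrow> 'm) \<Rightarrow> bool" where
  "graded_dg_module_hom M N f \<longleftrightarrow>
     linear_between (mod_scale M) (mod_space M) (mod_scale N) (mod_space N) f \<and>
     (\<forall>p. f ` mod_deg M p \<subseteq> mod_deg N p) \<and>
     (\<forall>x\<in>mod_space M. f (mod_diff M x) = mod_diff N (f x)) \<and>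
     (\<forall>v n. \<forall>x\<in>mod_space M. f (mod_Y M v n x) = mod_Y N v n (f x)) \<and>
     (\<forall>n\<in>half_ints. f ` mod_wt M n \<subseteq> mod_wt N n)"

definition adjoint_module :: "('v::ab_group_add, 'z) dg_voa_scheme \<Rightarrow> ('v, 'v) dg_mod" where
  "adjoint_module V = \<lparr>mod_space = UNIV, mod_scale = va_scale V, mod_deg = va_deg V,
     mod_diff = va_diff V, mod_Y = va_Y V, mod_wt = voa_wt V\<rparr>"


section \<open>Weight graded differential filtered algebras and modules\<close>

definition complex_ring :: "complex ring" where
  "complex_ring = \<lparr>carrier = UNIV, mult = (*), one = 1, zero = 0, add = (+)\<rparr>"

text \<open>A complex vector space together with an action \<open>act\<close> of an algebra with elements in \<open>'b\<close>,
  a filtration \<open>fil\<close>, a map \<open>dif\<close>, and a family \<open>wgt\<close> indexed by weights (a grading or an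
  increasing filtration, depending on the space). For algebras the ring multiplication is used;
  for modules the ring fields \<open>mult\<close> and \<open>one\<close> are meaningless.\<close>

record ('b, 'a) filt_mod = "(complex, 'a) module" +
  act :: "'b \<Rightarrow> 'a \<Rightarrow> 'a"
  fil :: "int \<Rightarrow> 'a set"
  dif :: "'a \<Rightarrow> 'a"
  wgt :: "rat \<Rightarrow> 'a set"

definition is_subspace :: "(complex, 'a, 'z) module_scheme \<Rightarrow> 'a set \<Rightarrow> bool" where
  "is_subspace X H \<longleftrightarrow> submodule H complex_ring X"

definition span_of :: "(complex, 'a, 'z) module_scheme \<Rightarrow> 'a set \<Rightarrow> 'a set" where
  "span_of X S = is_subspace X hull S"

definition linear_map ::
  "(complex, 'a, 'y) module_scheme \<Rightarrow> (complex, 'b, 'z) module_scheme \<Rightarrow> ('a \<Rightarrow> 'b) \<Rightarrow> bool" where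
  "linear_map X Y f \<longleftrightarrow>
     f \<in> carrier X \<rightarrow> carrier Y \<and>
     (\<forall>x\<in>carrier X. \<forall>y\<in>carrier X. f (x \<oplus>\<^bsub>X\<^esub> y) = f x \<oplus>\<^bsub>Y\<^esub> f y) \<and>
     (\<forall>c. \<forall>x\<in>carrier X. f (c \<odot>\<^bsub>X\<^esub> x) = c \<odot>\<^bsub>Y\<^esub> f x)"

definition weight_graded_space :: "('b, 'a) filt_mod \<Rightarrow> bool" where
  "weight_graded_space X \<longleftrightarrow>
     Module.module complex_ring X \<and> (\<forall>n\<in>half_ints. is_subspace X (wgt X n)) \<and>
     (\<forall>x\<in>carrier X. \<exists>!f. f \<in> (\<Pi>\<^sub>E n\<in>half_ints. wgt X n) \<and>
        finite {n\<in>half_ints. f n \<noteq> \<zero>\<^bsub>X\<^esub>} \<and>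
        x = (\<Oplus>\<^bsub>X\<^esub>n\<in>{n\<in>half_ints. f n \<noteq> \<zero>\<^bsub>X\<^esub>}. f n))"

definition graded_algebra :: "('a, 'a) filt_mod \<Rightarrow> bool" where
  "graded_algebra A \<longleftrightarrow>
     ring A \<and> weight_graded_space A \<and>
     (\<forall>c. \<forall>a\<in>carrier A. \<forall>b\<in>carrier A.
        (c \<odot>\<^bsub>A\<^esub> a) \<otimes>\<^bsub>A\<^esub> b = c \<odot>\<^bsub>A\<^esub> (a \<otimes>\<^bsub>A\<^esub> b) \<and> a \<otimes>\<^bsub>A\<^esub> (c \<odot>\<^bsub>A\<^esub> b) = c \<odot>\<^bsub>A\<^esub> (a \<otimes>\<^bsub>A\<^esub> b)) \<and>
     \<one>\<^bsub>A\<^esub> \<in> wgt A 0 \<and>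
     (\<forall>m\<in>half_ints. \<forall>n\<in>half_ints. \<forall>a\<in>wgt A m. \<forall>b\<in>wgt A n. a \<otimes>\<^bsub>A\<^esub> b \<in> wgt A (m + n))"

definition graded_module :: "('a, 'a) filt_mod \<Rightarrow> ('a, 'x) filt_mod \<Rightarrow> bool" where
  "graded_module A X \<longleftrightarrow>
     graded_algebra A \<and> weight_graded_space X \<and>
     (\<forall>a\<in>carrier A. linear_map X X (act X a)) \<and>
     (\<forall>x\<in>carrier X. linear_map A X (\<lambda>a. act X a x)) \<and>
     (\<forall>a\<in>carrier A. \<forall>b\<in>carrier A. \<forall>x\<in>carrier X.
        act X (a \<otimes>\<^bsub>A\<^esub> b) x = act X a (act X b x)) \<and>
     (\<forall>x\<in>carrier X. act X \<one>\<^bsub>A\<^esub> x = x) \<and>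
     (\<forall>m\<in>half_ints. \<forall>n\<in>half_ints. \<forall>a\<in>wgt A m. \<forall>x\<in>wgt X n. act X a x \<in> wgt X (m + n))"

definition graded_module_hom ::
  "('a, 'a) filt_mod \<Rightarrow> ('a, 'x) filt_mod \<Rightarrow> ('a, 'y) filt_mod \<Rightarrow> ('x \<Rightarrow> 'y) \<Rightarrow> bool" where
  "graded_module_hom A X Y f \<longleftrightarrow>
     graded_module A X \<and> graded_module A Y \<and> linear_map X Y f \<and>
     (\<forall>a\<in>carrier A. \<forall>x\<in>carrier X. f (act X a x) = act Y a (f x)) \<and>
     (\<forall>n\<in>half_ints. f ` wgt X n \<subseteq> wgt Y n)"

definition diff_filt_space :: "('b, 'a) filt_mod \<Rightarrow> bool" where
  "diff_filt_space X \<longleftrightarrow>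
     Module.module complex_ring X \<and> (\<forall>i. is_subspace X (fil X i)) \<and>
     (\<forall>i j. i \<le> j \<longrightarrow> fil X i \<subseteq> fil X j) \<and>
     (\<Inter>i. fil X i) = {\<zero>\<^bsub>X\<^esub>} \<and> (\<Union>i. fil X i) = carrier X \<and>
     linear_map X X (dif X) \<and>
     (\<forall>i. dif X ` fil X i \<subseteq> fil X (i + 1)) \<and>
     (\<forall>i. (dif X \<circ> dif X) ` fil X i \<subseteq> fil X (i + 1))"

definition fil_degree :: "('b, 'a) filt_mod \<Rightarrow> 'a \<Rightarrow> int" where
  "fil_degree X x = (LEAST i. x \<in> fil X i)"

definition diff_filt_algebra :: "('a, 'a) filt_mod \<Rightarrow> bool" where
  "diff_filt_algebra A \<longleftrightarrow>
     diff_filt_space A \<and> ring A \<and>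
     (\<forall>c. \<forall>a\<in>carrier A. \<forall>b\<in>carrier A.
        (c \<odot>\<^bsub>A\<^esub> a) \<otimes>\<^bsub>A\<^esub> b = c \<odot>\<^bsub>A\<^esub> (a \<otimes>\<^bsub>A\<^esub> b) \<and> a \<otimes>\<^bsub>A\<^esub> (c \<odot>\<^bsub>A\<^esub> b) = c \<odot>\<^bsub>A\<^esub> (a \<otimes>\<^bsub>A\<^esub> b)) \<and>
     (\<forall>i j. \<forall>a\<in>fil A i. \<forall>b\<in>fil A j. a \<otimes>\<^bsub>A\<^esub> b \<in> fil A (i + j)) \<and>
     (\<forall>a\<in>carrier A - {\<zero>\<^bsub>A\<^esub>}. \<forall>b\<in>carrier A - {\<zero>\<^bsub>A\<^esub>}.
        dif A (a \<otimes>\<^bsub>A\<^esub> b) \<ominus>\<^bsub>A\<^esub>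
          (dif A a \<otimes>\<^bsub>A\<^esub> b \<oplus>\<^bsub>A\<^esub> ((-1) powi fil_degree A a) \<odot>\<^bsub>A\<^esub> (a \<otimes>\<^bsub>A\<^esub> dif A b))
        \<in> fil A (fil_degree A a + fil_degree A b))"

definition diff_filt_module :: "('a, 'a) filt_mod \<Rightarrow> ('a, 'x) filt_mod \<Rightarrow> bool" where
  "diff_filt_module A X \<longleftrightarrow>
     diff_filt_algebra A \<and> diff_filt_space X \<and>
     (\<forall>a\<in>carrier A. linear_map X X (act X a)) \<and>
     (\<forall>x\<in>carrier X. linear_map A X (\<lambda>a. act X a x)) \<and>
     (\<forall>a\<in>carrier A. \<forall>b\<in>carrier A. \<forall>x\<in>carrier X.
        act X (a \<otimes>\<^bsub>A\<^esub> b) x = act X a (act X b x)) \<and>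
     (\<forall>x\<in>carrier X. act X \<one>\<^bsub>A\<^esub> x = x) \<and>
     (\<forall>i j. \<forall>a\<in>fil A i. \<forall>x\<in>fil X j. act X a x \<in> fil X (i + j)) \<and>
     (\<forall>a\<in>carrier A - {\<zero>\<^bsub>A\<^esub>}. \<forall>x\<in>carrier X - {\<zero>\<^bsub>X\<^esub>}.
        dif X (act X a x) \<ominus>\<^bsub>X\<^esub>
          (act X (dif A a) x \<oplus>\<^bsub>X\<^esub> ((-1) powi fil_degree A a) \<odot>\<^bsub>X\<^esub> act X a (dif X x))
        \<in> fil X (fil_degree A a + fil_degree X x))"

text \<open>Weight grading, filtration and differential are compatible: the differential preserves
  weights and every filtration step is spanned by its weight homogeneous elements.\<close>

definition weight_compatible :: "('b, 'a) filt_mod \<Rightarrow> bool" where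
  "weight_compatible X \<longleftrightarrow>
     (\<forall>n\<in>half_ints. dif X ` wgt X n \<subseteq> wgt X n) \<and>
     (\<forall>i. fil X i = span_of X (\<Union>n\<in>half_ints. fil X i \<inter> wgt X n))"

definition graded_diff_filt_module :: "('a, 'a) filt_mod \<Rightarrow> ('a, 'x) filt_mod \<Rightarrow> bool" where
  "graded_diff_filt_module A X \<longleftrightarrow>
     graded_module A X \<and> diff_filt_module A X \<and> weight_compatible A \<and> weight_compatible X"

definition graded_diff_filt_module_hom ::
  "('a, 'a) filt_mod \<Rightarrow> ('a, 'x) filt_mod \<Rightarrow> ('a, 'y) filt_mod \<Rightarrow> ('x \<Rightarrow> 'y) \<Rightarrow> bool" where
  "graded_diff_filt_module_hom A X Y f \<longleftrightarrow>
     graded_diff_filt_module A X \<and> graded_diff_filt_module A Y \<and> graded_module_hom A X Y f \<and>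
     (\<forall>i. f ` fil X i \<subseteq> fil Y i) \<and>
     (\<forall>i. (\<lambda>x. f (dif X x) \<ominus>\<^bsub>Y\<^esub> dif Y (f x)) ` fil X i \<subseteq> fil Y i)"


section \<open>Quotients and associated graded spaces\<close>

text \<open>Elements of quotients are cosets. A map on representatives is descended to cosets by taking
  the union of the cosets of all its values, which is a single coset precisely when the map is
  well defined on classes.\<close>

definition descend ::
  "(complex, 'y, 'z) module_scheme \<Rightarrow> 'y set \<Rightarrow> ('x \<Rightarrow> 'y) \<Rightarrow> 'x set \<Rightarrow> 'y set" where
  "descend Y K f C = (\<Union>x\<in>C. K +>\<^bsub>Y\<^esub> f x)"

definition descend2 ::
  "(complex, 'y, 'z) module_scheme \<Rightarrow> 'y set \<Rightarrow> ('a \<Rightarrow> 'x \<Rightarrow> 'y) \<Rightarrow> 'a set \<Rightarrow> 'x set \<Rightarrow> 'y set" where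
  "descend2 Y K f B C = (\<Union>a\<in>B. \<Union>x\<in>C. K +>\<^bsub>Y\<^esub> f a x)"

definition quotient_by :: "('b, 'a) filt_mod \<Rightarrow> 'a set \<Rightarrow> ('c \<Rightarrow> 'a set \<Rightarrow> 'a set) \<Rightarrow> ('c, 'a set) filt_mod"
  where
  "quotient_by X H ac = \<lparr>carrier = a_rcosets\<^bsub>X\<^esub> H, mult = undefined, one = undefined,
     zero = H, add = set_add X, smult = (\<lambda>c. descend X H (\<lambda>x. c \<odot>\<^bsub>X\<^esub> x)),
     act = ac,
     fil = (\<lambda>p. (\<lambda>x. H +>\<^bsub>X\<^esub> x) ` fil X p),
     dif = descend X H (dif X),
     wgt = (\<lambda>n. (\<lambda>x. H +>\<^bsub>X\<^esub> x) ` wgt X n)\<rparr>"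

definition as_algebra :: "('a, 'a) filt_mod \<Rightarrow> 'a \<Rightarrow> ('a, 'a) filt_mod" where
  "as_algebra X e = X\<lparr>mult := act X, one := e\<rparr>"

text \<open>In the next five definitions \<open>wgt X\<close> is an increasing filtration by weight; the field
  \<open>wgt\<close> of the resulting \<open>gr A X\<close> is a grading.\<close>

definition wgt_below :: "('b, 'a) filt_mod \<Rightarrow> rat \<Rightarrow> 'a set" where
  "wgt_below X n = (\<Union>m\<in>{m\<in>half_ints. m < n}. wgt X m)"

definition gr_piece :: "('b, 'a) filt_mod \<Rightarrow> rat \<Rightarrow> ('b, 'a set) filt_mod" where
  "gr_piece X n =
     quotient_by (X\<lparr>carrier := wgt X n, fil := (\<lambda>p. fil X p \<inter> wgt X n)\<rparr>) (wgt_below X n) undefined"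

text \<open>The product of the components of weights \<open>i\<close> and \<open>n - i\<close> lies in weight \<open>n\<close>; only finitely
  many \<open>i\<close> contribute.\<close>

definition gr_act :: "('b, 'b) filt_mod \<Rightarrow> ('b, 'a) filt_mod \<Rightarrow>
    (rat \<Rightarrow> 'b set) \<Rightarrow> (rat \<Rightarrow> 'a set) \<Rightarrow> (rat \<Rightarrow> 'a set)" where
  "gr_act A X f g = (\<lambda>n\<in>half_ints.
     \<Oplus>\<^bsub>gr_piece X n\<^esub>i\<in>{i\<in>half_ints. f i \<noteq> \<zero>\<^bsub>gr_piece A i\<^esub> \<and> g (n - i) \<noteq> \<zero>\<^bsub>gr_piece X (n - i)\<^esub>}.
       descend2 X (wgt_below X n) (act X) (f i) (g (n - i)))"

definition gr :: "('b, 'b) filt_mod \<Rightarrow> ('b, 'a) filt_mod \<Rightarrow> (rat \<Rightarrow> 'b set, rat \<Rightarrow> 'a set) filt_mod" where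
  "gr A X =
     (let C = {f \<in> (\<Pi>\<^sub>E n\<in>half_ints. carrier (gr_piece X n)).
                 finite {n\<in>half_ints. f n \<noteq> \<zero>\<^bsub>gr_piece X n\<^esub>}}
      in \<lparr>carrier = C, mult = undefined, one = undefined,
          zero = (\<lambda>n\<in>half_ints. \<zero>\<^bsub>gr_piece X n\<^esub>),
          add = (\<lambda>f g. \<lambda>n\<in>half_ints. f n \<oplus>\<^bsub>gr_piece X n\<^esub> g n),
          smult = (\<lambda>c f. \<lambda>n\<in>half_ints. c \<odot>\<^bsub>gr_piece X n\<^esub> f n),
          act = gr_act A X,
          fil = (\<lambda>p. {f \<in> C. \<forall>n\<in>half_ints. f n \<in> fil (gr_piece X n) p}),
          dif = (\<lambda>f. \<lambda>n\<in>half_ints. dif (gr_piece X n) (f n)),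
          wgt = (\<lambda>k. {f \<in> C. \<forall>n\<in>half_ints. n \<noteq> k \<longrightarrow> f n = \<zero>\<^bsub>gr_piece X n\<^esub>})\<rparr>)"

definition gr_single :: "('b, 'a) filt_mod \<Rightarrow> rat \<Rightarrow> 'a \<Rightarrow> (rat \<Rightarrow> 'a set)" where
  "gr_single X n x =
     (\<lambda>k\<in>half_ints. if k = n then wgt_below X n +>\<^bsub>X\<^esub> x else \<zero>\<^bsub>gr_piece X k\<^esub>)"


section \<open>The \<open>C\<^sub>2\<close>-algebra and the Zhu algebra with their modules\<close>

definition mod_deg_le :: "('v, 'm::ab_group_add) dg_mod \<Rightarrow> int \<Rightarrow> 'm set" where
  "mod_deg_le M p = module.span (mod_scale M) (\<Union>q\<in>{..p}. mod_deg M q)"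

definition mod_wt_le :: "('v, 'm::ab_group_add) dg_mod \<Rightarrow> rat \<Rightarrow> 'm set" where
  "mod_wt_le M n = module.span (mod_scale M) (\<Union>k\<in>{k\<in>half_ints. k \<le> n}. mod_wt M k)"

definition underlying ::
  "('v, 'm::ab_group_add) dg_mod \<Rightarrow> (rat \<Rightarrow> 'm set) \<Rightarrow> (unit, 'm) filt_mod" where
  "underlying M W = \<lparr>carrier = mod_space M, mult = undefined, one = undefined, zero = 0,
     add = (+), smult = mod_scale M, act = undefined, fil = mod_deg_le M, dif = mod_diff M, wgt = W\<rparr>"

definition C2 :: "('v, 'm::ab_group_add) dg_mod \<Rightarrow> 'm set" where
  "C2 M = module.span (mod_scale M) {mod_Y M v (-2) x | v x. x \<in> mod_space M}"

definition R_mod ::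
  "('v::ab_group_add, 'z) dg_voa_scheme \<Rightarrow> ('v, 'm::ab_group_add) dg_mod \<Rightarrow> ('v set, 'm set) filt_mod"
  where
  "R_mod V M = quotient_by (underlying M (mod_wt M)) (C2 M)
     (descend2 (underlying M (mod_wt M)) (C2 M) (\<lambda>v. mod_Y M v (-1)))"

definition R_class :: "('v, 'm::ab_group_add) dg_mod \<Rightarrow> 'm \<Rightarrow> 'm set" where
  "R_class M x = C2 M +>\<^bsub>underlying M (mod_wt M)\<^esub> x"

definition R_alg :: "('v::ab_group_add, 'z) dg_voa_scheme \<Rightarrow> ('v set, 'v set) filt_mod" where
  "R_alg V = as_algebra (R_mod V (adjoint_module V)) (R_class (adjoint_module V) (va_vac V))"

text \<open>For \<open>u\<close> of weight \<open>r\<close> this is the sum over \<open>k\<close> of \<open>(r choose k) u\<^bsub>k-j\<^esub> x\<close>, extended linearly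
  in \<open>u\<close>: the product \<open>u \<ast>\<^sub>l x\<close> for \<open>j = 1\<close> and \<open>u \<circ> x\<close> for \<open>j = 2\<close>.\<close>

definition zhu_prod :: "('v::ab_group_add, 'z) dg_voa_scheme \<Rightarrow> ('v, 'm::ab_group_add) dg_mod \<Rightarrow>
    int \<Rightarrow> 'v \<Rightarrow> 'm \<Rightarrow> 'm" where
  "zhu_prod V M j u x =
     Sum_any (\<lambda>r::rat. Sum_any (\<lambda>k::nat. mod_scale M (of_rat r gchoose k)
       (mod_Y M (component half_ints (voa_wt V) u r) (int k - j) x)))"

definition zhu_O :: "('v::ab_group_add, 'z) dg_voa_scheme \<Rightarrow> ('v, 'm::ab_group_add) dg_mod \<Rightarrow> 'm set"
  where
  "zhu_O V M = module.span (mod_scale M) {zhu_prod V M 2 u x | u x. x \<in> mod_space M}"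

definition A_mod ::
  "('v::ab_group_add, 'z) dg_voa_scheme \<Rightarrow> ('v, 'm::ab_group_add) dg_mod \<Rightarrow> ('v set, 'm set) filt_mod"
  where
  "A_mod V M = quotient_by (underlying M (mod_wt_le M)) (zhu_O V M)
     (descend2 (underlying M (mod_wt_le M)) (zhu_O V M) (zhu_prod V M 1))"

definition A_class ::
  "('v::ab_group_add, 'z) dg_voa_scheme \<Rightarrow> ('v, 'm::ab_group_add) dg_mod \<Rightarrow> 'm \<Rightarrow> 'm set" where
  "A_class V M x = zhu_O V M +>\<^bsub>underlying M (mod_wt_le M)\<^esub> x"

definition A_unit :: "('v::ab_group_add, 'z) dg_voa_scheme \<Rightarrow> 'v set" where
  "A_unit V = A_class V (adjoint_module V) (va_vac V)"

definition A_alg :: "('v::ab_group_add, 'z) dg_voa_scheme \<Rightarrow> ('v set, 'v set) filt_mod" where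
  "A_alg V = as_algebra (A_mod V (adjoint_module V)) (A_unit V)"

definition grA_alg ::
  "('v::ab_group_add, 'z) dg_voa_scheme \<Rightarrow> (rat \<Rightarrow> 'v set set, rat \<Rightarrow> 'v set set) filt_mod" where
  "grA_alg V = as_algebra (gr (A_alg V) (A_alg V)) (gr_single (A_alg V) 0 (A_unit V))"

definition grA_mod :: "('v::ab_group_add, 'z) dg_voa_scheme \<Rightarrow> ('v, 'm::ab_group_add) dg_mod \<Rightarrow>
    (rat \<Rightarrow> 'v set set, rat \<Rightarrow> 'm set set) filt_mod" where
  "grA_mod V M = gr (A_alg V) (A_mod V M)"


section \<open>The functors\<close>

text \<open>The class of \<open>u\<close> in \<open>R(V)\<close> is sent to the family of the classes of the weight components
  of \<open>u\<close>.\<close>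

definition eta :: "('v::ab_group_add, 'z) dg_voa_scheme \<Rightarrow> 'v set \<Rightarrow> (rat \<Rightarrow> 'v set set)" where
  "eta V C = (\<lambda>n\<in>half_ints. descend (A_alg V) (wgt_below (A_alg V) n)
     (\<lambda>u. A_class V (adjoint_module V) (component half_ints (voa_wt V) u n)) C)"

definition eta_ker :: "('v::ab_group_add, 'z) dg_voa_scheme \<Rightarrow> 'v set set" where
  "eta_ker V = {r \<in> carrier (R_alg V). eta V r = \<zero>\<^bsub>grA_alg V\<^esub>}"

definition eta_ker_times ::
  "('v::ab_group_add, 'z) dg_voa_scheme \<Rightarrow> ('v set, 'w) filt_mod \<Rightarrow> 'w set" where
  "eta_ker_times V W = span_of W {act W r w | r w. r \<in> eta_ker V \<and> w \<in> carrier W}"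

text \<open>The base change of an \<open>R(V)\<close>-module \<open>W\<close> along the surjection \<open>eta V\<close>, realised as
  \<open>W\<close> modulo \<open>(Ker eta) W\<close>; an element of the target of \<open>eta V\<close> acts through its preimages.\<close>

definition eta_mod :: "('v::ab_group_add, 'z) dg_voa_scheme \<Rightarrow> ('v set, 'w) filt_mod \<Rightarrow>
    (rat \<Rightarrow> 'v set set, 'w set) filt_mod" where
  "eta_mod V W = quotient_by W (eta_ker_times V W)
     (\<lambda>a C. \<Union>r\<in>{r \<in> carrier (R_alg V). eta V r = a}. descend W (eta_ker_times V W) (act W r) C)"

definition eta_map :: "('v::ab_group_add, 'z) dg_voa_scheme \<Rightarrow> ('v set, 'w) filt_mod \<Rightarrow>
    ('w \<Rightarrow> 'w) \<Rightarrow> 'w set \<Rightarrow> 'w set" where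
  "eta_map V W' f = descend W' (eta_ker_times V W') f"

definition R_map :: "('v, 'm::ab_group_add) dg_mod \<Rightarrow> ('m \<Rightarrow> 'm) \<Rightarrow> 'm set \<Rightarrow> 'm set" where
  "R_map N f = descend (underlying N (mod_wt N)) (C2 N) f"

definition A_map :: "('v::ab_group_add, 'z) dg_voa_scheme \<Rightarrow> ('v, 'm::ab_group_add) dg_mod \<Rightarrow>
    ('m \<Rightarrow> 'm) \<Rightarrow> 'm set \<Rightarrow> 'm set" where
  "A_map V N f = descend (underlying N (mod_wt_le N)) (zhu_O V N) f"

definition gr_map :: "('b, 'a) filt_mod \<Rightarrow> ('a \<Rightarrow> 'a) \<Rightarrow> (rat \<Rightarrow> 'a set) \<Rightarrow> (rat \<Rightarrow> 'a set)" where
  "gr_map Y f g = (\<lambda>n\<in>half_ints. descend Y (wgt_below Y n) f (g n))"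

definition etaR_mod :: "('v::ab_group_add, 'z) dg_voa_scheme \<Rightarrow> ('v, 'm::ab_group_add) dg_mod \<Rightarrow>
    (rat \<Rightarrow> 'v set set, 'm set set) filt_mod" where
  "etaR_mod V M = eta_mod V (R_mod V M)"

definition etaR_map :: "('v::ab_group_add, 'z) dg_voa_scheme \<Rightarrow> ('v, 'm::ab_group_add) dg_mod \<Rightarrow>
    ('v, 'm) dg_mod \<Rightarrow> ('m \<Rightarrow> 'm) \<Rightarrow> 'm set set \<Rightarrow> 'm set set" where
  "etaR_map V M N f = eta_map V (R_mod V N) (R_map N f)"

definition grA_map :: "('v::ab_group_add, 'z) dg_voa_scheme \<Rightarrow> ('v, 'm::ab_group_add) dg_mod \<Rightarrow>
    ('v, 'm) dg_mod \<Rightarrow> ('m \<Rightarrow> 'm) \<Rightarrow> (rat \<Rightarrow> 'm set set) \<Rightarrow> (rat \<Rightarrow> 'm set set)" where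
  "grA_map V M N f = gr_map (A_mod V N) (A_map V N f)"

text \<open>\<open>F0\<close>, \<open>F1\<close> are the object and morphism parts of a functor from the category of graded dg
  \<open>V\<close>-modules to the category of graded \<open>A\<close>-modules. Morphisms are functions considered on
  the carriers only.\<close>

definition functor_to_graded_modules ::
  "('v::ab_group_add, 'z) dg_voa_scheme \<Rightarrow> ('a, 'a) filt_mod \<Rightarrow>
   (('v, 'm::ab_group_add) dg_mod \<Rightarrow> ('a, 'x) filt_mod) \<Rightarrow>
   (('v, 'm) dg_mod \<Rightarrow> ('v, 'm) dg_mod \<Rightarrow> ('m \<Rightarrow> 'm) \<Rightarrow> 'x \<Rightarrow> 'x) \<Rightarrow> bool" where
  "functor_to_graded_modules V A F0 F1 \<longleftrightarrow>
     (\<forall>M. graded_dg_module V M \<longrightarrow> graded_module A (F0 M)) \<and>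
     (\<forall>M N f. graded_dg_module V M \<and> graded_dg_module V N \<and> graded_dg_module_hom M N f \<longrightarrow>
        graded_module_hom A (F0 M) (F0 N) (F1 M N f)) \<and>
     (\<forall>M. graded_dg_module V M \<longrightarrow> (\<forall>x\<in>carrier (F0 M). F1 M M id x = x)) \<and>
     (\<forall>L M N f g. graded_dg_module V L \<and> graded_dg_module V M \<and> graded_dg_module V N \<and>
        graded_dg_module_hom L M f \<and> graded_dg_module_hom M N g \<longrightarrow>
        (\<forall>x\<in>carrier (F0 L). F1 L N (g \<circ> f) x = F1 M N g (F1 L M f x)))"

definition natural_transformation ::
  "('v::ab_group_add, 'z) dg_voa_scheme \<Rightarrow> ('a, 'a) filt_mod \<Rightarrow>
   (('v, 'm::ab_group_add) dg_mod \<Rightarrow> ('a, 'x) filt_mod) \<Rightarrow>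
   (('v, 'm) dg_mod \<Rightarrow> ('v, 'm) dg_mod \<Rightarrow> ('m \<Rightarrow> 'm) \<Rightarrow> 'x \<Rightarrow> 'x) \<Rightarrow>
   (('v, 'm) dg_mod \<Rightarrow> ('a, 'y) filt_mod) \<Rightarrow>
   (('v, 'm) dg_mod \<Rightarrow> ('v, 'm) dg_mod \<Rightarrow> ('m \<Rightarrow> 'm) \<Rightarrow> 'y \<Rightarrow> 'y) \<Rightarrow>
   (('v, 'm) dg_mod \<Rightarrow> 'x \<Rightarrow> 'y) \<Rightarrow> bool" where
  "natural_transformation V A F0 F1 G0 G1 \<phi> \<longleftrightarrow>
     functor_to_graded_modules V A F0 F1 \<and> functor_to_graded_modules V A G0 G1 \<and>
     (\<forall>M. graded_dg_module V M \<longrightarrow> graded_module_hom A (F0 M) (G0 M) (\<phi> M)) \<and>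
     (\<forall>M N f. graded_dg_module V M \<and> graded_dg_module V N \<and> graded_dg_module_hom M N f \<longrightarrow>
        (\<forall>x\<in>carrier (F0 M). \<phi> N (F1 M N f x) = G1 M N f (\<phi> M x)))"

definition etaR_class ::
  "('v::ab_group_add, 'z) dg_voa_scheme \<Rightarrow> ('v, 'm::ab_group_add) dg_mod \<Rightarrow> 'm \<Rightarrow> 'm set set" where
  "etaR_class V M x = eta_ker_times V (R_mod V M) +>\<^bsub>R_mod V M\<^esub> R_class M x"

end

theory Submission
  imports Defs "HOL-Computational_Algebra.Formal_Power_Series"
begin

text \<open>
  Zhu's products and the products of the \<open>C\<^sub>2\<close>-algebra are two members of one family. For \<open>u\<close> of
  weight \<open>r\<close> let \<open>u \<ast>\<^sub>t x\<close> and \<open>u \<circ>\<^sub>t x\<close> be the sums over \<open>k\<close> of \<open>t\<^sup>k (r choose k) u\<^bsub>k-1\<^esub> x\<close> and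
  \<open>t\<^sup>k (r choose k) u\<^bsub>k-2\<^esub> x\<close>, and let \<open>O\<^sub>t(M)\<close> be the span of all \<open>u \<circ>\<^sub>t x\<close>. Then \<open>t = 1\<close> gives
  \<open>A(M)\<close> and \<open>t = 0\<close> gives \<open>R(M)\<close>. Zhu's argument works for every \<open>t\<close>: the residue of the Jacobi
  identity times \<open>(1 + t z\<^sub>1)\<^sup>U (1 + t z\<^sub>2)\<^sup>W\<close>, lemma \<open>residue_jacobi\<close>, shows that \<open>O\<^sub>t\<close> is stable under
  products on both sides and that the product is associative modulo \<open>O\<^sub>t\<close> (\<open>dO_dprod\<close>, \<open>dprod_dO\<close>,
  \<open>associator\<close>).

  With respect to the weight, \<open>u \<ast> x\<close> has leading term \<open>u\<^bsub>-1\<^esub> x\<close> and \<open>u \<circ> x\<close> has leading term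
  \<open>u\<^bsub>-2\<^esub> x\<close> (\<open>dprod_leading_term\<close>). The map that sends a vector to the classes of its weight
  components is therefore a surjection from \<open>M\<close> onto the associated graded space of \<open>A(M)\<close> which
  kills \<open>C\<^sub>2(M)\<close> and under which the action becomes \<open>u\<^bsub>-1\<^esub> x\<close> (\<open>C2_gr_ker\<close>, \<open>act_gr\<close>). It also kills
  \<open>u\<^bsub>-1\<^esub> x\<close> whenever the corresponding map kills \<open>u\<close>, that is, it kills the product of \<open>Ker eta\<close>
  with \<open>R(M)\<close>. So both functors send \<open>M\<close> to a quotient of the space \<open>M\<close>, with all structure induced
  from \<open>M\<close> by the same formulas, and the first kernel is contained in the second. The natural
  transformation is the projection between these quotients, and it is surjective.

  Since the structure is the same in all cases, the axioms of weight graded differential filtered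
  algebras and modules are verified once, for any quotient of \<open>M\<close> by a bigraded subspace containing
  \<open>C\<^sub>2(M)\<close> (\<open>module_presentation\<close>): products are associative because they are so modulo \<open>C\<^sub>2\<close>, and the
  filtration by degree is separated because the kernel is bigraded. The latter is the delicate
  point for the Zhu algebra, as \<open>O(M)\<close> is homogeneous neither for the weight nor for the degree. It
  is homogeneous for \<open>deg - 2 wt\<close>, which is additive under all modes, and within one weight this
  invariant determines the degree. Hence the kernel is bigraded (\<open>gr_ker_part\<close>), and a class of weight \<open>n\<close> in
  the \<open>p\<close>-th step of the filtration has a representative of weight \<open>n\<close> and degree at most \<open>p\<close>
  (\<open>piece_fil_lift\<close>).
\<close>

section \<open>Direct sum decompositions\<close>

locale decomposed = vector_space s
  for s :: "complex \<Rightarrow> 'a::ab_group_add \<Rightarrow> 'a" +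
  fixes I :: "'i set" and S :: "'i \<Rightarrow> 'a set" and U :: "'a set"
  assumes decomposition: "direct_decomposition s I S U"
begin

abbreviation part :: "'a \<Rightarrow> 'i \<Rightarrow> 'a" where
  "part \<equiv> component I S"

lemma subspace_U: "subspace U"
  and subspace_S: "i \<in> I \<Longrightarrow> subspace (S i)"
  and S_subset: "i \<in> I \<Longrightarrow> S i \<subseteq> U"
  and ex1_components: "x \<in> U \<Longrightarrow> \<exists>!f. components I S x f"
  using decomposition by (auto simp: direct_decomposition_def)

lemma U_add: "x \<in> U \<Longrightarrow> y \<in> U \<Longrightarrow> x + y \<in> U"
  and U_diff: "x \<in> U \<Longrightarrow> y \<in> U \<Longrightarrow> x - y \<in> U"
  and U_scale: "x \<in> U \<Longrightarrow> s c x \<in> U"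
  and U_zero: "0 \<in> U"
  and U_uminus: "x \<in> U \<Longrightarrow> - x \<in> U"
  and U_sum: "(\<And>j. j \<in> J \<Longrightarrow> g j \<in> U) \<Longrightarrow> sum g J \<in> U"
  using subspace_U by (auto simp: subspace_add subspace_diff subspace_scale subspace_0 subspace_neg
      intro: subspace_sum)

lemma components_part: "x \<in> U \<Longrightarrow> components I S x (part x)"
  unfolding component_def by (rule theI'[OF ex1_components])

lemma part_unique: "x \<in> U \<Longrightarrow> components I S x f \<Longrightarrow> part x = f"
  using ex1_components components_part by blast

lemma part_in: "x \<in> U \<Longrightarrow> i \<in> I \<Longrightarrow> part x i \<in> S i"
  and part_outside: "x \<in> U \<Longrightarrow> i \<notin> I \<Longrightarrow> part x i = 0"
  and finite_part: "x \<in> U \<Longrightarrow> finite {i. part x i \<noteq> 0}"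
  using components_part by (auto simp: components_def)

lemma part_in_U: "x \<in> U \<Longrightarrow> part x i \<in> U"
  using part_in part_outside S_subset U_zero by (metis subsetD)

lemma sum_part: "x \<in> U \<Longrightarrow> sum (part x) {i. part x i \<noteq> 0} = x"
  using components_part by (simp add: components_def Sum_any.expand_set)

lemma part_sum:
  assumes "finite J" "\<And>i. i \<in> J \<Longrightarrow> i \<in> I" "\<And>i. i \<in> J \<Longrightarrow> g i \<in> S i"
  shows "part (sum g J) i = (if i \<in> J then g i else 0)"
proof -
  let ?f = "\<lambda>i. if i \<in> J then g i else 0"
  have "sum g J \<in> U" using assms S_subset by (intro U_sum) blast
  moreover have "components I S (sum g J) ?f"
    unfolding components_def
  proof (intro conjI ballI allI impI)
    fix i assume "i \<in> I" then show "?f i \<in> S i"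
      using assms subspace_S subspace_0 by auto
  next
    show "finite {i. ?f i \<noteq> 0}" by (rule finite_subset[OF _ assms(1)]) auto
    show "sum g J = Sum_any ?f" by (rule Sum_any.conditionalize[OF assms(1)])
  qed (use assms in auto)
  ultimately have "part (sum g J) = ?f" by (rule part_unique)
  then show ?thesis by simp
qed

lemma part_homogeneous:
  assumes "i \<in> I" "x \<in> S i" shows "part x j = (if j = i then x else 0)"
  using part_sum[of "{i}" "\<lambda>_. x" j] assms by simp

lemma part_zero [simp]: "part 0 i = 0"
  using part_sum[of "{}" "\<lambda>_. 0"] by simp

lemma part_add:
  assumes "x \<in> U" "y \<in> U" shows "part (x + y) i = part x i + part y i"
proof -
  let ?f = "\<lambda>i. part x i + part y i"
  have "components I S (x + y) ?f"
    unfolding components_def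
  proof (intro conjI ballI allI impI)
    fix i assume "i \<in> I" then show "?f i \<in> S i"
      using assms part_in subspace_S subspace_add by auto
  next
    show "finite {i. ?f i \<noteq> 0}"
      by (rule finite_subset[of _ "{i. part x i \<noteq> 0} \<union> {i. part y i \<noteq> 0}"])
        (use assms finite_part in auto)
    show "x + y = Sum_any ?f"
      using assms components_part finite_part by (simp add: Sum_any.distrib components_def)
  qed (use assms part_outside in auto)
  then have "part (x + y) = ?f" using assms by (intro part_unique U_add)
  then show ?thesis by simp
qed

lemma part_scale:
  assumes "x \<in> U" shows "part (s c x) i = s c (part x i)"
proof -
  have "components I S (s c x) (\<lambda>i. s c (part x i))"
    unfolding components_def
  proof (intro conjI ballI allI impI)
    fix i assume "i \<in> I" then show "s c (part x i) \<in> S i"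
      using assms part_in subspace_S subspace_scale by auto
  next
    have sub: "{i. s c (part x i) \<noteq> 0} \<subseteq> {i. part x i \<noteq> 0}" by auto
    then show "finite {i. s c (part x i) \<noteq> 0}"
      using assms finite_part finite_subset by blast
    have "s c x = s c (sum (part x) {i. part x i \<noteq> 0})" using assms sum_part by simp
    also have "\<dots> = (\<Sum>i | part x i \<noteq> 0. s c (part x i))" by (simp add: scale_sum_right)
    also have "\<dots> = (\<Sum>i. s c (part x i))"
      using sub assms by (intro Sum_any.expand_superset[symmetric] finite_part)
    finally show "s c x = (\<Sum>i. s c (part x i))" .
  qed (use assms part_outside in auto)
  then have "part (s c x) = (\<lambda>i. s c (part x i))" using assms by (intro part_unique U_scale)
  then show ?thesis by simp
qed

lemma part_diff:
  assumes "x \<in> U" "y \<in> U" shows "part (x - y) i = part x i - part y i"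
  using part_add[of "x - y" y i] assms U_diff by simp

lemma part_sum_general:
  assumes "\<And>j. j \<in> J \<Longrightarrow> g j \<in> U"
  shows "part (sum g J) i = (\<Sum>j\<in>J. part (g j) i)"
  using assms
proof (induction J rule: infinite_finite_induct)
  case (insert j J)
  then show ?case by (simp add: part_add U_sum)
qed auto

lemma part_part:
  assumes "x \<in> U" shows "part (part x i) j = (if j = i then part x i else 0)"
  using assms part_homogeneous part_in part_outside by (cases "i \<in> I") auto

lemma in_subspace_if_part:
  assumes "subspace K" "x \<in> U" "\<And>i. part x i \<in> K" shows "x \<in> K"
  using sum_part[OF assms(2)] subspace_sum[OF assms(1)] assms(3) by metis

definition proj :: "'i set \<Rightarrow> 'a \<Rightarrow> 'a" where
  "proj B x = sum (part x) ({i. part x i \<noteq> 0} \<inter> B)"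

definition supported :: "'i set \<Rightarrow> 'a set" where
  "supported B = {x \<in> U. \<forall>i. part x i \<noteq> 0 \<longrightarrow> i \<in> B}"

lemma part_proj:
  assumes "x \<in> U" shows "part (proj B x) i = (if i \<in> B then part x i else 0)"
proof -
  have I: "i \<in> I" if "part x i \<noteq> 0" for i using that assms part_outside by blast
  have "part (proj B x) i = (if i \<in> {i. part x i \<noteq> 0} \<inter> B then part x i else 0)"
    unfolding proj_def by (rule part_sum) (use assms finite_part I part_in in auto)
  then show ?thesis by auto
qed

lemma proj_in_U: "x \<in> U \<Longrightarrow> proj B x \<in> U"
  unfolding proj_def by (intro U_sum part_in_U)

lemma eq_by_part:
  assumes "x \<in> U" "y \<in> U" "\<And>i. part x i = part y i" shows "x = y"
proof -
  have eq: "part x = part y" using assms(3) by (rule ext)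
  have "x = sum (part x) {i. part x i \<noteq> 0}" using sum_part[OF assms(1)] by (rule sym)
  also have "\<dots> = y" unfolding eq by (rule sum_part[OF assms(2)])
  finally show ?thesis .
qed

lemma proj_add: "x \<in> U \<Longrightarrow> y \<in> U \<Longrightarrow> proj B (x + y) = proj B x + proj B y"
  by (rule eq_by_part) (auto simp: part_proj part_add proj_in_U U_add)

lemma proj_diff: "x \<in> U \<Longrightarrow> y \<in> U \<Longrightarrow> proj B (x - y) = proj B x - proj B y"
  by (rule eq_by_part) (auto simp: part_proj part_diff proj_in_U U_diff)

lemma proj_scale: "x \<in> U \<Longrightarrow> proj B (s c x) = s c (proj B x)"
  by (rule eq_by_part) (auto simp: part_proj part_scale proj_in_U U_scale)

lemma proj_in_supported: "x \<in> U \<Longrightarrow> proj B x \<in> supported B"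
  by (auto simp: supported_def part_proj proj_in_U)

lemma supportedD: "x \<in> supported B \<Longrightarrow> x \<in> U" "x \<in> supported B \<Longrightarrow> i \<notin> B \<Longrightarrow> part x i = 0"
  by (auto simp: supported_def)

lemma supported_iff_proj: "x \<in> supported B \<longleftrightarrow> x \<in> U \<and> proj B x = x"
proof
  assume x: "x \<in> supported B"
  then have 0: "part x i = 0" if "i \<notin> B" for i using that by (auto simp: supported_def)
  have "proj B x = x"
    by (rule eq_by_part) (use x 0 in \<open>auto simp: part_proj proj_in_U supported_def\<close>)
  then show "x \<in> U \<and> proj B x = x" using x by (simp add: supported_def)
next
  assume "x \<in> U \<and> proj B x = x"
  then show "x \<in> supported B" using proj_in_supported[of x B] by auto
qed

lemma proj_supported_disjoint: "x \<in> supported C \<Longrightarrow> B \<inter> C = {} \<Longrightarrow> proj B x = 0"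
  by (rule eq_by_part) (auto simp: part_proj U_zero proj_in_U supported_def)

lemma supported_mono: "B \<subseteq> C \<Longrightarrow> supported B \<subseteq> supported C"
  by (auto simp: supported_def)

lemma subspace_supported: "subspace (supported B)"
proof (rule subspaceI)
  show "0 \<in> supported B" by (simp add: supported_def U_zero)
  show "x + y \<in> supported B" if "x \<in> supported B" "y \<in> supported B" for x y
    using that unfolding supported_def by (auto simp: U_add part_add) (metis add_0)
  show "s c x \<in> supported B" if "x \<in> supported B" for c x
    using that unfolding supported_def by (auto simp: U_scale part_scale)
qed

lemmas supported_0 = subspace_0[OF subspace_supported]
  and supported_add = subspace_add[OF subspace_supported]

lemma homogeneous_supported: "i \<in> I \<Longrightarrow> S i = supported {i}"
proof (intro equalityI subsetI)
  fix x assume "i \<in> I" "x \<in> S i" then show "x \<in> supported {i}"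
    using S_subset by (auto simp: supported_def part_homogeneous split: if_splits)
next
  fix x assume i: "i \<in> I" "x \<in> supported {i}"
  then have "proj {i} x = x" "x \<in> U" by (auto simp: supported_iff_proj)
  moreover have "part x j \<in> S i" if "j = i" for j using that i part_in supportedD by blast
  ultimately show "x \<in> S i"
    using subspace_sum[OF subspace_S[OF i(1)]] unfolding proj_def by (metis IntD2 singletonD)
qed

lemma supported_induct [consumes 1, case_names zero add homogeneous]:
  assumes "x \<in> supported B" "P 0" "\<And>x y. x \<in> U \<Longrightarrow> y \<in> U \<Longrightarrow> P x \<Longrightarrow> P y \<Longrightarrow> P (x + y)"
    "\<And>i x. i \<in> I \<Longrightarrow> i \<in> B \<Longrightarrow> x \<in> S i \<Longrightarrow> P x"
  shows "P x"
proof -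
  have x: "x \<in> U" using assms(1) by (rule supportedD)
  have B: "part x i \<noteq> 0 \<Longrightarrow> i \<in> B" for i using assms(1) by (auto simp: supported_def)
  have "P (part x i)" for i
    using assms(2,4) part_in part_outside x B by (cases "i \<in> I \<and> part x i \<noteq> 0") auto
  note P_part = this
  have "P (sum (part x) J)" for J
  proof (induction J rule: infinite_finite_induct)
    case (insert i J)
    have "part x i \<in> U" "sum (part x) J \<in> U" using part_in_U[OF x] by (auto intro: U_sum)
    then show ?case using insert assms(3) P_part by simp
  qed (use assms(2) in auto)
  then show ?thesis using sum_part[OF x] by metis
qed

lemma homogeneous_induct [consumes 1, case_names zero add homogeneous]:
  assumes "x \<in> U" "P 0" "\<And>x y. x \<in> U \<Longrightarrow> y \<in> U \<Longrightarrow> P x \<Longrightarrow> P y \<Longrightarrow> P (x + y)"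
    "\<And>i x. i \<in> I \<Longrightarrow> x \<in> S i \<Longrightarrow> P x"
  shows "P x"
  using supported_induct[of x UNIV P] assms by (simp add: supported_def)

lemma proj_on_supported:
  assumes "x \<in> supported (h -` {z})"
  shows "proj (h -` Z) x = (if z \<in> Z then x else 0)"
proof (cases "z \<in> Z")
  case True
  then have "x \<in> supported (h -` Z)" using assms supported_mono[of "h -` {z}" "h -` Z"] by auto
  then show ?thesis using True by (simp add: supported_iff_proj)
next
  case False
  then show ?thesis using proj_supported_disjoint[OF assms, of "h -` Z"] by auto
qed

lemma span_supported: "span (\<Union>j\<in>J. supported (B j)) = supported (\<Union>j\<in>J. B j)"
proof (rule span_unique)
  show "(\<Union>j\<in>J. supported (B j)) \<subseteq> supported (\<Union>j\<in>J. B j)"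
    by (auto simp: supported_def)
  show "subspace (supported (\<Union>j\<in>J. B j))" by (rule subspace_supported)
  fix T assume T: "(\<Union>j\<in>J. supported (B j)) \<subseteq> T" "subspace T"
  show "supported (\<Union>j\<in>J. B j) \<subseteq> T"
  proof
    fix x assume x: "x \<in> supported (\<Union>j\<in>J. B j)"
    then have xU: "x \<in> U" by (rule supportedD)
    show "x \<in> T"
    proof (rule in_subspace_if_part[OF T(2) xU])
      fix i show "part x i \<in> T"
      proof (cases "part x i = 0")
        case True then show ?thesis using subspace_0[OF T(2)] by simp
      next
        case False
        then obtain j where "j \<in> J" "i \<in> B j" using x by (auto simp: supported_def)
        then have "part x i \<in> supported (B j)"
          using xU by (auto simp: supported_def part_part part_in_U split: if_splits)
        then show ?thesis using T \<open>j \<in> J\<close> by blast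
      qed
    qed
  qed
qed

lemma linear_span_mem:
  fixes f :: "'a \<Rightarrow> 'c::ab_group_add"
  assumes "y \<in> span G" "G \<subseteq> U" "\<And>g. g \<in> G \<Longrightarrow> f g \<in> K"
    and add: "\<And>x y. x \<in> U \<Longrightarrow> y \<in> U \<Longrightarrow> f (x + y) = f x + f y"
    and scale: "\<And>c x. x \<in> U \<Longrightarrow> f (s c x) = t c (f x)"
    and t: "vector_space t" and K: "module.subspace t K"
  shows "f y \<in> K"
proof -
  interpret T: vector_space t by fact
  have "y \<in> U \<and> f y \<in> K" using assms(1)
  proof (induction rule: span_induct_alt)
    case base
    have "f 0 = 0" using add[of 0 0] U_zero by simp
    then show ?case by (simp add: U_zero T.subspace_0[OF K])
  next
    case (step c g y)
    then have "g \<in> U" "f g \<in> K" using assms(2,3) by auto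
    then show ?case using step
      by (simp add: add scale U_add U_scale T.subspace_add[OF K] T.subspace_scale[OF K])
  qed
  then show ?thesis ..
qed

lemma proj_single: "proj {i} x = part x i"
proof -
  have "{j. part x j \<noteq> 0} \<inter> {i} = (if part x i = 0 then {} else {i})" by auto
  then show ?thesis by (simp add: proj_def)
qed


lemma proj_regroup:
  assumes "x \<in> U"
  shows "(\<Sum>j\<in>h ` {i. part x i \<noteq> 0}. proj (h -` {j}) x) = x"
proof -
  have "x = sum (part x) {i. part x i \<noteq> 0}" using assms by (simp add: sum_part)
  also have "\<dots> = (\<Sum>j\<in>h ` {i. part x i \<noteq> 0}. sum (part x) {i \<in> {i. part x i \<noteq> 0}. h i = j})"
    by (rule sum.image_gen[OF finite_part[OF assms]])
  also have "\<dots> = (\<Sum>j\<in>h ` {i. part x i \<noteq> 0}. proj (h -` {j}) x)"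
    unfolding proj_def by (intro sum.cong) auto
  finally show ?thesis ..
qed

text \<open>The map \<open>h\<close> assigns to an index of the given decomposition the index of the piece of a coarser
  decomposition that contains the summand. For the bigrading of a module, \<open>h\<close> is \<open>fst\<close> or \<open>snd\<close>.\<close>

lemma component_coarsening:
  assumes "direct_decomposition s J W U" "\<And>i. i \<in> I \<Longrightarrow> h i \<in> J \<and> S i \<subseteq> W (h i)" "x \<in> U"
  shows "component J W x j = proj (h -` {j}) x"
proof -
  interpret W: decomposed s J W U by unfold_locales (rule assms(1))
  let ?T = "h ` {i. part x i \<noteq> 0}"
  have fin: "finite ?T" using assms(3) finite_part by simp
  have supp: "i \<in> I" if "part x i \<noteq> 0" for i using that assms(3) part_outside by blast
  have TJ: "?T \<subseteq> J" using supp assms(2) by auto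
  have "part x i \<in> W k" if "part x i \<noteq> 0" "h i = k" for i k
    using that assms(2,3) supp part_in by blast
  then have "proj (h -` {k}) x \<in> W k" if "k \<in> ?T" for k
    unfolding proj_def using TJ that by (intro subspace_sum[OF W.subspace_S]) auto
  then have "W.part (\<Sum>k\<in>?T. proj (h -` {k}) x) j = (if j \<in> ?T then proj (h -` {j}) x else 0)"
    using fin TJ by (intro W.part_sum) auto
  moreover have "proj (h -` {j}) x = 0" if "j \<notin> ?T"
  proof -
    have "{i. part x i \<noteq> 0} \<inter> h -` {j} = {}" using that by auto
    then show ?thesis by (simp add: proj_def)
  qed
  ultimately show ?thesis using proj_regroup[OF assms(3), of h] by auto
qed

lemma coarsening_supported:
  assumes "direct_decomposition s J W U" "\<And>i. i \<in> I \<Longrightarrow> h i \<in> J \<and> S i \<subseteq> W (h i)" "j \<in> J"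
  shows "W j = supported (h -` {j})"
proof -
  interpret W: decomposed s J W U by unfold_locales (rule assms(1))
  have "x \<in> W j \<longleftrightarrow> x \<in> U \<and> W.part x j = x" for x
    using W.part_homogeneous[OF assms(3)] W.part_in assms(3) W.S_subset by (metis subsetD)
  then show ?thesis
    using component_coarsening[OF assms(1,2)] by (auto simp: supported_iff_proj)
qed

end

lemma direct_decompositionI:
  assumes "vector_space s" "module.subspace s U"
    and "\<And>i. i \<in> I \<Longrightarrow> module.subspace s (S i) \<and> S i \<subseteq> U"
    and ex: "\<And>x. x \<in> U \<Longrightarrow> \<exists>J g. finite J \<and> J \<subseteq> I \<and> (\<forall>i\<in>J. g i \<in> S i) \<and> x = sum g J"
    and indep: "\<And>J g i. finite J \<Longrightarrow> J \<subseteq> I \<Longrightarrow> (\<And>i. i \<in> J \<Longrightarrow> g i \<in> S i) \<Longrightarrow> sum g J = 0 \<Longrightarrow>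
      i \<in> J \<Longrightarrow> g i = 0"
  shows "direct_decomposition s I S U"
proof -
  interpret vector_space s by fact
  have "\<exists>!f. components I S x f" if x: "x \<in> U" for x
  proof -
    obtain J g where J: "finite J" "J \<subseteq> I" "\<forall>i\<in>J. g i \<in> S i" "x = sum g J" using ex[OF x] by blast
    let ?f = "\<lambda>i. if i \<in> J then g i else 0"
    have "components I S x ?f"
      unfolding components_def
    proof (intro conjI ballI allI impI)
      fix i assume "i \<in> I" then show "?f i \<in> S i" using J assms(3) subspace_0 by auto
    next
      show "finite {i. ?f i \<noteq> 0}" by (rule finite_subset[OF _ J(1)]) auto
      show "x = Sum_any ?f" using Sum_any.conditionalize[OF J(1)] J(4) by simp
    qed (use J in auto)
    moreover have "f = f'" if f: "components I S x f" "components I S x f'" for f f'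
    proof
      fix i
      let ?K = "{i. f i \<noteq> 0} \<union> {i. f' i \<noteq> 0}"
      have fin: "finite ?K" using f by (simp add: components_def)
      have "sum f ?K = x" "sum f' ?K = x"
        using f Sum_any.expand_superset[OF fin, of f] Sum_any.expand_superset[OF fin, of f']
        by (auto simp: components_def)
      then have "(\<Sum>i\<in>?K. f i - f' i) = 0" by (simp add: sum_subtractf)
      moreover have KI: "?K \<subseteq> I" using f by (auto simp: components_def)
      moreover have "f i - f' i \<in> S i" if "i \<in> ?K" for i
      proof -
        have "i \<in> I" using that KI by blast
        then have "subspace (S i)" "f i \<in> S i" "f' i \<in> S i" using f assms(3) by (auto simp: components_def)
        then show ?thesis by (rule subspace_diff)
      qed
      ultimately have "i \<in> ?K \<Longrightarrow> f i - f' i = 0" using indep[OF fin, of "\<lambda>i. f i - f' i"] by blast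
      then show "f i = f' i" by (cases "i \<in> ?K") auto
    qed
    ultimately show ?thesis by blast
  qed
  then show ?thesis using assms(2,3) by (auto simp: direct_decomposition_def)
qed

lemma direct_decomposition_refine:
  assumes vs: "vector_space s" and dI: "direct_decomposition s I W U"
    and dK: "\<And>i. i \<in> I \<Longrightarrow> direct_decomposition s K (\<lambda>k. W i \<inter> D k) (W i)"
  shows "direct_decomposition s (I \<times> K) (\<lambda>(i, k). W i \<inter> D k) U"
proof -
  interpret vector_space s by fact
  interpret W: decomposed s I W U by unfold_locales (rule dI)
  have dec: "decomposed s K (\<lambda>k. W i \<inter> D k) (W i)" if "i \<in> I" for i
    by unfold_locales (rule dK[OF that])
  show ?thesis
  proof (rule direct_decompositionI[OF vs W.subspace_U])
    fix j assume "j \<in> I \<times> K"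
    then show "subspace (case j of (i, k) \<Rightarrow> W i \<inter> D k) \<and> (case j of (i, k) \<Rightarrow> W i \<inter> D k) \<subseteq> U"
      using decomposed.subspace_S[OF dec] W.S_subset by auto
  next
    fix x assume x: "x \<in> U"
    let ?p = "\<lambda>i. component K (\<lambda>k. W i \<inter> D k) (W.part x i)"
    let ?J = "SIGMA i:{i. W.part x i \<noteq> 0}. {k. ?p i k \<noteq> 0}"
    have supp: "i \<in> I" if "W.part x i \<noteq> 0" for i using that x W.part_outside by blast
    have fin: "finite {k. ?p i k \<noteq> 0}" if "W.part x i \<noteq> 0" for i
      using decomposed.finite_part[OF dec] supp[OF that] W.part_in x by blast
    then have "finite ?J" using W.finite_part[OF x] by auto
    moreover have "\<And>i k. W.part x i \<noteq> 0 \<Longrightarrow> ?p i k \<noteq> 0 \<Longrightarrow> k \<in> K \<and> ?p i k \<in> W i \<inter> D k"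
      using decomposed.part_outside[OF dec] decomposed.part_in[OF dec] supp W.part_in[OF x] by metis
    then have "?J \<subseteq> I \<times> K" "\<forall>j\<in>?J. (\<lambda>(i, k). ?p i k) j \<in> (case j of (i, k) \<Rightarrow> W i \<inter> D k)"
      using supp by auto
    moreover have "x = sum (\<lambda>(i, k). ?p i k) ?J"
    proof -
      have "x = (\<Sum>i | W.part x i \<noteq> 0. W.part x i)" using W.sum_part[OF x] by simp
      also have "\<dots> = (\<Sum>i | W.part x i \<noteq> 0. sum (?p i) {k. ?p i k \<noteq> 0})"
        using decomposed.sum_part[OF dec] supp W.part_in[OF x] by (intro sum.cong) auto
      also have "\<dots> = sum (\<lambda>(i, k). ?p i k) ?J"
        using fin W.finite_part[OF x] by (intro sum.Sigma) auto
      finally show ?thesis .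
    qed
    ultimately show "\<exists>J g. finite J \<and> J \<subseteq> I \<times> K \<and>
        (\<forall>i\<in>J. g i \<in> (case i of (i, k) \<Rightarrow> W i \<inter> D k)) \<and> x = sum g J" by blast
  next
    fix J g j
    assume fin: "finite J" and sub: "J \<subseteq> I \<times> K" and g: "\<And>j. j \<in> J \<Longrightarrow> g j \<in> (case j of (i, k) \<Rightarrow> W i \<inter> D k)"
      and sum0: "sum g J = 0" and j: "j \<in> J"
    obtain i k where ik: "j = (i, k)" by fastforce
    let ?h = "\<lambda>i. \<Sum>k\<in>{k. (i, k) \<in> J}. g (i, k)"
    have finK: "finite {k. (i, k) \<in> J}" for i
      by (rule finite_subset[OF _ finite_imageI[OF fin, of snd]]) force
    have "sum g J = (\<Sum>(i, k)\<in>(SIGMA i:fst ` J. {k. (i, k) \<in> J}). g (i, k))"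
      by (rule sum.cong) force+
    also have "\<dots> = (\<Sum>i\<in>fst ` J. ?h i)"
      using fin finK by (subst sum.Sigma) auto
    finally have "(\<Sum>i\<in>fst ` J. ?h i) = 0" using sum0 by simp
    moreover have hW: "?h i \<in> W i" if "i \<in> fst ` J" for i
      using that sub g by (intro subspace_sum[OF W.subspace_S]) force+
    moreover have sub1: "i \<in> I" if "i \<in> fst ` J" for i using that sub by auto
    ultimately have "W.part 0 i = (if i \<in> fst ` J then ?h i else 0)"
      using W.part_sum[of "fst ` J" ?h i] fin by simp
    moreover have i: "i \<in> fst ` J" using j ik by force
    ultimately have h0: "?h i = 0" by simp
    interpret D: decomposed s K "\<lambda>k. W i \<inter> D k" "W i" by (rule dec[OF sub1[OF i]])
    have "D.part (?h i) k = (if k \<in> {k. (i, k) \<in> J} then g (i, k) else 0)"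
      using g sub finK by (intro D.part_sum) force+
    then show "g j = 0" using h0 j ik by simp
  qed
qed

section \<open>The bigrading of a graded dg module\<close>

lemma half_ints_of_int: "of_int k \<in> half_ints"
  unfolding half_ints_def by (rule range_eqI[of _ _ "2 * k"]) simp

lemma half_ints_0 [simp]: "0 \<in> half_ints"
  and half_ints_1 [simp]: "1 \<in> half_ints"
  using half_ints_of_int[of 0] half_ints_of_int[of 1] by simp_all

lemma half_ints_add: "m \<in> half_ints \<Longrightarrow> n \<in> half_ints \<Longrightarrow> m + n \<in> half_ints"
  unfolding half_ints_def by (auto simp flip: add_divide_distrib of_int_add)

lemma half_ints_diff: "m \<in> half_ints \<Longrightarrow> n \<in> half_ints \<Longrightarrow> m - n \<in> half_ints"
  unfolding half_ints_def by (auto simp flip: diff_divide_distrib of_int_diff)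

context weak_dg_module
begin

abbreviation scal :: "complex \<Rightarrow> 'm \<Rightarrow> 'm" where "scal \<equiv> mod_scale M"
abbreviation space :: "'m set" where "space \<equiv> mod_space M"

sublocale vs: vector_space scal by (rule vector_space)
sublocale dg: decomposed scal UNIV "mod_deg M" space
  by unfold_locales (rule degree_decomposition)

lemma act_left: "x \<in> space \<Longrightarrow> module_hom (va_scale V) scal (\<lambda>u. mod_Y M u n x)"
  using Vector_Spaces.linear.axioms(3)[OF Y_linear_left] .

lemmas act_add_left = module_hom.add[OF act_left]
  and act_scale_left = module_hom.scale[OF act_left]
  and act_zero_left = module_hom.zero[OF act_left]
  and act_sum_left = module_hom.sum[OF act_left]

lemma act_in: "x \<in> space \<Longrightarrow> mod_Y M u n x \<in> space"
  and act_add_right: "x \<in> space \<Longrightarrow> y \<in> space \<Longrightarrow> mod_Y M u n (x + y) = mod_Y M u n x + mod_Y M u n y"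
  and act_scale_right: "x \<in> space \<Longrightarrow> mod_Y M u n (scal c x) = scal c (mod_Y M u n x)"
  using Y_linear_right[of u n] by (auto simp: linear_between_def)

lemma act_zero_right: "mod_Y M u n 0 = 0"
  using act_scale_right[of 0 u n 0] dg.U_zero by simp

lemma act_sum_right:
  "(\<And>j. j \<in> J \<Longrightarrow> g j \<in> space) \<Longrightarrow> mod_Y M u n (sum g J) = (\<Sum>j\<in>J. mod_Y M u n (g j))"
  by (induction J rule: infinite_finite_induct) (auto simp: act_zero_right act_add_right dg.U_sum)

lemma diff_in: "x \<in> space \<Longrightarrow> mod_diff M x \<in> space"
  and diff_add: "x \<in> space \<Longrightarrow> y \<in> space \<Longrightarrow> mod_diff M (x + y) = mod_diff M x + mod_diff M y"
  and diff_scale: "x \<in> space \<Longrightarrow> mod_diff M (scal c x) = scal c (mod_diff M x)"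
  using diff_linear by (auto simp: linear_between_def)

lemma diff_zero: "mod_diff M 0 = 0"
  using diff_scale[of 0 0] dg.U_zero by simp

lemma diff_sum: "(\<And>j. j \<in> J \<Longrightarrow> g j \<in> space) \<Longrightarrow> mod_diff M (sum g J) = (\<Sum>j\<in>J. mod_diff M (g j))"
  by (induction J rule: infinite_finite_induct) (auto simp: diff_zero diff_add dg.U_sum)

lemma diff_sub: "x \<in> space \<Longrightarrow> y \<in> space \<Longrightarrow> mod_diff M (x - y) = mod_diff M x - mod_diff M y"
  using diff_add[of "x - y" y] dg.U_diff by (simp add: eq_diff_eq)

lemma mod_deg_in: "x \<in> mod_deg M p \<Longrightarrow> x \<in> space"
  using dg.S_subset by blast

end

context graded_dg_module
begin

sublocale wt: decomposed scal half_ints "mod_wt M" space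
  by unfold_locales (rule weight_decomposition)
sublocale bi: decomposed scal "half_ints \<times> UNIV" "\<lambda>(n, p). mod_wt M n \<inter> mod_deg M p" space
  by unfold_locales
    (rule direct_decomposition_refine[OF vector_space weight_decomposition weight_subcomplex_graded])

lemma wt_part_eq: "x \<in> space \<Longrightarrow> wt.part x n = bi.proj (fst -` {n}) x"
  by (rule bi.component_coarsening[OF weight_decomposition]) auto

lemma mod_wt_eq: "n \<in> half_ints \<Longrightarrow> mod_wt M n = bi.supported (fst -` {n})"
  by (rule bi.coarsening_supported[OF weight_decomposition]) auto

lemma mod_deg_eq: "mod_deg M p = bi.supported (snd -` {p})"
  by (rule bi.coarsening_supported[OF degree_decomposition]) auto

lemma mod_deg_le_eq: "mod_deg_le M p = bi.supported (snd -` {..p})"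
proof -
  have "mod_deg_le M p = vs.span (\<Union>q\<in>{..p}. bi.supported (snd -` {q}))"
    unfolding mod_deg_le_def by (intro arg_cong[where f = vs.span] SUP_cong refl mod_deg_eq)
  also have "\<dots> = bi.supported (\<Union>q\<in>{..p}. snd -` {q})" by (rule bi.span_supported)
  also have "(\<Union>q\<in>{..p}. snd -` {q}) = snd -` {..p}" by auto
  finally show ?thesis .
qed

lemma supported_half_ints: "bi.supported B = bi.supported (B \<inter> half_ints \<times> UNIV)"
  using bi.part_outside by (auto simp: bi.supported_def)

lemma mod_wt_le_eq: "mod_wt_le M n = bi.supported (fst -` {..n})"
proof -
  have "mod_wt_le M n = vs.span (\<Union>k\<in>{k\<in>half_ints. k \<le> n}. bi.supported (fst -` {k}))"
    unfolding mod_wt_le_def by (intro arg_cong[where f = vs.span] SUP_cong refl mod_wt_eq) simp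
  also have "\<dots> = bi.supported (\<Union>k\<in>{k\<in>half_ints. k \<le> n}. fst -` {k})" by (rule bi.span_supported)
  also have "(\<Union>k\<in>{k\<in>half_ints. k \<le> n}. fst -` {k}) = (fst -` {..n} \<inter> half_ints \<times> (UNIV :: int set))"
    by auto
  finally show ?thesis by (simp only: supported_half_ints[of "fst -` {..n}"])
qed

abbreviation wt_lt :: "rat \<Rightarrow> 'm set" where "wt_lt n \<equiv> bi.supported (fst -` {..<n})"

lemma mod_wt_in: "n \<in> half_ints \<Longrightarrow> x \<in> mod_wt M n \<Longrightarrow> x \<in> space"
  using wt.S_subset by blast

lemma bi_homogeneous:
  "n \<in> half_ints \<Longrightarrow> mod_wt M n \<inter> mod_deg M p = bi.supported {(n, p)}"
  using bi.homogeneous_supported[of "(n, p)"] by simp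

end

text \<open>The invariant \<open>deg - 2 wt\<close> of a bidegree: it is additive under all the operations
  \<open>u\<^sub>n x\<close>, whatever the value of \<open>n\<close>.\<close>

definition charge :: "rat \<times> int \<Rightarrow> rat" where
  "charge k = of_int (snd k) - 2 * fst k"

lemma adjoint_module_simps [simp]:
  "mod_space (adjoint_module V) = UNIV" "mod_scale (adjoint_module V) = va_scale V"
  "mod_deg (adjoint_module V) = va_deg V" "mod_diff (adjoint_module V) = va_diff V"
  "mod_Y (adjoint_module V) = va_Y V" "mod_wt (adjoint_module V) = voa_wt V"
  by (simp_all add: adjoint_module_def)

lemma gbinomial_zero_left: "(0 :: complex) gchoose i = (if i = 0 then 1 else 0)"
  by (cases i) auto

lemma Sum_any_if:
  "g = (\<lambda>i. if i \<in> A then f i else 0) \<Longrightarrow> finite A \<Longrightarrow> Sum_any g = sum f A"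
  by (simp add: Sum_any.conditionalize)

text \<open>In any module the \<open>n\<close>-th mode of \<open>u\<^bsub>-2\<^esub> 1\<close>, the derivative of \<open>u\<close>, is \<open>- n u\<^bsub>n-1\<^esub>\<close>: this is
  the Jacobi identity for \<open>u\<close> and the vacuum with \<open>l = -2\<close>, \<open>m = 0\<close>.\<close>

lemma derivative_mode:
  assumes "dg_vertex_algebra V" "weak_dg_module V M" and x: "x \<in> mod_space M"
  shows "mod_Y M (va_Y V u (-2) (va_vac V)) n x = mod_scale M (- of_int n) (mod_Y M u (n - 1) x)"
proof -
  interpret V: dg_vertex_algebra V by fact
  interpret weak_dg_module V M by fact
  interpret Vv: vector_space "va_scale V" by (rule V.vector_space)
  interpret Vd: decomposed "va_scale V" UNIV "va_deg V" UNIV by unfold_locales (rule V.degree_decomposition)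
  note hom = Vector_Spaces.linear.axioms(3)[OF V.Y_linear_left]
  have "u \<in> UNIV" by simp
  then show ?thesis
  proof (induction rule: Vd.homogeneous_induct)
    case zero
    show ?case using x by (simp add: module_hom.zero[OF hom] act_zero_left)
  next
    case (add u v)
    then show ?case using x by (simp add: module_hom.add[OF hom] act_add_left vs.scale_right_distrib)
  next
    case (homogeneous p u)
    have "Sum_any (\<lambda>i::nat. scal ((-1) ^ i * (of_int (-2) gchoose i))
            (mod_Y M u (0 + (-2) - int i) (mod_Y M (va_vac V) (n + int i) x)
             - scal ((-1) powi (-2) * (-1) powi (p * 0))
                 (mod_Y M (va_vac V) (n + (-2) - int i) (mod_Y M u (0 + int i) x))))
        = Sum_any (\<lambda>i::nat. scal (of_int 0 gchoose i)
            (mod_Y M (va_Y V u (-2 + int i) (va_vac V)) (0 + n - int i) x))" (is "Sum_any ?l = Sum_any ?r")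
      using jacobi V.vac_degree homogeneous x unfolding jacobi_identity_def by blast
    moreover have "Sum_any ?r = mod_Y M (va_Y V u (-2) (va_vac V)) n x"
    proof -
      have "?r = (\<lambda>i. if i \<in> {0} then mod_Y M (va_Y V u (-2) (va_vac V)) n x else 0)"
        by (rule ext) (simp add: gbinomial_zero_left)
      from Sum_any_if[OF this] show ?thesis by simp
    qed
    moreover have "Sum_any ?l = scal (- of_int n) (mod_Y M u (n - 1) x)"
    proof -
      \<comment> \<open>the one index at which a mode of the vacuum survives: in the first product for negative \<open>n\<close>,
        in the second for positive \<open>n\<close>; for \<open>n = 0\<close> there is none and the coefficient is \<open>0\<close>\<close>
      define k where "k = nat (if n < 0 then - 1 - n else n - 1)"
      have "?l = (\<lambda>i. if i \<in> {k} then scal (- of_int n) (mod_Y M u (n - 1) x) else 0)"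
      proof (rule ext)
        fix i
        have "(-2 :: complex) gchoose i = (-1) ^ i * (of_nat i + 1)"
          using gbinomial_minus[of "2 :: complex" i] binomial_gbinomial[of "i + 1" i, where ?'a = complex]
          by (simp add: add.commute)
        then have coeff: "(-1) ^ i * (of_int (-2) gchoose i) = (of_nat i + 1 :: complex)"
          by (simp flip: power_mult_distrib mult.assoc)
        have "?l i = scal (of_nat i + 1) ((if n + int i = -1 then mod_Y M u (-2 - int i) x else 0)
            - (if n - 2 - int i = -1 then mod_Y M u (int i) x else 0))"
          unfolding coeff using x by (simp add: Y_vac act_in act_zero_right)
        also have "\<dots> = (if i \<in> {k} then scal (- of_int n) (mod_Y M u (n - 1) x) else 0)"
        proof -
          consider "n < 0" | "n = 0" | "n > 0" by linarith
          then show ?thesis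
          proof cases
            case 1
            then have "n + int i = -1 \<longleftrightarrow> i = k" "n - 2 - int i \<noteq> -1" by (auto simp: k_def)
            moreover have "n = - 1 - int k" using 1 by (simp add: k_def)
            ultimately show ?thesis by auto
          next
            case 3
            then have "n - 2 - int i = -1 \<longleftrightarrow> i = k" "n + int i \<noteq> -1" by (auto simp: k_def)
            moreover have "n = 1 + int k" using 3 by (simp add: k_def)
            ultimately show ?thesis by (auto simp: vs.scale_left_diff_distrib vs.scale_left_distrib)
          qed auto
        qed
        finally show "?l i = (if i \<in> {k} then scal (- of_int n) (mod_Y M u (n - 1) x) else 0)" .
      qed
      from Sum_any_if[OF this] show ?thesis by simp
    qed
    ultimately show ?case by simp
  qed
qed

context dg_vertex_operator_algebra
begin

sublocale Vs: vector_space "va_scale V" by (rule vector_space)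

sublocale adj: weak_dg_module V "adjoint_module V"
proof (rule weak_dg_module.intro)
  show "linear_between (mod_scale (adjoint_module V)) (mod_space (adjoint_module V))
      (mod_scale (adjoint_module V)) (mod_space (adjoint_module V)) (mod_diff (adjoint_module V))"
    using Vector_Spaces.linear.axioms(3)[OF diff_linear]
    by (auto simp: linear_between_def module_hom.add module_hom.scale)
  show "linear_between (mod_scale (adjoint_module V)) (mod_space (adjoint_module V))
      (mod_scale (adjoint_module V)) (mod_space (adjoint_module V)) (mod_Y (adjoint_module V) u n)" for u n
    using Vector_Spaces.linear.axioms(3)[OF Y_linear_right[of u n]]
    by (auto simp: linear_between_def module_hom.add module_hom.scale)
qed (use vector_space degree_decomposition diff_degree diff_diff Y_linear_left Y_degree Y_diff truncation
    Y_vac jacobi in auto)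

text \<open>The Jacobi identity for the conformal vector with \<open>l = 0\<close>, \<open>m = 1\<close> is the commutator
  formula for \<open>L(0)\<close>; the conformal vector has even degree, so no sign appears.\<close>

lemma L0_commutator:
  "voa_L V 0 (va_Y V u m w) = va_Y V u m (voa_L V 0 w) + va_Y V (voa_L V (-1) u) (m + 1) w
     + va_Y V (voa_L V 0 u) m w"
proof -
  have "u \<in> mod_space (adjoint_module V)" by simp
  then show ?thesis
  proof (induction rule: adj.dg.homogeneous_induct)
    case zero show ?case
      using adj.act_zero_left adj.act_zero_right by (simp add: voa_L_def)
  next
    case (add u v)
    then show ?case
      using adj.act_add_left adj.act_add_right by (simp add: voa_L_def algebra_simps)
  next
    case (homogeneous p u)
    have "Sum_any (\<lambda>i::nat. va_scale V ((-1) ^ i * (of_int 0 gchoose i))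
            (va_Y V (voa_omega V) (1 + 0 - int i) (va_Y V u (m + int i) w)
             - va_scale V ((-1) powi 0 * (-1) powi (4 * p))
                 (va_Y V u (m + 0 - int i) (va_Y V (voa_omega V) (1 + int i) w))))
        = Sum_any (\<lambda>i::nat. va_scale V (of_int 1 gchoose i)
            (va_Y V (va_Y V (voa_omega V) (0 + int i) u) (1 + m - int i) w))" (is "Sum_any ?l = Sum_any ?r")
      using omega_degree homogeneous
      by (intro jacobi[unfolded jacobi_identity_def, rule_format]) simp_all
    moreover have "Sum_any ?l = va_Y V (voa_omega V) 1 (va_Y V u m w) - va_Y V u m (va_Y V (voa_omega V) 1 w)"
    proof -
      have "?l = (\<lambda>i. if i \<in> {0} then va_Y V (voa_omega V) 1 (va_Y V u m w)
          - va_Y V u m (va_Y V (voa_omega V) 1 w) else 0)"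
        by (rule ext) (auto simp: gbinomial_zero_left power_int_mult)
      from Sum_any_if[OF this] show ?thesis by simp
    qed
    moreover have "Sum_any ?r =
        va_Y V (va_Y V (voa_omega V) 0 u) (m + 1) w + va_Y V (va_Y V (voa_omega V) 1 u) m w"
    proof -
      have "?r = (\<lambda>i. if i \<in> {0, 1} then
          va_Y V (va_Y V (voa_omega V) (int i) u) (1 + m - int i) w else 0)"
      proof (rule ext)
        fix i :: nat
        have "(1::complex) gchoose i = (if i \<in> {0, 1} then 1 else 0)"
          using binomial_gbinomial[of 1 i, where ?'a = complex] by (auto simp: binomial_eq_0)
        then show "?r i = (if i \<in> {0, 1} then va_Y V (va_Y V (voa_omega V) (int i) u) (1 + m - int i) w else 0)"
          by (simp del: insert_iff)
      qed
      from Sum_any_if[OF this] show ?thesis by (simp add: add.commute)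
    qed
    ultimately show ?case by (simp add: voa_L_def algebra_simps)
  qed
qed

lemma L0_mode:
  "voa_L V 0 (va_Y V u m w) = va_Y V u m (voa_L V 0 w) + va_Y V (voa_L V 0 u) m w
     - va_scale V (of_int m + 1) (va_Y V u m w)"
  using L0_commutator[of u m w]
    derivative_mode[OF dg_vertex_algebra_axioms adj.weak_dg_module_axioms, of w u "m + 1"]
  by (simp add: L_minus_one Vs.scale_left_diff_distrib algebra_simps)

lemma voa_L_degree: "x \<in> va_deg V p \<Longrightarrow> voa_L V 0 x \<in> va_deg V p"
  using Y_degree[OF omega_degree, of 1 p] by (auto simp: voa_L_def)

lemma voa_wt_degree_part:
  assumes "x \<in> voa_wt V n" shows "adj.dg.part x p \<in> voa_wt V n"
proof -
  have x: "x \<in> mod_space (adjoint_module V)" by simp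
  let ?J = "{p. adj.dg.part x p \<noteq> 0}"
  have "voa_L V 0 x = voa_L V 0 (sum (adj.dg.part x) ?J)" using adj.dg.sum_part[OF x] by simp
  also have "\<dots> = (\<Sum>p\<in>?J. voa_L V 0 (adj.dg.part x p))"
    using adj.act_sum_right[of ?J] by (simp add: voa_L_def)
  finally have "adj.dg.part (voa_L V 0 x) p = (if p \<in> ?J then voa_L V 0 (adj.dg.part x p) else 0)"
    using adj.dg.part_sum[of ?J "\<lambda>p. voa_L V 0 (adj.dg.part x p)"] adj.dg.finite_part[OF x]
      adj.dg.part_in[OF x] voa_L_degree by simp
  moreover have "voa_L V 0 x = va_scale V (of_rat n) x" using assms by (simp add: voa_wt_def)
  ultimately have "p \<in> ?J \<Longrightarrow> voa_L V 0 (adj.dg.part x p) = va_scale V (of_rat n) (adj.dg.part x p)"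
    using adj.dg.part_scale[OF x] by simp
  moreover have "voa_L V 0 0 = 0" using adj.act_zero_right by (simp add: voa_L_def)
  ultimately show ?thesis by (cases "p \<in> ?J") (auto simp: voa_wt_def)
qed

lemma Y_weight:
  assumes "u \<in> voa_wt V n" "w \<in> voa_wt V r"
  shows "va_Y V u m w \<in> voa_wt V (r + n - of_int m - 1)"
proof -
  have "voa_L V 0 u = va_scale V (of_rat n) u" "voa_L V 0 w = va_scale V (of_rat r) w"
    using assms by (auto simp: voa_wt_def)
  then have "voa_L V 0 (va_Y V u m w) = va_scale V (of_rat (r + n - of_int m - 1)) (va_Y V u m w)"
    using L0_mode[of u m w] adj.act_scale_left adj.act_scale_right[of w u m]
    by (simp add: of_rat_add of_rat_diff Vs.scale_left_distrib Vs.scale_left_diff_distrib)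
  then show ?thesis by (simp add: voa_wt_def)
qed

lemma vac_weight: "va_vac V \<in> voa_wt V 0"
  using creation_regular[of 1 "voa_omega V"] by (simp add: voa_wt_def voa_L_def)

lemma subspace_voa_wt: "n \<in> half_ints \<Longrightarrow> adj.vs.subspace (voa_wt V n)"
  using weight_decomposition by (auto simp: direct_decomposition_def)

text \<open>\<open>L(0)\<close> commutes with the differential and preserves the degree, so its eigenspaces are
  graded subcomplexes and \<open>V\<close> is a graded dg module over itself.\<close>

sublocale adj: graded_dg_module V "adjoint_module V"
proof
  fix n assume n: "n \<in> half_ints"
  show "direct_decomposition (mod_scale (adjoint_module V)) UNIV
      (\<lambda>p. mod_wt (adjoint_module V) n \<inter> mod_deg (adjoint_module V) p) (mod_wt (adjoint_module V) n)"
  proof (rule direct_decompositionI)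
    fix x assume "x \<in> mod_wt (adjoint_module V) n"
    then have "\<forall>p\<in>{p. adj.dg.part x p \<noteq> 0}. adj.dg.part x p \<in>
        mod_wt (adjoint_module V) n \<inter> mod_deg (adjoint_module V) p"
      using voa_wt_degree_part adj.dg.part_in[of x] by auto
    then show "\<exists>J g. finite J \<and> J \<subseteq> UNIV \<and>
        (\<forall>p\<in>J. g p \<in> mod_wt (adjoint_module V) n \<inter> mod_deg (adjoint_module V) p) \<and> x = sum g J"
      using adj.dg.finite_part[of x] adj.dg.sum_part[of x] by (metis UNIV_I adjoint_module_simps(1) subset_UNIV)
  next
    fix J g p
    assume "finite J" "\<And>i. i \<in> J \<Longrightarrow> g i \<in> mod_wt (adjoint_module V) n \<inter> mod_deg (adjoint_module V) i"
      "sum g J = 0" "p \<in> J"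
    then show "g p = 0" using adj.dg.part_sum[of J g p] adj.dg.part_zero[of p] by simp
  qed (use n subspace_voa_wt adj.dg.subspace_S adj.vector_space in \<open>auto intro: Vs.subspace_inter\<close>)
  show "mod_diff (adjoint_module V) ` mod_wt (adjoint_module V) n \<subseteq> mod_wt (adjoint_module V) n"
  proof -
    have "voa_L V 0 (va_diff V x) = va_diff V (voa_L V 0 x)" for x
      using Y_diff[OF omega_degree, of 1 x] adj.act_zero_left[of x] by (simp add: diff_omega voa_L_def)
    then show ?thesis using adj.diff_scale by (auto simp: voa_wt_def)
  qed
qed (use weight_decomposition Y_weight in auto)

end

locale voa = dg_vertex_operator_algebra V for V :: "'v::ab_group_add dg_voa"

locale voa_module = V: voa V + graded_dg_module V M
  for V :: "'v::ab_group_add dg_voa" and M :: "('v, 'm::ab_group_add) dg_mod"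

section \<open>Series of modes and the Jacobi identity\<close>

text \<open>The coefficients of \<open>(1 + t X)\<^sup>r\<close>.\<close>

definition bin :: "complex \<Rightarrow> complex \<Rightarrow> nat \<Rightarrow> complex" where
  "bin t r k = t ^ k * (r gchoose k)"

text \<open>For a power series \<open>c\<close> this is the residue in \<open>z\<close> of \<open>c(z) z\<^sup>N Y(u, z) x\<close>.\<close>

definition modes :: "('v, 'm::ab_group_add) dg_mod \<Rightarrow> (nat \<Rightarrow> complex) \<Rightarrow> 'v \<Rightarrow> int \<Rightarrow> 'm \<Rightarrow> 'm" where
  "modes M c u N x = Sum_any (\<lambda>k. mod_scale M (c k) (mod_Y M u (N + int k) x))"

lemma bin_0 [simp]: "bin t r 0 = 1"
  by (simp add: bin_def)

lemma bin_Vandermonde: "(\<Sum>a\<le>c. bin t P a * bin t Q (c - a)) = bin t (P + Q) c"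
proof -
  have "(\<Sum>a\<le>c. bin t P a * bin t Q (c - a)) = (\<Sum>a\<le>c. t ^ c * ((P gchoose a) * (Q gchoose (c - a))))"
  proof (rule sum.cong)
    fix a assume "a \<in> {..c}"
    then have "t ^ c = t ^ a * t ^ (c - a)" by (simp flip: power_add)
    then show "bin t P a * bin t Q (c - a) = t ^ c * ((P gchoose a) * (Q gchoose (c - a)))"
      by (simp add: bin_def)
  qed simp
  also have "\<dots> = bin t (P + Q) c"
    by (simp add: bin_def gbinomial_Vandermonde atMost_atLeast0 flip: sum_distrib_left)
  finally show ?thesis .
qed

lemma bin_choose: "bin t U (a + i) * (of_nat (a + i) gchoose i) = bin t U i * bin t (U - of_nat i) a"
  using gbinomial_trinomial_revision[of i "a + i" U] by (simp add: bin_def power_add)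

text \<open>Truncation bounds depend on the vector, but only the finitely many \<open>k\<close> between \<open>B\<close> and \<open>K\<close> matter.\<close>

lemma uniform_truncation:
  fixes F :: "int \<Rightarrow> int \<Rightarrow> 'b::zero"
  assumes "\<And>k. \<exists>N. \<forall>n\<ge>N. F k n = 0" and "\<And>k n. k \<ge> K \<Longrightarrow> F k n = 0"
  shows "\<exists>N. \<forall>k\<ge>B. \<forall>n\<ge>N. F k n = 0"
proof -
  obtain f where f: "\<And>k n. n \<ge> f k \<Longrightarrow> F k n = 0" using assms(1) by metis
  let ?N = "Max (insert 0 (f ` {B..<K}))"
  have "F k n = 0" if "k \<ge> B" "n \<ge> ?N" for k n
  proof (cases "k < K")
    case True
    then have "f k \<le> ?N" using that by (intro Max_ge) auto
    then show ?thesis by (rule f[OF order.trans[OF _ that(2)]])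
  qed (use assms(2) in auto)
  then show ?thesis by blast
qed

lemma Sum_any_lessThan:
  fixes g :: "nat \<Rightarrow> 'b::comm_monoid_add"
  assumes "\<And>i. i \<ge> n \<Longrightarrow> g i = 0" shows "Sum_any g = sum g {..<n}"
proof (rule Sum_any.expand_superset)
  show "{i. g i \<noteq> 0} \<subseteq> {..<n}" using assms not_le by blast
qed simp

lemma common_bound:
  "\<exists>n. \<forall>k\<ge>n. P k \<Longrightarrow> \<exists>n. \<forall>k\<ge>n. Q k \<Longrightarrow> \<exists>n::nat. (\<forall>k\<ge>n. P k) \<and> (\<forall>k\<ge>n. Q k)"
proof -
  assume "\<exists>n. \<forall>k\<ge>n. P k" "\<exists>n. \<forall>k\<ge>n. Q k"
  then obtain m n where "\<forall>k\<ge>m. P k" "\<forall>k\<ge>n. Q k" by blast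
  then show ?thesis by (intro exI[of _ "max m n"]) simp
qed

context weak_dg_module
begin

lemma modes_eq_sum:
  assumes "x \<in> space" "\<And>k. k \<ge> n \<Longrightarrow> mod_Y M u (N + int k) x = 0"
  shows "modes M c u N x = (\<Sum>k<n. scal (c k) (mod_Y M u (N + int k) x))"
  unfolding modes_def by (rule Sum_any_lessThan) (simp add: assms(2))

lemma modes_truncation:
  assumes "x \<in> space" shows "\<exists>n. \<forall>k\<ge>n. mod_Y M u (N + int k) x = 0"
proof -
  obtain K where "\<forall>m\<ge>K. mod_Y M u m x = 0" using truncation[OF assms] by blast
  then have "\<forall>k\<ge>nat (K - N). mod_Y M u (N + int k) x = 0" by auto
  then show ?thesis ..
qed

lemma modes_in:
  assumes "x \<in> space" shows "modes M c u N x \<in> space"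
proof -
  obtain n where "\<forall>k\<ge>n. mod_Y M u (N + int k) x = 0" using modes_truncation[OF assms] by metis
  then have "modes M c u N x = (\<Sum>k<n. scal (c k) (mod_Y M u (N + int k) x))"
    using assms by (intro modes_eq_sum) auto
  then show ?thesis using assms by (simp add: dg.U_sum dg.U_scale act_in)
qed

lemma modes_add_left:
  assumes "x \<in> space" shows "modes M c (u + v) N x = modes M c u N x + modes M c v N x"
proof -
  obtain n where "\<forall>k\<ge>n. mod_Y M u (N + int k) x = 0" "\<forall>k\<ge>n. mod_Y M v (N + int k) x = 0"
    using common_bound[OF modes_truncation[OF assms] modes_truncation[OF assms]] by metis
  then show ?thesis
    using assms by (simp add: modes_eq_sum[of _ n] act_add_left vs.scale_right_distrib sum.distrib)
qed

lemma modes_scale_left: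
  assumes "x \<in> space" shows "modes M c (va_scale V a u) N x = scal a (modes M c u N x)"
proof -
  obtain n where "\<forall>k\<ge>n. mod_Y M u (N + int k) x = 0"
    using modes_truncation[OF assms] by metis
  then show ?thesis
    using assms by (simp add: modes_eq_sum[of _ n] act_scale_left vs.scale_sum_right mult.commute)
qed

lemma modes_zero_left: "x \<in> space \<Longrightarrow> modes M c 0 N x = 0"
  by (simp add: modes_def act_zero_left)

lemma modes_add_right:
  assumes "x \<in> space" "y \<in> space" shows "modes M c u N (x + y) = modes M c u N x + modes M c u N y"
proof -
  obtain n where "\<forall>k\<ge>n. mod_Y M u (N + int k) x = 0" "\<forall>k\<ge>n. mod_Y M u (N + int k) y = 0"
    using common_bound[OF modes_truncation[OF assms(1)] modes_truncation[OF assms(2)]] by metis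
  then show ?thesis
    using assms dg.U_add
    by (simp add: modes_eq_sum[of _ n] act_add_right vs.scale_right_distrib sum.distrib)
qed

lemma modes_scale_right:
  assumes "x \<in> space" shows "modes M c u N (scal a x) = scal a (modes M c u N x)"
proof -
  obtain n where "\<forall>k\<ge>n. mod_Y M u (N + int k) x = 0"
    using modes_truncation[OF assms] by metis
  then show ?thesis
    using assms dg.U_scale
    by (simp add: modes_eq_sum[of _ n] act_scale_right vs.scale_sum_right mult.commute)
qed

lemma modes_add_coeff:
  assumes "x \<in> space"
  shows "modes M (\<lambda>k. a * c k + b * d k) u N x = scal a (modes M c u N x) + scal b (modes M d u N x)"
proof -
  obtain n where "\<forall>k\<ge>n. mod_Y M u (N + int k) x = 0"
    using modes_truncation[OF assms] by metis
  then show ?thesis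
    using assms
    by (simp add: modes_eq_sum[of _ n] vs.scale_left_distrib vs.scale_sum_right sum.distrib)
qed

text \<open>Multiplication of the power series by \<open>z\<close> is absorbed into the exponent.\<close>

lemma modes_shift:
  assumes "x \<in> space"
  shows "modes M c u (N + 1) x = modes M (\<lambda>k. case k of 0 \<Rightarrow> 0 | Suc j \<Rightarrow> c j) u N x"
proof -
  obtain n where n: "\<forall>k\<ge>n. mod_Y M u (N + int k) x = 0"
    using modes_truncation[OF assms] by metis
  then have "\<forall>k\<ge>n. mod_Y M u (N + 1 + int k) x = 0"
    by (metis add.assoc add.commute le_SucI of_nat_Suc)
  then have "modes M c u (N + 1) x = (\<Sum>k<n. scal (c k) (mod_Y M u (N + 1 + int k) x))"
    using assms by (simp add: modes_eq_sum)
  also have "\<dots> = (\<Sum>k<Suc n. scal (case k of 0 \<Rightarrow> 0 | Suc j \<Rightarrow> c j) (mod_Y M u (N + int k) x))"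
    unfolding sum.lessThan_Suc_shift by (simp add: add.assoc)
  also have "\<dots> = modes M (\<lambda>k. case k of 0 \<Rightarrow> 0 | Suc j \<Rightarrow> c j) u N x"
    using n assms by (intro modes_eq_sum[symmetric]) auto
  finally show ?thesis .
qed

lemma modes_modes:
  assumes "x \<in> space" "\<And>b. b \<ge> n \<Longrightarrow> mod_Y M v (N' + int b) x = 0"
    "\<And>a b. a \<ge> n \<Longrightarrow> mod_Y M u (N + int a) (mod_Y M v (N' + int b) x) = 0"
  shows "modes M c u N (modes M d v N' x) =
    (\<Sum>a<n. \<Sum>b<n. scal (c a * d b) (mod_Y M u (N + int a) (mod_Y M v (N' + int b) x)))"
proof -
  have eq: "modes M d v N' x = (\<Sum>b<n. scal (d b) (mod_Y M v (N' + int b) x))"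
    using assms by (intro modes_eq_sum)
  have act: "mod_Y M u m (modes M d v N' x) = (\<Sum>b<n. scal (d b) (mod_Y M u m (mod_Y M v (N' + int b) x)))" for m
    unfolding eq using assms(1) by (simp add: act_sum_right dg.U_scale act_in act_scale_right)
  have "modes M c u N (modes M d v N' x) = (\<Sum>a<n. scal (c a) (mod_Y M u (N + int a) (modes M d v N' x)))"
    using assms by (intro modes_eq_sum modes_in) (simp_all add: act)
  then show ?thesis by (simp add: act vs.scale_sum_right)
qed

text \<open>The substitution \<open>z\<^sub>1 = z\<^sub>2 + z\<^sub>0\<close> in \<open>(1 + t z\<^sub>1)\<^sup>U (1 + t z\<^sub>2)\<^sup>W\<close>, in coefficients: trinomial revision and
  the Vandermonde convolution.\<close>

lemma bin_substitution:
  assumes x: "x \<in> space" and m: "i + m = n" "\<And>k. k \<ge> m \<Longrightarrow> mod_Y M w (B + int k) x = 0"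
  shows "(\<Sum>a<n. \<Sum>b<n. scal (bin t U a * bin t W b) (scal (of_nat a gchoose i) (mod_Y M w (int a + (int b + B) - int i) x)))
    = scal (bin t U i) (modes M (bin t (U + W - of_nat i)) w B x)"
proof -
  define f where "f k = mod_Y M w (B + int k) x" for k
  have f0: "f k = 0" if "k \<ge> m" for k using m that by (simp add: f_def)
  let ?g = "\<lambda>a b. scal (bin t U a * bin t W b * (of_nat a gchoose i)) (mod_Y M w (int a + (int b + B) - int i) x)"
  let ?h = "\<lambda>a b. scal (bin t U i * (bin t (U - of_nat i) a * bin t W b)) (f (a + b))"
  have g0: "?g a b = 0" if "a < i" for a b
    using that binomial_gbinomial[of a i, where ?'a = complex] by (simp add: binomial_eq_0)
  have gh: "?g (a + i) b = ?h a b" for a b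
  proof -
    have idx: "int (a + i) + (int b + B) - int i = B + int (a + b)" by simp
    have "bin t U (a + i) * bin t W b * (of_nat (a + i) gchoose i)
        = (bin t U (a + i) * (of_nat (a + i) gchoose i)) * bin t W b" by (simp only: mult_ac)
    also have "\<dots> = bin t U i * (bin t (U - of_nat i) a * bin t W b)" by (simp only: bin_choose mult.assoc)
    finally show ?thesis by (simp only: idx f_def)
  qed
  have "(\<Sum>a<n. \<Sum>b<n. ?g a b) = (\<Sum>a=i..<i + m. \<Sum>b<n. ?g a b)"
    using m(1) by (intro sum.mono_neutral_right ballI sum.neutral g0) auto
  also have "\<dots> = (\<Sum>a<m. \<Sum>b<n. ?g (a + i) b)"
    using sum.shift_bounds_nat_ivl[of "\<lambda>a. \<Sum>b<n. ?g a b" 0 i m] by (simp add: add.commute lessThan_atLeast0)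
  also have "\<dots> = (\<Sum>a<m. \<Sum>b<n. ?h a b)" unfolding gh ..
  also have "\<dots> = (\<Sum>a<m. \<Sum>b<m - a. ?h a b)"
    using m(1) f0 by (intro sum.cong sum.mono_neutral_right) auto
  also have "\<dots> = (\<Sum>(a, b)\<in>(SIGMA a:{..<m}. {..<m - a}). ?h a b)"
    by (rule sum.Sigma) auto
  also have "(SIGMA a:{..<m}. {..<m - a}) = {(a, b). a + b < m}" by auto
  also have "(\<Sum>(a, b)\<in>{(a, b). a + b < m}. ?h a b) = (\<Sum>k<m. \<Sum>a\<le>k. ?h a (k - a))"
    by (rule sum.triangle_reindex)
  also have "\<dots> = (\<Sum>k<m. scal (bin t U i) (scal (bin t (U - of_nat i + W) k) (f k)))"
  proof (rule sum.cong)
    fix k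
    have "(\<Sum>a\<le>k. ?h a (k - a)) = (\<Sum>a\<le>k. scal (bin t U i * (bin t (U - of_nat i) a * bin t W (k - a))) (f k))"
      by (rule sum.cong) auto
    also have "\<dots> = scal (bin t U i) (scal (bin t (U - of_nat i + W) k) (f k))"
      by (simp add: bin_Vandermonde flip: vs.scale_sum_left sum_distrib_left)
    finally show "(\<Sum>a\<le>k. ?h a (k - a)) = scal (bin t U i) (scal (bin t (U - of_nat i + W) k) (f k))" .
  qed simp
  also have "\<dots> = scal (bin t U i) (modes M (bin t (U + W - of_nat i)) w B x)"
    using m(2) x by (simp add: modes_eq_sum[of _ m] f_def vs.scale_sum_right algebra_simps)
  finally show ?thesis by (simp add: mult.assoc)
qed

end

context voa_module
begin

text \<open>The residue of the Jacobi identity times \<open>z\<^sub>0\<^sup>l z\<^sub>2\<^sup>B (1 + t z\<^sub>1)\<^sup>U (1 + t z\<^sub>2)\<^sup>W\<close>: the Jacobi identities with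
  exponents \<open>l\<close>, \<open>a\<close>, \<open>b + B\<close> are summed over \<open>a\<close> and \<open>b\<close> with the coefficients of the two binomial series.
  All sums are cut off at one bound \<open>n\<close> beyond their supports. It is chosen positive so that the
  summand \<open>i = 0\<close> can always be split off.\<close>

lemma residue_jacobi:
  assumes u: "u \<in> va_deg V p" and v: "v \<in> va_deg V q" and x: "x \<in> space"
  shows "\<exists>n>0. (\<forall>i\<ge>n. va_Y V u (l + int i) v = 0) \<and>
    (\<Sum>i<n. scal (bin t U i) (modes M (bin t (U + W - of_nat i)) (va_Y V u (l + int i) v) B x)) =
    (\<Sum>i<n. scal ((-1) ^ i * (of_int l gchoose i))
       (modes M (bin t U) u (l - int i) (modes M (bin t W) v (B + int i) x)
        - scal ((-1) powi l * (-1) powi (p * q))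
            (modes M (bin t W) v (B + l - int i) (modes M (bin t U) u (int i) x))))"
proof -
  obtain K1 K2 K3 where K: "\<And>k. k \<ge> K1 \<Longrightarrow> mod_Y M v k x = 0" "\<And>k. k \<ge> K2 \<Longrightarrow> mod_Y M u k x = 0"
    "\<And>k. k \<ge> K3 \<Longrightarrow> va_Y V u k v = 0"
    using truncation[OF x] V.truncation by metis
  have "\<exists>N. \<forall>k\<ge>B. \<forall>n\<ge>N. mod_Y M u n (mod_Y M v k x) = 0"
    using truncation act_in x K by (intro uniform_truncation[of _ K1]) (auto simp: act_zero_right)
  then obtain N1 where N1: "\<And>k n. k \<ge> B \<Longrightarrow> n \<ge> N1 \<Longrightarrow> mod_Y M u n (mod_Y M v k x) = 0" by blast
  have "\<exists>N. \<forall>k\<ge>0. \<forall>n\<ge>N. mod_Y M v n (mod_Y M u k x) = 0"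
    using truncation act_in x K by (intro uniform_truncation[of _ K2]) (auto simp: act_zero_right)
  then obtain N2 where N2: "\<And>k n. k \<ge> 0 \<Longrightarrow> n \<ge> N2 \<Longrightarrow> mod_Y M v n (mod_Y M u k x) = 0" by blast
  have "\<exists>N. \<forall>k\<ge>l. \<forall>n\<ge>N. mod_Y M (va_Y V u k v) n x = 0"
    using truncation x K by (intro uniform_truncation[of _ K3]) (auto simp: act_zero_left)
  then obtain N3 where N3: "\<And>k n. k \<ge> l \<Longrightarrow> n \<ge> N3 \<Longrightarrow> mod_Y M (va_Y V u k v) n x = 0" by blast
  \<comment> \<open>For small \<open>i\<close> an outer mode with index beyond \<open>n\<close> vanishes, for large \<open>i\<close> the inner one does;
    the differences below are the thresholds that cover both ranges.\<close>
  define bounds where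
    "bounds = {1, K1 - B, N1 + K1 - B - l, K2, N2 + K2 - B - l, K3 - l, N3 + K3 - B - l}"
  define n where "n = nat (Max bounds)"
  have nb: "z \<le> int n" if "z \<in> bounds" for z
  proof -
    have "finite bounds" by (simp add: bounds_def)
    then have "z \<le> Max bounds" using that by (rule Max_ge)
    then show ?thesis unfolding n_def by linarith
  qed
  have n0: "0 < n" using nb[of 1] by (simp add: bounds_def)
  from nb have n: "K1 - B \<le> int n" "N1 + K1 - B - l \<le> int n" "K2 \<le> int n" "N2 + K2 - B - l \<le> int n"
    "K3 - l \<le> int n" "N3 + K3 - B - l \<le> int n" by (simp_all add: bounds_def)
  let ?e = "(-1) powi l * (-1) powi (p * q) :: complex"
  let ?k = "\<lambda>i. (-1) ^ i * (of_int l gchoose i) :: complex"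
  let ?w = "\<lambda>i. va_Y V u (l + int i) v"
  let ?c = "\<lambda>a b. bin t U a * bin t W b"
  let ?uv = "\<lambda>a b i. mod_Y M u (int a + l - int i) (mod_Y M v (int b + B + int i) x)"
  let ?vu = "\<lambda>a b i. mod_Y M v (int b + B + l - int i) (mod_Y M u (int a + int i) x)"
  let ?w' = "\<lambda>a b i. mod_Y M (?w i) (int a + (int b + B) - int i) x"
  have w0: "?w i = 0" if "i \<ge> n" for i using that n by (intro K(3)) linarith
  have jac: "(\<Sum>i<n. scal (?k i) (?uv a b i - scal ?e (?vu a b i))) = (\<Sum>i<n. scal (of_nat a gchoose i) (?w' a b i))"
    for a b
  proof -
    have l0: "scal (?k i) (?uv a b i - scal ?e (?vu a b i)) = 0" if "i \<ge> n" for i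
    proof -
      have "mod_Y M v (int b + B + int i) x = 0" using that n by (intro K(1)) linarith
      moreover have "mod_Y M u (int a + int i) x = 0" using that n by (intro K(2)) linarith
      ultimately show ?thesis by (simp add: act_zero_right)
    qed
    have r0: "scal (of_nat a gchoose i) (?w' a b i) = 0" if "i \<ge> n" for i
      using w0[OF that] x by (simp add: act_zero_left)
    have "Sum_any (\<lambda>i. scal (?k i) (?uv a b i - scal ?e (?vu a b i)))
        = Sum_any (\<lambda>i. scal (of_int (int a) gchoose i) (?w' a b i))"
      using jacobi[unfolded jacobi_identity_def, rule_format, OF u v x, of l "int a" "int b + B"] by simp
    moreover have "Sum_any (\<lambda>i. scal (?k i) (?uv a b i - scal ?e (?vu a b i)))
        = (\<Sum>i<n. scal (?k i) (?uv a b i - scal ?e (?vu a b i)))"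
      by (rule Sum_any_lessThan[OF l0])
    moreover have "Sum_any (\<lambda>i. scal (of_nat a gchoose i) (?w' a b i))
        = (\<Sum>i<n. scal (of_nat a gchoose i) (?w' a b i))"
      by (rule Sum_any_lessThan[OF r0])
    ultimately show ?thesis by simp
  qed
  have uv: "modes M (bin t U) u (l - int i) (modes M (bin t W) v (B + int i) x)
      = (\<Sum>a<n. \<Sum>b<n. scal (?c a b) (?uv a b i))" for i
  proof -
    have i1: "l - int i + int a = int a + l - int i" "B + int i + int b = int b + B + int i" for a b
      by simp_all
    have "mod_Y M v (B + int i + int b) x = 0" if "b \<ge> n" for b using that n by (intro K(1)) linarith
    moreover have "mod_Y M u (l - int i + int a) (mod_Y M v (B + int i + int b) x) = 0" if "a \<ge> n" for a b
    proof (cases "B + int i \<ge> K1")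
      case True
      then have "mod_Y M v (B + int i + int b) x = 0" by (intro K(1)) linarith
      then show ?thesis by (simp add: act_zero_right)
    next
      case False
      then show ?thesis using that n by (intro N1) linarith+
    qed
    ultimately show ?thesis
      using modes_modes[OF x, of n v "B + int i" u "l - int i" "bin t U" "bin t W"] by (simp only: i1)
  qed
  have vu: "modes M (bin t W) v (B + l - int i) (modes M (bin t U) u (int i) x)
      = (\<Sum>a<n. \<Sum>b<n. scal (?c a b) (?vu a b i))" for i
  proof -
    have i2: "int i + int a = int a + int i" "B + l - int i + int b = int b + B + l - int i" for a b
      by simp_all
    have "mod_Y M u (int i + int a) x = 0" if "a \<ge> n" for a using that n by (intro K(2)) linarith
    moreover have "mod_Y M v (B + l - int i + int b) (mod_Y M u (int i + int a) x) = 0" if "b \<ge> n" for a b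
    proof (cases "int i \<ge> K2")
      case True
      then have "mod_Y M u (int i + int a) x = 0" by (intro K(2)) linarith
      then show ?thesis by (simp add: act_zero_right)
    next
      case False
      then show ?thesis using that n by (intro N2) linarith+
    qed
    ultimately have "modes M (bin t W) v (B + l - int i) (modes M (bin t U) u (int i) x)
      = (\<Sum>b<n. \<Sum>a<n. scal (?c a b) (?vu a b i))"
      using modes_modes[OF x, of n u "int i" v "B + l - int i" "bin t W" "bin t U"]
      by (simp only: i2 mult.commute[of "bin t W _" "bin t U _"])
    then show ?thesis by (subst sum.swap)
  qed
  have w: "(\<Sum>a<n. \<Sum>b<n. scal (?c a b) (scal (of_nat a gchoose i) (?w' a b i)))
      = scal (bin t U i) (modes M (bin t (U + W - of_nat i)) (?w i) B x)" if "i < n" for i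
  proof (cases "l + int i \<ge> K3")
    case True
    then have "?w i = 0" by (rule K(3))
    then show ?thesis using x by (simp add: act_zero_left modes_zero_left)
  next
    case False
    then show ?thesis
      using that n by (intro bin_substitution[OF x, of i "n - i"] N3) linarith+
  qed
  have "(\<Sum>i<n. scal (?k i) (modes M (bin t U) u (l - int i) (modes M (bin t W) v (B + int i) x)
        - scal ?e (modes M (bin t W) v (B + l - int i) (modes M (bin t U) u (int i) x))))
     = (\<Sum>i<n. \<Sum>a<n. \<Sum>b<n. scal (?c a b) (scal (?k i) (?uv a b i - scal ?e (?vu a b i))))"
    unfolding uv vu
    by (simp add: vs.scale_sum_right vs.scale_right_diff_distrib sum_subtractf mult_ac)
  also have "\<dots> = (\<Sum>a<n. \<Sum>i<n. \<Sum>b<n. scal (?c a b) (scal (?k i) (?uv a b i - scal ?e (?vu a b i))))"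
    by (rule sum.swap)
  also have "\<dots> = (\<Sum>a<n. \<Sum>b<n. \<Sum>i<n. scal (?c a b) (scal (?k i) (?uv a b i - scal ?e (?vu a b i))))"
    by (rule sum.cong[OF refl sum.swap])
  also have "\<dots> = (\<Sum>a<n. \<Sum>b<n. scal (?c a b) (\<Sum>i<n. scal (?k i) (?uv a b i - scal ?e (?vu a b i))))"
    by (simp only: vs.scale_sum_right)
  also have "\<dots> = (\<Sum>a<n. \<Sum>b<n. \<Sum>i<n. scal (?c a b) (scal (of_nat a gchoose i) (?w' a b i)))"
    by (simp only: jac vs.scale_sum_right)
  also have "\<dots> = (\<Sum>a<n. \<Sum>i<n. \<Sum>b<n. scal (?c a b) (scal (of_nat a gchoose i) (?w' a b i)))"
    by (rule sum.cong[OF refl sum.swap])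
  also have "\<dots> = (\<Sum>i<n. \<Sum>a<n. \<Sum>b<n. scal (?c a b) (scal (of_nat a gchoose i) (?w' a b i)))"
    by (rule sum.swap)
  also have "\<dots> = (\<Sum>i<n. scal (bin t U i) (modes M (bin t (U + W - of_nat i)) (?w i) B x))"
    using w by (intro sum.cong) auto
  finally have "(\<Sum>i<n. scal (bin t U i) (modes M (bin t (U + W - of_nat i)) (?w i) B x)) =
    (\<Sum>i<n. scal (?k i) (modes M (bin t U) u (l - int i) (modes M (bin t W) v (B + int i) x)
        - scal ?e (modes M (bin t W) v (B + l - int i) (modes M (bin t U) u (int i) x))))" ..
  then show ?thesis using w0 n0 by (intro exI[of _ n]) auto
qed

end

context voa
begin

sublocale self: voa_module V "adjoint_module V" by unfold_locales

end

section \<open>A family of products interpolating between the two quotients\<close>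

text \<open>The product \<open>u \<ast>\<^sub>t x\<close> for \<open>j = 1\<close> and \<open>u \<circ>\<^sub>t x\<close> for \<open>j = 2\<close>, extended linearly from homogeneous \<open>u\<close>: the residue
  of \<open>(1 + t z)\<^bsup>wt u\<^esup> z\<^bsup>-j\<^esup> Y(u, z) x\<close>. Zhu's products are the case \<open>t = 1\<close>, and for \<open>t = 0\<close> only \<open>u\<^bsub>-j\<^esub> x\<close>
  remains.\<close>

definition dprod :: "'v::ab_group_add dg_voa \<Rightarrow> ('v, 'm::ab_group_add) dg_mod \<Rightarrow> complex \<Rightarrow> int \<Rightarrow> 'v \<Rightarrow> 'm \<Rightarrow> 'm" where
  "dprod V M t j u x = Sum_any (\<lambda>r::rat. modes M (bin t (of_rat r)) (component half_ints (voa_wt V) u r) (- j) x)"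

text \<open>The subspace \<open>O(M)\<close> for \<open>t = 1\<close>, and \<open>C\<^sub>2(M)\<close> for \<open>t = 0\<close>.\<close>

definition dO :: "'v::ab_group_add dg_voa \<Rightarrow> ('v, 'm::ab_group_add) dg_mod \<Rightarrow> complex \<Rightarrow> 'm set" where
  "dO V M t = module.span (mod_scale M) {dprod V M t 2 u x | u x. x \<in> mod_space M}"

lemma zhu_prod_eq: "zhu_prod V M j u x = dprod V M 1 j u x"
  by (simp add: zhu_prod_def dprod_def modes_def bin_def)

lemma zhu_O_eq: "zhu_O V M = dO V M 1"
  by (simp add: zhu_O_def dO_def zhu_prod_eq)

context voa_module
begin

abbreviation vpart :: "'v \<Rightarrow> rat \<Rightarrow> 'v" where "vpart \<equiv> component half_ints (voa_wt V)"

lemmas vpart_add = V.adj.wt.part_add[simplified]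
  and vpart_scale = V.adj.wt.part_scale[simplified]
  and finite_vpart = V.adj.wt.finite_part[simplified]
  and vpart_homogeneous = V.adj.wt.part_homogeneous[simplified]
  and sum_vpart = V.adj.wt.sum_part[simplified]
  and vpart_in = V.adj.wt.part_in[simplified]
  and vpart_outside = V.adj.wt.part_outside[simplified]

abbreviation vhom :: "rat \<Rightarrow> int \<Rightarrow> 'v set" where "vhom n p \<equiv> voa_wt V n \<inter> va_deg V p"
abbreviation vsupp :: "(rat \<times> int) set \<Rightarrow> 'v set" where "vsupp \<equiv> V.adj.bi.supported"

lemma biadditive_zero:
  fixes f :: "'v \<Rightarrow> 'm \<Rightarrow> 'c::ab_group_add"
  assumes "\<And>u v x. x \<in> space \<Longrightarrow> f (u + v) x = f u x + f v x"
    and "\<And>u x y. x \<in> space \<Longrightarrow> y \<in> space \<Longrightarrow> f u (x + y) = f u x + f u y"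
  shows "x \<in> space \<Longrightarrow> f 0 x = 0" "f u 0 = 0"
  using assms(1)[of x 0 0] assms(2)[of 0 0 u] dg.U_zero by simp_all

text \<open>Jacobi identity, differential and weights are given for homogeneous vectors only; membership of
  biadditive expressions in a subspace is reduced to this case.\<close>

lemma biadditive_supported:
  fixes f :: "'v \<Rightarrow> 'm \<Rightarrow> 'c::ab_group_add"
  assumes add: "\<And>u v x. x \<in> space \<Longrightarrow> f (u + v) x = f u x + f v x"
    "\<And>u x y. x \<in> space \<Longrightarrow> y \<in> space \<Longrightarrow> f u (x + y) = f u x + f u y"
    and K: "0 \<in> K" "\<And>a b. a \<in> K \<Longrightarrow> b \<in> K \<Longrightarrow> a + b \<in> K"
    and hom: "\<And>n p r q u x. n \<in> half_ints \<Longrightarrow> r \<in> half_ints \<Longrightarrow> (n, p) \<in> B \<Longrightarrow> (r, q) \<in> C \<Longrightarrow>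
      u \<in> vhom n p \<Longrightarrow> x \<in> mod_wt M r \<Longrightarrow> x \<in> mod_deg M q \<Longrightarrow> f u x \<in> K"
    and u: "u \<in> vsupp B" and x: "x \<in> bi.supported C"
  shows "f u x \<in> K"
  using u x
proof (induction arbitrary: x rule: V.adj.bi.supported_induct)
  case zero then show ?case
    using biadditive_zero(1)[of f, OF add] K by (simp add: bi.supportedD)
next
  case (add u v) then show ?case using assms(1) K by (simp add: bi.supportedD)
next
  case (homogeneous i u)
  note u = this
  show ?case using u(4)
  proof (induction rule: bi.supported_induct)
    case zero then show ?case using biadditive_zero(2)[of f, OF assms(1,2)] K by simp
  next
    case (add x y) then show ?case using assms(2) K by simp
  next
    case (homogeneous k x)
    then show ?case using hom[of "fst i" "fst k" "snd i" "snd k" u x] u(1-3) by auto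
  qed
qed

lemma biadditive_mem:
  fixes f :: "'v \<Rightarrow> 'm \<Rightarrow> 'c::ab_group_add"
  assumes "\<And>u v x. x \<in> space \<Longrightarrow> f (u + v) x = f u x + f v x"
    "\<And>u x y. x \<in> space \<Longrightarrow> y \<in> space \<Longrightarrow> f u (x + y) = f u x + f u y"
    "0 \<in> K" "\<And>a b. a \<in> K \<Longrightarrow> b \<in> K \<Longrightarrow> a + b \<in> K"
    and "\<And>n p r q u x. n \<in> half_ints \<Longrightarrow> r \<in> half_ints \<Longrightarrow> u \<in> vhom n p \<Longrightarrow>
      x \<in> mod_wt M r \<Longrightarrow> x \<in> mod_deg M q \<Longrightarrow> f u x \<in> K"
    and "x \<in> space"
  shows "f u x \<in> K"
proof (rule biadditive_supported[OF assms(1-4), of UNIV UNIV])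
  show "u \<in> vsupp UNIV" unfolding V.adj.bi.supported_def by simp
  show "x \<in> bi.supported UNIV" using assms(6) unfolding bi.supported_def by simp
qed (use assms(5) in auto)

lemma finite_dprod:
  assumes "x \<in> space"
  shows "finite {r. modes M (bin t (of_rat r)) (vpart u r) (- j) x \<noteq> 0}"
proof (rule finite_subset)
  show "{r. modes M (bin t (of_rat r)) (vpart u r) (- j) x \<noteq> 0} \<subseteq> {r. vpart u r \<noteq> 0}"
    using modes_zero_left[OF assms] by auto
qed (rule finite_vpart)

lemma dprod_in: "x \<in> space \<Longrightarrow> dprod V M t j u x \<in> space"
  unfolding dprod_def Sum_any.expand_set by (intro dg.U_sum modes_in)

lemma dprod_add_left:
  "x \<in> space \<Longrightarrow> dprod V M t j (u + v) x = dprod V M t j u x + dprod V M t j v x"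
  unfolding dprod_def vpart_add
  by (simp add: modes_add_left finite_dprod Sum_any.distrib)

lemma dprod_add_right:
  "x \<in> space \<Longrightarrow> y \<in> space \<Longrightarrow> dprod V M t j u (x + y) = dprod V M t j u x + dprod V M t j u y"
  unfolding dprod_def by (simp add: modes_add_right finite_dprod Sum_any.distrib)

lemma dprod_homogeneous:
  assumes "n \<in> half_ints" "u \<in> voa_wt V n" "x \<in> space"
  shows "dprod V M t j u x = modes M (bin t (of_rat n)) u (- j) x"
proof -
  have "(\<lambda>r. modes M (bin t (of_rat r)) (vpart u r) (- j) x) =
    (\<lambda>r. if r \<in> {n} then modes M (bin t (of_rat n)) u (- j) x else 0)"
    using assms by (auto simp: vpart_homogeneous modes_zero_left)
  from Sum_any_if[OF this] show ?thesis by (simp add: dprod_def)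
qed

lemma dprod_zero_left: "x \<in> space \<Longrightarrow> dprod V M t j 0 x = 0"
  using biadditive_zero[of "dprod V M t j"] dprod_add_left dprod_add_right by blast+

lemma dprod_scale_right:
  assumes "x \<in> space" shows "dprod V M t j u (scal a x) = scal a (dprod V M t j u x)"
proof -
  have "dprod V M t j u y = (\<Sum>r | vpart u r \<noteq> 0. modes M (bin t (of_rat r)) (vpart u r) (- j) y)"
    if "y \<in> space" for y
    unfolding dprod_def using modes_zero_left[OF that] finite_vpart
    by (intro Sum_any.expand_superset) auto
  then show ?thesis using assms by (simp add: dg.U_scale modes_scale_right vs.scale_sum_right)
qed

lemma dprod_sum_left:
  "x \<in> space \<Longrightarrow> dprod V M t j (sum g J) x = (\<Sum>i\<in>J. dprod V M t j (g i) x)"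
  by (induction J rule: infinite_finite_induct) (auto simp: dprod_zero_left dprod_add_left)

lemma dprod_scale_left:
  assumes "x \<in> space" shows "dprod V M t j (va_scale V a u) x = scal a (dprod V M t j u x)"
proof -
  have "{r. va_scale V a (vpart u r) \<noteq> 0} \<subseteq> {r. vpart u r \<noteq> 0}" by auto
  then have "dprod V M t j (va_scale V a u) x = (\<Sum>r | vpart u r \<noteq> 0.
      modes M (bin t (of_rat r)) (va_scale V a (vpart u r)) (- j) x)"
    unfolding dprod_def vpart_scale using modes_zero_left[OF assms] finite_vpart
    by (intro Sum_any.expand_superset) auto
  moreover have "dprod V M t j u x = (\<Sum>r | vpart u r \<noteq> 0. modes M (bin t (of_rat r)) (vpart u r) (- j) x)"
    unfolding dprod_def using modes_zero_left[OF assms] finite_vpart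
    by (intro Sum_any.expand_superset) auto
  ultimately show ?thesis using assms by (simp add: modes_scale_left vs.scale_sum_right)
qed

lemma modes_bin_0:
  assumes "x \<in> space" shows "modes M (bin 0 r) u N x = mod_Y M u N x"
proof -
  have "(\<lambda>k. scal (bin 0 r k) (mod_Y M u (N + int k) x)) = (\<lambda>k. if k \<in> {0} then mod_Y M u N x else 0)"
    by (auto simp: bin_def)
  from Sum_any_if[OF this] show ?thesis by (simp add: modes_def)
qed

lemma dprod_0:
  assumes "x \<in> space" shows "dprod V M 0 j u x = mod_Y M u (- j) x"
proof -
  have "dprod V M 0 j u x = Sum_any (\<lambda>r. mod_Y M (vpart u r) (- j) x)"
    using assms by (simp add: dprod_def modes_bin_0)
  also have "\<dots> = (\<Sum>r | vpart u r \<noteq> 0. mod_Y M (vpart u r) (- j) x)"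
    using act_zero_left[OF assms] finite_vpart by (intro Sum_any.expand_superset) auto
  also have "\<dots> = mod_Y M (\<Sum>r | vpart u r \<noteq> 0. vpart u r) (- j) x"
    using assms by (simp add: act_sum_left)
  finally show ?thesis by (simp add: sum_vpart)
qed

lemma C2_eq: "C2 M = dO V M 0"
proof -
  have "{mod_Y M v (- 2) x |v x. x \<in> space} = {dprod V M 0 2 u x |u x. x \<in> space}"
    using dprod_0 by metis
  then show ?thesis by (simp add: C2_def dO_def)
qed

lemma subspace_dO: "vs.subspace (dO V M t)"
  unfolding dO_def by (rule vs.subspace_span)

lemma dprod_2_in_dO: "x \<in> space \<Longrightarrow> dprod V M t 2 u x \<in> dO V M t"
  unfolding dO_def by (rule vs.span_base) auto

lemma dO_subset: "dO V M t \<subseteq> space"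
  unfolding dO_def using dprod_in by (intro vs.span_minimal dg.subspace_U) auto

lemmas dO_0 = vs.subspace_0[OF subspace_dO]
  and dO_add = vs.subspace_add[OF subspace_dO]
  and dO_diff = vs.subspace_diff[OF subspace_dO]
  and dO_scale = vs.subspace_scale[OF subspace_dO]
  and dO_sum = vs.subspace_sum[OF subspace_dO]

lemma dO_induct:
  assumes "y \<in> dO V M t" "vs.subspace K" "\<And>u x. x \<in> space \<Longrightarrow> f (dprod V M t 2 u x) \<in> K"
    and add: "\<And>x y. x \<in> space \<Longrightarrow> y \<in> space \<Longrightarrow> f (x + y) = f x + f y"
    and scale: "\<And>c x. x \<in> space \<Longrightarrow> f (scal c x) = scal c (f x)"
  shows "f y \<in> K"
proof (rule dg.linear_span_mem[where t = scal and f = f, OF _ _ _ add scale vector_space assms(2)])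
  show "y \<in> vs.span {dprod V M t 2 u x | u x. x \<in> space}" using assms(1) by (simp add: dO_def)
qed (use dprod_in assms(3) in auto)

lemma Y_weight_V:
  assumes "u \<in> voa_wt V n" "v \<in> voa_wt V r"
  shows "va_Y V u m v \<in> voa_wt V (n + r - of_int m - 1)"
  using V.Y_weight[OF assms, of m] by (simp add: algebra_simps)

lemma bin_Suc: "bin t (n + 1) (Suc m) = bin t n (Suc m) + t * bin t n m"
  unfolding bin_def gbinomial_Suc_Suc by (simp add: distrib_left mult_ac)

text \<open>The coefficients of \<open>- z\<^bsup>j+1\<^esup>\<close> times the derivative of \<open>z\<^bsup>-j\<^esup> (1 + t z)\<^bsup>n+1\<^esup>\<close>, once from the series and once
  from the product rule.\<close>

lemma bin_derivative:
  "bin t (n + 1) k * (of_nat j - of_nat k) =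
    of_nat j * bin t n k + t * (of_nat j - 1 - n) * (case k of 0 \<Rightarrow> 0 | Suc i \<Rightarrow> bin t n i)"
proof (cases k)
  case (Suc m)
  have "(of_nat m + 1) * (n gchoose Suc m) = (n - of_nat m) * (n gchoose m)"
    using gbinomial_mult_1[of n m] by (simp add: algebra_simps)
  then have absorb: "(of_nat m + 1) * bin t n (Suc m) = t * (n - of_nat m) * bin t n m"
    by (simp add: bin_def)
  obtain a b where ab: "a = bin t n (Suc m)" "b = bin t n m" by simp
  show ?thesis using absorb unfolding Suc bin_Suc by (simp flip: ab add: algebra_simps)
qed simp

text \<open>Integration by parts: pairing \<open>(1 + t z)\<^bsup>n+1\<^esup> z\<^bsup>-j\<^esup>\<close> with the derivative of \<open>u\<close>, which has weight \<open>n + 1\<close>, is,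
  up to the sign, pairing the derivative of this function with \<open>u\<close>. This raises the order of the pole by one.\<close>

lemma modes_in_dO_nat:
  assumes "n \<in> half_ints" "u \<in> voa_wt V n" "x \<in> space"
  shows "modes M (bin t (of_rat n)) u (- int (j + 2)) x \<in> dO V M t"
  using assms(1,2)
proof (induction j arbitrary: n u)
  case 0
  then show ?case using dprod_2_in_dO[OF assms(3), of t u] assms(3) by (simp add: dprod_homogeneous)
next
  case (Suc j)
  let ?i = "j + 2" and ?v = "va_Y V u (-2) (va_vac V)" and ?r = "of_rat n :: complex"
  have wt: "?v \<in> voa_wt V (n + 1)" using Y_weight_V[OF Suc.prems(2) V.vac_weight, of "-2"] by (simp add: add.commute)
  have n1: "n + 1 \<in> half_ints" using Suc.prems by (simp add: half_ints_add)
  have shift: "modes M c u (- int ?i) x = modes M (\<lambda>k. case k of 0 \<Rightarrow> 0 | Suc i \<Rightarrow> c i) u (- int (Suc j + 2)) x" for c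
    using modes_shift[OF assms(3), of c u "- int (Suc j + 2)"] by simp
  have "modes M (bin t (of_rat (n + 1))) ?v (- int ?i) x =
      modes M (\<lambda>k. bin t (?r + 1) k * (of_nat ?i - of_nat k)) u (- int (Suc j + 2)) x"
    unfolding modes_def
  proof (rule Sum_any.cong)
    fix k
    have idx: "- int ?i + int k - 1 = - int (Suc j + 2) + int k" by simp
    have coeff: "- of_int (- int ?i + int k) = (of_nat ?i - of_nat k :: complex)" by simp
    have "mod_Y M ?v (- int ?i + int k) x = scal (of_nat ?i - of_nat k) (mod_Y M u (- int (Suc j + 2) + int k) x)"
      using derivative_mode[OF V.dg_vertex_algebra_axioms weak_dg_module_axioms assms(3), of u "- int ?i + int k"]
      unfolding idx coeff .
    then show "scal (bin t (of_rat (n + 1)) k) (mod_Y M ?v (- int ?i + int k) x) =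
        scal (bin t (?r + 1) k * (of_nat ?i - of_nat k)) (mod_Y M u (- int (Suc j + 2) + int k) x)"
      by (simp add: of_rat_add)
  qed
  also have "\<dots> = scal (of_nat ?i) (modes M (bin t ?r) u (- int (Suc j + 2)) x)
      + scal (t * (of_nat ?i - 1 - ?r)) (modes M (bin t ?r) u (- int ?i) x)"
    unfolding bin_derivative shift by (rule modes_add_coeff[OF assms(3)])
  finally have "scal (of_nat ?i) (modes M (bin t ?r) u (- int (Suc j + 2)) x) \<in> dO V M t"
    using dO_diff[OF Suc.IH[OF n1 wt] dO_scale[OF Suc.IH[OF Suc.prems], of "t * (of_nat ?i - 1 - ?r)"]] by simp
  then have "scal (1 / of_nat ?i) (scal (of_nat ?i) (modes M (bin t ?r) u (- int (Suc j + 2)) x)) \<in> dO V M t"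
    by (rule dO_scale)
  moreover have "(of_nat ?i :: complex) \<noteq> 0" by (simp flip: of_nat_Suc of_nat_add)
  ultimately show ?case by simp
qed

lemma modes_in_dO:
  assumes "n \<in> half_ints" "u \<in> voa_wt V n" "x \<in> space" "N \<le> -2"
  shows "modes M (bin t (of_rat n)) u N x \<in> dO V M t"
  using modes_in_dO_nat[OF assms(1-3), of t "nat (- 2 - N)"] assms(4) by simp

lemma modes_bin_Suc:
  assumes "x \<in> space"
  shows "modes M (bin t (r + 1)) u N x = modes M (bin t r) u N x + scal t (modes M (bin t r) u (N + 1) x)"
proof -
  have "bin t (r + 1) = (\<lambda>k. 1 * bin t r k + t * (case k of 0 \<Rightarrow> 0 | Suc i \<Rightarrow> bin t r i))"
    by (rule ext) (simp add: bin_Suc split: nat.split)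
  then show ?thesis using modes_add_coeff[OF assms, of 1 "bin t r" t] modes_shift[OF assms] by simp
qed

end

context voa_module
begin

text \<open>The vector \<open>u\<^bsub>i-k\<^esub> v\<close> has weight \<open>n + r + k - 1 - i\<close>, so the exponents are those of \<open>residue_jacobi\<close> with
  \<open>U = n\<close> and \<open>W = r + k - 1\<close>.\<close>

lemma dprod_dprod:
  assumes n: "n \<in> half_ints" and r: "r \<in> half_ints" and u: "u \<in> vhom n p" and v: "v \<in> vhom r q"
    and x: "x \<in> space" and N: "\<forall>i\<ge>N. va_Y V u (- k + int i) v = 0"
  shows "dprod V M t j (dprod V (adjoint_module V) t k u v) x =
    (\<Sum>i<N. scal (bin t (of_rat n) i)
       (modes M (bin t (of_rat n + (of_rat r + of_int k - 1) - of_nat i)) (va_Y V u (- k + int i) v) (- j) x))"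
proof -
  have "dprod V (adjoint_module V) t k u v = modes (adjoint_module V) (bin t (of_rat n)) u (- k) v"
    using V.self.dprod_homogeneous n u by simp
  also have "\<dots> = (\<Sum>i<N. va_scale V (bin t (of_rat n) i) (va_Y V u (- k + int i) v))"
    using V.adj.modes_eq_sum[of v N u "- k"] N by simp
  finally have "dprod V M t j (dprod V (adjoint_module V) t k u v) x =
    (\<Sum>i<N. scal (bin t (of_rat n) i) (dprod V M t j (va_Y V u (- k + int i) v) x))"
    using x by (simp add: dprod_sum_left dprod_scale_left)
  also have "\<dots> = (\<Sum>i<N. scal (bin t (of_rat n) i)
       (modes M (bin t (of_rat n + (of_rat r + of_int k - 1) - of_nat i)) (va_Y V u (- k + int i) v) (- j) x))"
  proof (rule sum.cong[OF refl])
    fix i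
    let ?w = "n + (r + of_int k - 1) - of_int (int i)"
    have w: "?w \<in> half_ints" using n r by (intro half_ints_add half_ints_diff half_ints_of_int) simp_all
    have "va_Y V u (- k + int i) v \<in> voa_wt V ?w"
      using Y_weight_V[of u n v r "- k + int i"] u v by (simp add: algebra_simps)
    then have "dprod V M t j (va_Y V u (- k + int i) v) x = modes M (bin t (of_rat ?w)) (va_Y V u (- k + int i) v) (- j) x"
      using w x by (simp only: dprod_homogeneous)
    also have "of_rat ?w = (of_rat n + (of_rat r + of_int k - 1) - of_nat i :: complex)"
      by (simp add: of_rat_add of_rat_diff)
    finally show "scal (bin t (of_rat n) i) (dprod V M t j (va_Y V u (- k + int i) v) x) = scal (bin t (of_rat n) i)
        (modes M (bin t (of_rat n + (of_rat r + of_int k - 1) - of_nat i)) (va_Y V u (- k + int i) v) (- j) x)"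
      by simp
  qed
  finally show ?thesis .
qed

text \<open>For \<open>l = -2\<close> the expansion of \<open>(z\<^sub>1 - z\<^sub>2)\<^sup>-\<^sup>2\<close> leaves only poles of order at least two in \<open>z\<^sub>1\<close> or \<open>z\<^sub>2\<close>. The
  weight of \<open>u \<circ>\<^sub>t v\<close> brings in an additional factor \<open>1 + t z\<^sub>2\<close>; it lowers the order of the pole in \<open>z\<^sub>2\<close> by at
  most one, and that order is at least three.\<close>

lemma dO_dprod_homogeneous:
  assumes n: "n \<in> half_ints" and r: "r \<in> half_ints" and u: "u \<in> vhom n p" and v: "v \<in> vhom r q"
    and x: "x \<in> space"
  shows "dprod V M t 1 (dprod V (adjoint_module V) t 2 u v) x \<in> dO V M t"
proof -
  obtain N where N: "\<forall>i\<ge>N. va_Y V u (-2 + int i) v = 0" and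
    eq: "(\<Sum>i<N. scal (bin t (of_rat n) i) (modes M (bin t (of_rat n + (of_rat r + 1) - of_nat i)) (va_Y V u (-2 + int i) v) (-1) x))
      = (\<Sum>i<N. scal ((-1) ^ i * (of_int (-2) gchoose i))
       (modes M (bin t (of_rat n)) u (-2 - int i) (modes M (bin t (of_rat r + 1)) v (-1 + int i) x)
        - scal ((-1) powi (-2) * (-1) powi (p * q))
            (modes M (bin t (of_rat r + 1)) v (-1 + (-2) - int i) (modes M (bin t (of_rat n)) u (int i) x))))"
    (is "_ = ?R")
    using residue_jacobi[of u p v q x "-2" t "of_rat n" "of_rat r + 1" "-1"] u v x by blast
  have "?R \<in> dO V M t"
  proof (intro dO_sum dO_scale dO_diff)
    fix i
    show "modes M (bin t (of_rat n)) u (-2 - int i) (modes M (bin t (of_rat r + 1)) v (-1 + int i) x) \<in> dO V M t"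
      using n u x by (intro modes_in_dO modes_in) auto
    show "modes M (bin t (of_rat r + 1)) v (-1 + (-2) - int i) (modes M (bin t (of_rat n)) u (int i) x) \<in> dO V M t"
      using r v x modes_in[OF x] by (subst modes_bin_Suc) (auto intro!: modes_in_dO dO_add dO_scale)
  qed
  then show ?thesis using dprod_dprod[OF n r u v x, of N 2 t 1] N eq by (simp add: add.commute)
qed

text \<open>For \<open>l = -1\<close> the expansion of \<open>(z\<^sub>1 - z\<^sub>2)\<^sup>-\<^sup>1\<close> contributes the composite of the two operators, and
  otherwise poles of order at least two in \<open>z\<^sub>1\<close> or \<open>z\<^sub>2\<close>.\<close>

lemma associator_homogeneous:
  assumes n: "n \<in> half_ints" and r: "r \<in> half_ints" and u: "u \<in> vhom n p" and v: "v \<in> vhom r q"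
    and x: "x \<in> space" and j: "j \<ge> 1"
  shows "dprod V M t j (dprod V (adjoint_module V) t 1 u v) x - dprod V M t 1 u (dprod V M t j v x) \<in> dO V M t"
proof -
  let ?k = "\<lambda>i::nat. (-1) ^ i * (of_int (-1) gchoose i) :: complex"
  let ?e = "(-1) powi (-1) * (-1) powi (p * q) :: complex"
  let ?uv = "\<lambda>i. modes M (bin t (of_rat n)) u (-1 - int i) (modes M (bin t (of_rat r)) v (- j + int i) x)"
  let ?vu = "\<lambda>i. modes M (bin t (of_rat r)) v (- j + (-1) - int i) (modes M (bin t (of_rat n)) u (int i) x)"
  let ?L = "\<lambda>N. \<Sum>i<N. scal (bin t (of_rat n) i)
    (modes M (bin t (of_rat n + of_rat r - of_nat i)) (va_Y V u (-1 + int i) v) (- j) x)"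
  obtain N where N: "N > 0" "\<forall>i\<ge>N. va_Y V u (-1 + int i) v = 0" and
    eq: "?L N = (\<Sum>i<N. scal (?k i) (?uv i - scal ?e (?vu i)))"
    using residue_jacobi[of u p v q x "-1" t "of_rat n" "of_rat r" "- j"] u v x by auto
  have vu: "?vu i \<in> dO V M t" for i using r v x j by (intro modes_in_dO modes_in) auto
  have uv: "?uv (Suc i) \<in> dO V M t" for i using n u x by (intro modes_in_dO modes_in) auto
  obtain m where m: "N = Suc m" using N(1) not0_implies_Suc by blast
  have "?L N - ?uv 0 = - scal ?e (?vu 0) + (\<Sum>i<m. scal (?k (Suc i)) (?uv (Suc i) - scal ?e (?vu (Suc i))))"
    unfolding eq unfolding m sum.lessThan_Suc_shift by simp
  also have "\<dots> \<in> dO V M t"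
    using vu uv by (intro dO_add dO_sum dO_scale dO_diff vs.subspace_neg[OF subspace_dO])
  finally have "?L N - ?uv 0 \<in> dO V M t" .
  moreover have "dprod V M t j (dprod V (adjoint_module V) t 1 u v) x = ?L N"
    using dprod_dprod[OF n r u v x, of N 1 t j] N by simp
  moreover have "dprod V M t 1 u (dprod V M t j v x) = ?uv 0"
    using n r u v x by (simp add: dprod_homogeneous modes_in)
  ultimately show ?thesis by simp
qed

lemma associator:
  assumes x: "x \<in> space" and j: "j \<ge> 1"
  shows "dprod V M t j (dprod V (adjoint_module V) t 1 u v) x - dprod V M t 1 u (dprod V M t j v x) \<in> dO V M t"
    (is "?f u v \<in> _")
proof (rule V.self.biadditive_mem[OF _ _ dO_0 dO_add, where f = "\<lambda>u v. ?f u v"])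
  note lin = V.self.dprod_add_left[simplified] V.self.dprod_add_right[simplified]
    dprod_add_left dprod_add_right dprod_in
  show "?f (u + u') v = ?f u v + ?f u' v" "?f u (v + v') = ?f u v + ?f u v'" for u u' v v'
    using x by (simp_all add: lin)
  show "?f u v \<in> dO V M t" if "n \<in> half_ints" "r \<in> half_ints" "u \<in> vhom n p"
    "v \<in> mod_wt (adjoint_module V) r" "v \<in> mod_deg (adjoint_module V) q" for n r p q u v
    using associator_homogeneous[OF that(1-3) _ x j] that by simp
qed simp_all

lemma dO_dprod:
  assumes "u \<in> dO V (adjoint_module V) t" "x \<in> space" shows "dprod V M t 1 u x \<in> dO V M t"
proof -
  have gen: "dprod V M t 1 (dprod V (adjoint_module V) t 2 u v) x \<in> dO V M t" (is "?f u v \<in> _") for u v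
  proof (rule V.self.biadditive_mem[OF _ _ dO_0 dO_add, where f = "\<lambda>u v. ?f u v"])
    note lin = V.self.dprod_add_left[simplified] V.self.dprod_add_right[simplified] dprod_add_left
    show "?f (u + u') v = ?f u v + ?f u' v" "?f u (v + v') = ?f u v + ?f u v'" for u u' v v'
      using assms(2) by (simp_all add: lin)
    show "?f u v \<in> dO V M t" if "n \<in> half_ints" "r \<in> half_ints" "u \<in> vhom n p"
      "v \<in> mod_wt (adjoint_module V) r" "v \<in> mod_deg (adjoint_module V) q" for n r p q u v
      using dO_dprod_homogeneous[OF that(1-3) _ assms(2)] that by simp
  qed simp_all
  show ?thesis
  proof (rule V.adj.dg.linear_span_mem[where t = scal and f = "\<lambda>u. dprod V M t 1 u x"])
    show "u \<in> V.adj.vs.span {dprod V (adjoint_module V) t 2 u v | u v. v \<in> mod_space (adjoint_module V)}"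
      using assms(1) by (simp add: dO_def)
  qed (use gen assms(2) in \<open>auto simp: dprod_add_left dprod_scale_left vector_space subspace_dO\<close>)
qed

text \<open>Modulo \<open>O\<^sub>t(M)\<close>, the vector \<open>u \<ast>\<^sub>t (v \<circ>\<^sub>t x)\<close> is \<open>(u \<ast>\<^sub>t v) \<circ>\<^sub>t x\<close>.\<close>

lemma dprod_dO:
  assumes "y \<in> dO V M t" shows "dprod V M t 1 u y \<in> dO V M t"
proof (rule dO_induct[OF assms subspace_dO])
  fix v x assume x: "x \<in> space"
  have "dprod V M t 2 (dprod V (adjoint_module V) t 1 u v) x
      - (dprod V M t 2 (dprod V (adjoint_module V) t 1 u v) x - dprod V M t 1 u (dprod V M t 2 v x)) \<in> dO V M t"
    using x by (intro dO_diff dprod_2_in_dO associator) auto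
  then show "dprod V M t 1 u (dprod V M t 2 v x) \<in> dO V M t" by simp
qed (simp_all add: dprod_add_right dprod_scale_right)

end

section \<open>Gradings, differential and morphisms on the family of quotients\<close>

context voa_module
begin

lemma act_bihomogeneous:
  assumes "n \<in> half_ints" "r \<in> half_ints" "u \<in> vhom n p" "x \<in> mod_wt M r" "x \<in> mod_deg M q"
  shows "mod_Y M u m x \<in> bi.supported {(n + r - of_int m - 1, p + q - 2 * m - 2)}"
proof -
  have "mod_Y M u m x \<in> mod_wt M (r + n - of_int m - 1)" using assms Y_weight[of n r u m] by auto
  then have "mod_Y M u m x \<in> mod_wt M (n + r - of_int m - 1)" by (simp add: add.commute)
  moreover have "mod_Y M u m x \<in> mod_deg M (q + (p - 2 * m - 2))" using assms Y_degree[of u p m q] by auto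
  then have "mod_Y M u m x \<in> mod_deg M (p + q - 2 * m - 2)" by (simp add: algebra_simps)
  moreover have "n + r - of_int m - 1 \<in> half_ints"
    using assms by (intro half_ints_diff half_ints_add half_ints_of_int) auto
  ultimately show ?thesis using bi_homogeneous[of "n + r - of_int m - 1" "p + q - 2 * m - 2"] by blast
qed

lemma act_supported:
  assumes "u \<in> vsupp B" "x \<in> bi.supported C"
    and D: "\<And>n p r q. (n, p) \<in> B \<Longrightarrow> (r, q) \<in> C \<Longrightarrow> (n + r - of_int m - 1, p + q - 2 * m - 2) \<in> D"
  shows "mod_Y M u m x \<in> bi.supported D"
proof (rule biadditive_supported[OF _ _ bi.supported_0 bi.supported_add _ assms(1,2)])
  fix n r :: rat and p q u x
  assume *: "n \<in> half_ints" "r \<in> half_ints" "(n, p) \<in> B" "(r, q) \<in> C"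
    "u \<in> vhom n p" "x \<in> mod_wt M r" "x \<in> mod_deg M q"
  show "mod_Y M u m x \<in> bi.supported D"
    using act_bihomogeneous[OF *(1,2,5-7), of m] bi.supported_mono[of "{_}" D] D[OF *(3,4)] by blast
qed (simp_all add: act_add_left act_add_right)

text \<open>A mode \<open>u\<^bsub>N+i\<^esub>\<close> lowers the weight by \<open>i\<close> and the degree by \<open>2 i\<close> in comparison with \<open>u\<^sub>N\<close>.\<close>

lemma modes_supported:
  assumes "u \<in> vsupp B" "x \<in> bi.supported C"
    and D: "\<And>n p r q i. (n, p) \<in> B \<Longrightarrow> (r, q) \<in> C \<Longrightarrow> i > 0 \<Longrightarrow>
      (n + r - of_int N - 1 - of_nat i, p + q - 2 * N - 2 - 2 * int i) \<in> D"
  shows "modes M c u N x - scal (c 0) (mod_Y M u N x) \<in> bi.supported D"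
proof -
  have x: "x \<in> space" using assms(2) by (rule bi.supportedD)
  obtain m where "\<forall>k\<ge>m. mod_Y M u (N + int k) x = 0" using modes_truncation[OF x] by blast
  then have "modes M c u N x = (\<Sum>k<Suc m. scal (c k) (mod_Y M u (N + int k) x))"
    using x by (intro modes_eq_sum) auto
  then have "modes M c u N x - scal (c 0) (mod_Y M u N x)
      = (\<Sum>k<m. scal (c (Suc k)) (mod_Y M u (N + int (Suc k)) x))"
    unfolding sum.lessThan_Suc_shift by simp
  also have "\<dots> \<in> bi.supported D"
  proof (intro vs.subspace_sum vs.subspace_scale bi.subspace_supported act_supported[OF assms(1,2)])
    fix k n p r q assume "(n, p) \<in> B" "(r, q) \<in> C"
    from D[OF this, of "Suc k"]
    show "(n + r - of_int (N + int (Suc k)) - 1, p + q - 2 * (N + int (Suc k)) - 2) \<in> D"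
      by (simp add: algebra_simps)
  qed
  finally show ?thesis .
qed

lemma dprod_leading_term:
  assumes "u \<in> vsupp B" "x \<in> bi.supported C"
    and D: "\<And>n p r q i. (n, p) \<in> B \<Longrightarrow> (r, q) \<in> C \<Longrightarrow> i > 0 \<Longrightarrow>
      (n + r + of_int j - 1 - of_nat i, p + q + 2 * j - 2 - 2 * int i) \<in> D"
  shows "dprod V M t j u x - mod_Y M u (- j) x \<in> bi.supported D"
proof (rule biadditive_supported[OF _ _ bi.supported_0 bi.supported_add _ assms(1,2)])
  fix n r :: rat and p q u x
  assume *: "n \<in> half_ints" "r \<in> half_ints" "(n, p) \<in> B" "(r, q) \<in> C"
    "u \<in> vhom n p" "x \<in> mod_wt M r" "x \<in> mod_deg M q"
  have "u \<in> vsupp {(n, p)}" "x \<in> bi.supported {(r, q)}"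
    using * bi_homogeneous[of r q] V.adj.bi_homogeneous[of n p] by auto
  then have "modes M (bin t (of_rat n)) u (- j) x - scal (bin t (of_rat n) 0) (mod_Y M u (- j) x) \<in> bi.supported D"
    using D[OF *(3,4)] by (intro modes_supported) auto
  then show "dprod V M t j u x - mod_Y M u (- j) x \<in> bi.supported D"
    using * mod_wt_in by (simp add: dprod_homogeneous)
qed (simp_all add: act_add_left act_add_right dprod_add_left dprod_add_right)

lemma dprod_supported:
  assumes "u \<in> vsupp B" "x \<in> bi.supported C"
    and D: "\<And>n p r q i. (n, p) \<in> B \<Longrightarrow> (r, q) \<in> C \<Longrightarrow>
      (n + r + of_int j - 1 - of_nat i, p + q + 2 * j - 2 - 2 * int i) \<in> D"
  shows "dprod V M t j u x \<in> bi.supported D"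
proof -
  have "dprod V M t j u x - mod_Y M u (- j) x \<in> bi.supported D"
    using D by (intro dprod_leading_term[OF assms(1,2)]) auto
  moreover have "mod_Y M u (- j) x \<in> bi.supported D"
    using D[of _ _ _ _ 0] by (intro act_supported[OF assms(1,2)]) auto
  ultimately show ?thesis using vs.subspace_add[OF bi.subspace_supported] by fastforce
qed

text \<open>For bihomogeneous \<open>u\<close> and \<open>x\<close> all terms of \<open>u \<circ>\<^sub>t x\<close> have the same charge, although they differ in weight and degree.\<close>

lemma proj_dO:
  assumes "y \<in> dO V M t" shows "bi.proj (charge -` Z) y \<in> dO V M t"
proof (rule dO_induct[OF assms subspace_dO])
  fix u x assume x: "x \<in> space"
  show "bi.proj (charge -` Z) (dprod V M t 2 u x) \<in> dO V M t"
  proof (rule biadditive_mem[OF _ _ dO_0 dO_add _ x])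
    fix n r :: rat and p q u x
    assume *: "n \<in> half_ints" "r \<in> half_ints" "u \<in> vhom n p" "x \<in> mod_wt M r" "x \<in> mod_deg M q"
    have "u \<in> vsupp {(n, p)}" "x \<in> bi.supported {(r, q)}"
      using * bi_homogeneous[of r q] V.adj.bi_homogeneous[of n p] by auto
    then have "dprod V M t 2 u x \<in> bi.supported (charge -` {charge (n, p) + charge (r, q)})"
      by (rule dprod_supported) (auto simp: charge_def)
    moreover have "dprod V M t 2 u x \<in> dO V M t" using * mod_wt_in by (intro dprod_2_in_dO)
    ultimately show "bi.proj (charge -` Z) (dprod V M t 2 u x) \<in> dO V M t"
      using subspace_dO by (simp add: bi.proj_on_supported vs.subspace_0)
  qed (simp_all add: dprod_add_left dprod_add_right dprod_in bi.proj_add)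
qed (simp_all add: bi.proj_add bi.proj_scale)

text \<open>For \<open>t = 0\<close> the generators \<open>u\<^bsub>-2\<^esub> x\<close> are homogeneous for both gradings.\<close>

lemma part_dO_0:
  assumes "y \<in> dO V M 0" shows "bi.part y k \<in> dO V M 0"
proof (rule dO_induct[OF assms subspace_dO])
  fix u x assume x: "x \<in> space"
  show "bi.part (dprod V M 0 2 u x) k \<in> dO V M 0"
  proof (rule biadditive_mem[OF _ _ dO_0 dO_add _ x])
    fix n r :: rat and p q u x
    assume *: "n \<in> half_ints" "r \<in> half_ints" "u \<in> vhom n p" "x \<in> mod_wt M r" "x \<in> mod_deg M q"
    have x: "x \<in> space" using * mod_wt_in by simp
    have "dprod V M 0 2 u x \<in> bi.supported (id -` {(n + r + 1, p + q + 2)})"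
      using act_bihomogeneous[OF *, of "-2"] x by (simp add: dprod_0 algebra_simps)
    moreover have "dprod V M 0 2 u x \<in> dO V M 0" using x by (intro dprod_2_in_dO)
    ultimately show "bi.part (dprod V M 0 2 u x) k \<in> dO V M 0"
      using subspace_dO bi.proj_on_supported[of _ id _ "{k}"] by (simp add: bi.proj_single vs.subspace_0)
  qed (simp_all add: dprod_add_left dprod_add_right dprod_in bi.part_add)
qed (simp_all add: bi.part_add bi.part_scale)

lemma act_diff:
  assumes "u \<in> va_deg V p" "x \<in> space"
  shows "mod_diff M (mod_Y M u m x) = mod_Y M (va_diff V u) m x + scal ((-1) powi p) (mod_Y M u m (mod_diff M x))"
  using Y_diff[OF assms, of m] by simp

lemma modes_diff:
  assumes u: "u \<in> va_deg V p" and x: "x \<in> space"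
  shows "mod_diff M (modes M c u N x) = modes M c (va_diff V u) N x + scal ((-1) powi p) (modes M c u N (mod_diff M x))"
proof -
  have dx: "mod_diff M x \<in> space" using x by (rule diff_in)
  obtain n where n: "\<forall>k\<ge>n. mod_Y M u (N + int k) x = 0" "\<forall>k\<ge>n. mod_Y M u (N + int k) (mod_diff M x) = 0"
    using common_bound[OF modes_truncation[OF x] modes_truncation[OF dx]] by metis
  have n': "mod_Y M (va_diff V u) (N + int k) x = 0" if "k \<ge> n" for k
    using act_diff[OF u x, of "N + int k"] n that by (simp add: diff_zero)
  have "mod_diff M (modes M c u N x) = (\<Sum>k<n. mod_diff M (scal (c k) (mod_Y M u (N + int k) x)))"
    using x n by (simp add: modes_eq_sum[of _ n] diff_sum dg.U_scale act_in)
  also have "\<dots> = (\<Sum>k<n. scal (c k) (mod_Y M (va_diff V u) (N + int k) x)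
      + scal ((-1) powi p) (scal (c k) (mod_Y M u (N + int k) (mod_diff M x))))"
    using x by (intro sum.cong) (simp_all add: diff_scale act_in act_diff[OF u x] vs.scale_right_distrib mult.commute)
  also have "\<dots> = modes M c (va_diff V u) N x + scal ((-1) powi p) (modes M c u N (mod_diff M x))"
    using x dx n n' by (simp add: modes_eq_sum[of _ n] sum.distrib vs.scale_sum_right)
  finally show ?thesis .
qed

lemma dprod_diff:
  assumes "n \<in> half_ints" "u \<in> vhom n p" "x \<in> space"
  shows "mod_diff M (dprod V M t j u x) =
    dprod V M t j (va_diff V u) x + scal ((-1) powi p) (dprod V M t j u (mod_diff M x))"
proof -
  have "va_diff V u \<in> voa_wt V n" using V.adj.weight_subcomplex_diff[of n] assms by auto
  then show ?thesis using assms modes_diff by (simp add: dprod_homogeneous diff_in)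
qed

lemma diff_dO:
  assumes "y \<in> dO V M t" shows "mod_diff M y \<in> dO V M t"
proof (rule dO_induct[OF assms subspace_dO])
  fix u x assume x: "x \<in> space"
  show "mod_diff M (dprod V M t 2 u x) \<in> dO V M t"
  proof (rule biadditive_mem[OF _ _ dO_0 dO_add _ x])
    fix n r :: rat and p q u x
    assume *: "n \<in> half_ints" "r \<in> half_ints" "u \<in> vhom n p" "x \<in> mod_wt M r" "x \<in> mod_deg M q"
    then have "x \<in> space" using mod_wt_in by simp
    then show "mod_diff M (dprod V M t 2 u x) \<in> dO V M t"
      unfolding dprod_diff[OF *(1,3) \<open>x \<in> space\<close>] by (intro dO_add dO_scale dprod_2_in_dO diff_in)
  qed (simp_all add: dprod_add_left dprod_add_right dprod_in diff_add)
qed (simp_all add: diff_add diff_scale)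

end

locale voa_module_hom = M: voa_module V M + N: voa_module V N
  for V :: "'v::ab_group_add dg_voa" and M :: "('v, 'm::ab_group_add) dg_mod"
    and N :: "('v, 'm) dg_mod" +
  fixes f :: "'m \<Rightarrow> 'm"
  assumes hom: "graded_dg_module_hom M N f"
begin

lemma hom_in: "x \<in> mod_space M \<Longrightarrow> f x \<in> mod_space N"
  and hom_add: "x \<in> mod_space M \<Longrightarrow> y \<in> mod_space M \<Longrightarrow> f (x + y) = f x + f y"
  and hom_scale: "x \<in> mod_space M \<Longrightarrow> f (mod_scale M c x) = mod_scale N c (f x)"
  and hom_act: "x \<in> mod_space M \<Longrightarrow> f (mod_Y M v n x) = mod_Y N v n (f x)"
  and hom_wt: "r \<in> half_ints \<Longrightarrow> x \<in> mod_wt M r \<Longrightarrow> f x \<in> mod_wt N r"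
  using hom by (auto simp: graded_dg_module_hom_def linear_between_def image_subset_iff)

lemma hom_zero: "f 0 = 0"
  using hom_add[of 0 0] M.dg.U_zero by simp

lemma hom_uminus: "x \<in> mod_space M \<Longrightarrow> f (- x) = - f x"
  using hom_add[of x "- x"] M.dg.U_uminus hom_zero by (simp add: eq_neg_iff_add_eq_0 add.commute)

lemma hom_sub: "x \<in> mod_space M \<Longrightarrow> y \<in> mod_space M \<Longrightarrow> f (x - y) = f x - f y"
  using hom_add[of x "- y"] hom_uminus M.dg.U_uminus by simp

lemma hom_sum: "(\<And>j. j \<in> J \<Longrightarrow> g j \<in> mod_space M) \<Longrightarrow> f (sum g J) = (\<Sum>j\<in>J. f (g j))"
  by (induction J rule: infinite_finite_induct) (auto simp: hom_zero hom_add M.dg.U_sum)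

lemma hom_modes:
  assumes x: "x \<in> mod_space M" shows "f (modes M c u K x) = modes N c u K (f x)"
proof -
  obtain n where n: "\<forall>k\<ge>n. mod_Y M u (K + int k) x = 0" using M.modes_truncation[OF x] by blast
  then have "mod_Y N u (K + int k) (f x) = 0" if "k \<ge> n" for k
    using hom_act[OF x, of u "K + int k"] that hom_zero by simp
  then show ?thesis using n x
    by (simp add: M.modes_eq_sum[of _ n] N.modes_eq_sum[of _ n] hom_in hom_sum M.dg.U_scale M.act_in
        hom_scale hom_act)
qed

lemma hom_dprod:
  assumes x: "x \<in> mod_space M" shows "f (dprod V M t j u x) = dprod V N t j u (f x)"
proof -
  have "dprod V M t j u x = (\<Sum>r | M.vpart u r \<noteq> 0. modes M (bin t (of_rat r)) (M.vpart u r) (- j) x)"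
    unfolding dprod_def using M.modes_zero_left[OF x] M.finite_vpart
    by (intro Sum_any.expand_superset) auto
  moreover have "dprod V N t j u (f x) = (\<Sum>r | M.vpart u r \<noteq> 0. modes N (bin t (of_rat r)) (M.vpart u r) (- j) (f x))"
    unfolding dprod_def using N.modes_zero_left[OF hom_in[OF x]] M.finite_vpart
    by (intro Sum_any.expand_superset) auto
  ultimately show ?thesis using x by (simp add: hom_sum M.modes_in hom_modes)
qed

lemma hom_dO:
  assumes "y \<in> dO V M t" shows "f y \<in> dO V N t"
proof (rule M.dg.linear_span_mem[where t = N.scal and f = f, OF _ _ _ hom_add hom_scale N.vector_space N.subspace_dO])
  show "y \<in> M.vs.span {dprod V M t 2 u x | u x. x \<in> mod_space M}" using assms by (simp add: dO_def)
  show "f g \<in> dO V N t" if "g \<in> {dprod V M t 2 u x | u x. x \<in> mod_space M}" for g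
    using that hom_in N.dprod_2_in_dO by (auto simp: hom_dprod)
qed (use M.dprod_in in auto)

lemma hom_wt_part:
  assumes x: "x \<in> mod_space M" shows "f (M.wt.part x n) = N.wt.part (f x) n"
proof -
  let ?J = "{n. M.wt.part x n \<noteq> 0}"
  have J: "n \<in> half_ints" if "n \<in> ?J" for n using that x M.wt.part_outside by blast
  have "f x = f (sum (M.wt.part x) ?J)" using x by (simp add: M.wt.sum_part)
  also have "\<dots> = (\<Sum>n\<in>?J. f (M.wt.part x n))" using x M.wt.part_in_U by (intro hom_sum)
  finally have "N.wt.part (f x) n = (if n \<in> ?J then f (M.wt.part x n) else 0)"
    using N.wt.part_sum[OF M.wt.finite_part[OF x], of "\<lambda>n. f (M.wt.part x n)"] x J M.wt.part_in hom_wt by simp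
  then show ?thesis using hom_zero by auto
qed

end

section \<open>Coset spaces presented by surjections\<close>

lemma cring_complex_ring: "cring complex_ring"
  by (rule cringI; (rule abelian_groupI comm_monoidI)?)
    (auto simp: complex_ring_def algebra_simps intro: exI[of _ "- _"])

lemma descend_eqI:
  assumes "C \<noteq> {}" "\<And>x. x \<in> C \<Longrightarrow> K +>\<^bsub>Y\<^esub> f x = D"
  shows "descend Y K f C = D"
  using assms by (auto simp: descend_def)

lemma descend2_eqI:
  assumes "B \<noteq> {}" "C \<noteq> {}" "\<And>a x. a \<in> B \<Longrightarrow> x \<in> C \<Longrightarrow> K +>\<^bsub>Y\<^esub> f a x = D"
  shows "descend2 Y K f B C = D"
  using assms by (auto simp: descend2_def)

text \<open>The spaces to be studied consist of cosets, of cosets of cosets, or of families of such. A map \<open>\<pi>\<close>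
  from a subspace of a fixed vector space onto the carrier, with known kernel \<open>P\<close>, reduces all
  computations to representatives modulo \<open>P\<close>.\<close>

locale presented_space = vector_space s
  for s :: "complex \<Rightarrow> 'm::ab_group_add \<Rightarrow> 'm" +
  fixes S P :: "'m set" and X :: "('b, 'x) filt_mod" and \<pi> :: "'m \<Rightarrow> 'x"
  assumes subspace_S: "subspace S" and subspace_P: "subspace P" and P_subset: "P \<subseteq> S"
    and carrier_eq: "carrier X = \<pi> ` S"
    and \<pi>_eq_iff: "x \<in> S \<Longrightarrow> y \<in> S \<Longrightarrow> \<pi> x = \<pi> y \<longleftrightarrow> x - y \<in> P"
    and zero_eq: "\<zero>\<^bsub>X\<^esub> = \<pi> 0"
    and add_eq: "x \<in> S \<Longrightarrow> y \<in> S \<Longrightarrow> \<pi> x \<oplus>\<^bsub>X\<^esub> \<pi> y = \<pi> (x + y)"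
    and smult_eq: "x \<in> S \<Longrightarrow> c \<odot>\<^bsub>X\<^esub> \<pi> x = \<pi> (s c x)"
begin

lemmas S_add = subspace_add[OF subspace_S]
  and S_diff = subspace_diff[OF subspace_S]
  and S_scale = subspace_scale[OF subspace_S]
  and S_neg = subspace_neg[OF subspace_S]
  and S_sum = subspace_sum[OF subspace_S]
  and S_0 = subspace_0[OF subspace_S]

lemma \<pi>_in: "x \<in> S \<Longrightarrow> \<pi> x \<in> carrier X"
  by (simp add: carrier_eq)

lemma \<pi>_zero_iff: "x \<in> S \<Longrightarrow> \<pi> x = \<zero>\<^bsub>X\<^esub> \<longleftrightarrow> x \<in> P"
  using \<pi>_eq_iff[of x 0] S_0 by (simp add: zero_eq)

lemma abelian_group_X: "abelian_group X"
proof (rule abelian_groupI)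
  fix x assume "x \<in> carrier X"
  then obtain a where a: "a \<in> S" "x = \<pi> a" by (auto simp: carrier_eq)
  then have "\<pi> (- a) \<in> carrier X \<and> \<pi> (- a) \<oplus>\<^bsub>X\<^esub> x = \<zero>\<^bsub>X\<^esub>"
    by (simp add: add_eq S_neg \<pi>_in zero_eq)
  then show "\<exists>y\<in>carrier X. y \<oplus>\<^bsub>X\<^esub> x = \<zero>\<^bsub>X\<^esub>" by blast
qed (auto simp: carrier_eq zero_eq add_eq S_add S_0 add_ac)

lemma module_X: "Module.module complex_ring X"
proof (rule moduleI[OF cring_complex_ring abelian_group_X])
qed (auto simp: carrier_eq add_eq smult_eq S_add S_scale complex_ring_def scale_left_distrib
    scale_right_distrib mult.commute)

sublocale Module.module complex_ring X by (rule module_X)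

lemma minus_eq: "x \<in> S \<Longrightarrow> \<ominus>\<^bsub>X\<^esub> \<pi> x = \<pi> (- x)"
  by (rule minus_equality) (simp_all add: add_eq S_neg \<pi>_in zero_eq)

lemma diff_eq: "x \<in> S \<Longrightarrow> y \<in> S \<Longrightarrow> \<pi> x \<ominus>\<^bsub>X\<^esub> \<pi> y = \<pi> (x - y)"
  by (simp add: a_minus_def minus_eq add_eq S_neg)

lemma finsum_eq:
  assumes "finite J" "\<And>j. j \<in> J \<Longrightarrow> g j \<in> S"
  shows "finsum X (\<lambda>j. \<pi> (g j)) J = \<pi> (sum g J)"
  using assms
proof (induction J)
  case empty show ?case by (simp add: zero_eq)
next
  case (insert j J)
  then have "finsum X (\<lambda>j. \<pi> (g j)) (insert j J) = \<pi> (g j) \<oplus>\<^bsub>X\<^esub> finsum X (\<lambda>j. \<pi> (g j)) J"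
    by (intro finsum_insert) (auto simp: \<pi>_in)
  then show ?case using insert by (simp add: add_eq S_sum)
qed

lemma is_subspace_image:
  assumes "subspace Q" "Q \<subseteq> S" shows "is_subspace X (\<pi> ` Q)"
proof -
  have "\<pi> x \<oplus>\<^bsub>X\<^esub> \<pi> y \<in> \<pi> ` Q" if "x \<in> Q" "y \<in> Q" for x y
    using that assms subspace_add by (auto simp: add_eq subset_iff)
  moreover have "c \<odot>\<^bsub>X\<^esub> \<pi> x \<in> \<pi> ` Q" if "x \<in> Q" for c x
    using that assms subspace_scale by (auto simp: smult_eq subset_iff)
  moreover have "\<ominus>\<^bsub>X\<^esub> \<pi> x \<in> \<pi> ` Q" if "x \<in> Q" for x
    using that assms subspace_neg by (auto simp: minus_eq subset_iff)
  moreover have "\<pi> 0 \<in> \<pi> ` Q" using assms subspace_0 by blast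
  ultimately show ?thesis unfolding is_subspace_def
    using assms(2) by (intro submoduleI) (auto simp: carrier_eq zero_eq)
qed

lemma coset_eq:
  assumes "subspace Q" "Q \<subseteq> S" "x \<in> S"
  shows "\<pi> ` Q +>\<^bsub>X\<^esub> \<pi> x = \<pi> ` {y \<in> S. y - x \<in> Q}"
proof -
  have "\<pi> ` Q +>\<^bsub>X\<^esub> \<pi> x = (\<lambda>q. \<pi> q \<oplus>\<^bsub>X\<^esub> \<pi> x) ` Q" by (auto simp: a_r_coset_def')
  also have "\<dots> = (\<lambda>q. \<pi> (q + x)) ` Q" using assms by (intro image_cong) (auto simp: add_eq subset_iff)
  also have "\<dots> = \<pi> ` (\<lambda>q. q + x) ` Q" by (simp add: image_image)
  also have "(\<lambda>q. q + x) ` Q = {y \<in> S. y - x \<in> Q}"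
  proof (intro equalityI subsetI)
    fix y assume "y \<in> {y \<in> S. y - x \<in> Q}"
    then show "y \<in> (\<lambda>q. q + x) ` Q" by (intro image_eqI[of _ _ "y - x"]) auto
  qed (use assms S_add in auto)
  finally show ?thesis .
qed

lemma coset_cong_iff:
  assumes "subspace Q" "P \<subseteq> Q" "Q \<subseteq> S" "x \<in> S" "y \<in> S"
  shows "\<pi> ` Q +>\<^bsub>X\<^esub> \<pi> x = \<pi> ` Q +>\<^bsub>X\<^esub> \<pi> y \<longleftrightarrow> x - y \<in> Q"
proof
  assume eq: "\<pi> ` Q +>\<^bsub>X\<^esub> \<pi> x = \<pi> ` Q +>\<^bsub>X\<^esub> \<pi> y"
  have "\<pi> x \<in> \<pi> ` {z \<in> S. z - x \<in> Q}"
    using assms(4) subspace_0[OF assms(1)] by (intro imageI) simp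
  then have "\<pi> x \<in> \<pi> ` {z \<in> S. z - y \<in> Q}"
    using eq assms by (simp only: coset_eq)
  then obtain z where z: "z \<in> S" "z - y \<in> Q" "\<pi> x = \<pi> z" by auto
  then have "x - z \<in> Q" using assms \<pi>_eq_iff by blast
  then have "(x - z) + (z - y) \<in> Q" using z(2) by (intro subspace_add[OF assms(1)])
  then show "x - y \<in> Q" by simp
next
  assume xy: "x - y \<in> Q"
  have "z - x \<in> Q \<longleftrightarrow> z - y \<in> Q" for z
    using subspace_add[OF assms(1), of "z - x" "x - y"] subspace_diff[OF assms(1), of "z - y" "x - y"] xy
    by auto
  then show "\<pi> ` Q +>\<^bsub>X\<^esub> \<pi> x = \<pi> ` Q +>\<^bsub>X\<^esub> \<pi> y" using assms by (simp add: coset_eq)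
qed

lemma descend_coset:
  assumes "subspace Q" "Q \<subseteq> S" "x \<in> S"
    and "\<And>y. y \<in> S \<Longrightarrow> y - x \<in> Q \<Longrightarrow> K +>\<^bsub>Y\<^esub> f (\<pi> y) = D"
  shows "descend Y K f (\<pi> ` Q +>\<^bsub>X\<^esub> \<pi> x) = D"
proof (rule descend_eqI)
  show "\<pi> ` Q +>\<^bsub>X\<^esub> \<pi> x \<noteq> {}" using assms subspace_0[OF assms(1)] by (auto simp: coset_eq)
qed (use assms in \<open>auto simp: coset_eq\<close>)

text \<open>A quotient of a presented space is presented by the same vector space with a larger kernel, so
  iterated quotients are covered as well.\<close>

lemma presented_quotient:
  assumes "subspace Q" "P \<subseteq> Q" "Q \<subseteq> S"
  shows "presented_space s S Q (quotient_by X (\<pi> ` Q) ac) (\<lambda>x. \<pi> ` Q +>\<^bsub>X\<^esub> \<pi> x)"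
proof unfold_locales
  show "carrier (quotient_by X (\<pi> ` Q) ac) = (\<lambda>x. \<pi> ` Q +>\<^bsub>X\<^esub> \<pi> x) ` S"
    by (auto simp: quotient_by_def A_RCOSETS_def' carrier_eq)
  show "(\<pi> ` Q +>\<^bsub>X\<^esub> \<pi> x = \<pi> ` Q +>\<^bsub>X\<^esub> \<pi> y) = (x - y \<in> Q)" if "x \<in> S" "y \<in> S" for x y
    using coset_cong_iff[OF assms that] .
  have "{y \<in> S. y \<in> Q} = Q" using assms by auto
  then show "\<zero>\<^bsub>quotient_by X (\<pi> ` Q) ac\<^esub> = \<pi> ` Q +>\<^bsub>X\<^esub> \<pi> 0"
    using assms by (simp add: quotient_by_def coset_eq S_0)
  show "(\<pi> ` Q +>\<^bsub>X\<^esub> \<pi> x) \<oplus>\<^bsub>quotient_by X (\<pi> ` Q) ac\<^esub> (\<pi> ` Q +>\<^bsub>X\<^esub> \<pi> y) = \<pi> ` Q +>\<^bsub>X\<^esub> \<pi> (x + y)"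
    if xy: "x \<in> S" "y \<in> S" for x y
  proof -
    have "\<pi> a \<oplus>\<^bsub>X\<^esub> \<pi> b \<in> \<pi> ` {z \<in> S. z - (x + y) \<in> Q}"
      if "a \<in> S" "a - x \<in> Q" "b \<in> S" "b - y \<in> Q" for a b
      using that subspace_add[OF assms(1), of "a - x" "b - y"] by (auto simp: add_eq S_add add_diff_add)
    moreover have "\<exists>a\<in>{z \<in> S. z - x \<in> Q}. \<exists>b\<in>{z \<in> S. z - y \<in> Q}. \<pi> c = \<pi> a \<oplus>\<^bsub>X\<^esub> \<pi> b"
      if "c \<in> S" "c - (x + y) \<in> Q" for c
    proof (intro bexI)
      show "\<pi> c = \<pi> (c - y) \<oplus>\<^bsub>X\<^esub> \<pi> y" using that xy by (simp add: add_eq S_diff)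
      show "c - y \<in> {z \<in> S. z - x \<in> Q}" using that xy by (simp add: S_diff algebra_simps)
      show "y \<in> {z \<in> S. z - y \<in> Q}" using xy subspace_0[OF assms(1)] by simp
    qed
    ultimately have "(\<pi> ` {z \<in> S. z - x \<in> Q}) <+>\<^bsub>X\<^esub> (\<pi> ` {z \<in> S. z - y \<in> Q}) = \<pi> ` {z \<in> S. z - (x + y) \<in> Q}"
      by (fastforce simp: set_add_def')
    then show ?thesis using xy assms by (simp add: quotient_by_def coset_eq S_add)
  qed
  show "c \<odot>\<^bsub>quotient_by X (\<pi> ` Q) ac\<^esub> (\<pi> ` Q +>\<^bsub>X\<^esub> \<pi> x) = \<pi> ` Q +>\<^bsub>X\<^esub> \<pi> (s c x)" if x: "x \<in> S" for c x
    unfolding quotient_by_def module.simps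
  proof (rule descend_coset[OF assms(1,3) x])
    fix y assume y: "y \<in> S" "y - x \<in> Q"
    then have "s c y - s c x \<in> Q" using subspace_scale[OF assms(1)] by (simp flip: scale_right_diff_distrib)
    then show "\<pi> ` Q +>\<^bsub>X\<^esub> c \<odot>\<^bsub>X\<^esub> \<pi> y = \<pi> ` Q +>\<^bsub>X\<^esub> \<pi> (s c x)"
      using x y assms coset_cong_iff by (simp add: smult_eq S_scale)
  qed
qed (use assms subspace_S in auto)

lemma quotient_dif:
  assumes "subspace Q" "P \<subseteq> Q" "Q \<subseteq> S" "x \<in> S"
    and d: "\<And>x. x \<in> S \<Longrightarrow> dif X (\<pi> x) = \<pi> (d x)" "\<And>x. x \<in> S \<Longrightarrow> d x \<in> S"
      "\<And>x y. x \<in> S \<Longrightarrow> y \<in> S \<Longrightarrow> d (x - y) = d x - d y" "\<And>x. x \<in> Q \<Longrightarrow> d x \<in> Q"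
  shows "dif (quotient_by X (\<pi> ` Q) ac) (\<pi> ` Q +>\<^bsub>X\<^esub> \<pi> x) = \<pi> ` Q +>\<^bsub>X\<^esub> \<pi> (d x)"
proof -
  have "descend X (\<pi> ` Q) (dif X) (\<pi> ` Q +>\<^bsub>X\<^esub> \<pi> x) = \<pi> ` Q +>\<^bsub>X\<^esub> \<pi> (d x)"
  proof (rule descend_coset[OF assms(1,3,4)])
    fix y assume y: "y \<in> S" "y - x \<in> Q"
    then have "d y - d x \<in> Q" using d(3)[of y x] d(4)[of "y - x"] assms(4) by simp
    then show "\<pi> ` Q +>\<^bsub>X\<^esub> dif X (\<pi> y) = \<pi> ` Q +>\<^bsub>X\<^esub> \<pi> (d x)"
      using d(1,2) y assms(4) coset_cong_iff[OF assms(1-3)] by simp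
  qed
  then show ?thesis by (simp add: quotient_by_def)
qed

end

section \<open>The associated graded of the Zhu quotient\<close>

context voa_module
begin

abbreviation vclass :: "'v \<Rightarrow> 'v set" where "vclass \<equiv> A_class V (adjoint_module V)"

lemma presented_underlying: "presented_space scal space {0} (underlying M W) id"
  by unfold_locales (auto simp: underlying_def dg.subspace_U dg.U_zero vs.subspace_0)

lemma underlying_coset:
  assumes "vs.subspace Q" "Q \<subseteq> space" "x \<in> space"
  shows "Q +>\<^bsub>underlying M W\<^esub> x = {y \<in> space. y - x \<in> Q}"
  using presented_space.coset_eq[OF presented_underlying assms] by simp

lemma presented_A: "presented_space scal space (dO V M 1) (A_mod V M) (A_class V M)"
proof -
  have "presented_space scal space (dO V M 1) (A_mod V M) (\<lambda>x. A_class V M x)"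
    unfolding A_mod_def A_class_def zhu_O_eq
    using presented_space.presented_quotient[OF presented_underlying subspace_dO _ dO_subset] subspace_dO
    by (simp add: vs.subspace_0)
  then show ?thesis .
qed

lemma presented_R: "presented_space scal space (dO V M 0) (R_mod V M) (R_class M)"
proof -
  have "presented_space scal space (dO V M 0) (R_mod V M) (\<lambda>x. R_class M x)"
    unfolding R_mod_def R_class_def C2_eq
    using presented_space.presented_quotient[OF presented_underlying subspace_dO _ dO_subset] subspace_dO
    by (simp add: vs.subspace_0)
  then show ?thesis .
qed

lemma A_class_coset: "x \<in> space \<Longrightarrow> A_class V M x = {y \<in> space. y - x \<in> dO V M 1}"
  unfolding A_class_def zhu_O_eq by (rule underlying_coset[OF subspace_dO dO_subset])

lemma R_class_coset: "x \<in> space \<Longrightarrow> R_class M x = {y \<in> space. y - x \<in> dO V M 0}"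
  unfolding R_class_def C2_eq by (rule underlying_coset[OF subspace_dO dO_subset])

lemma A_class_self: "x \<in> space \<Longrightarrow> x \<in> A_class V M x"
  and R_class_self: "x \<in> space \<Longrightarrow> x \<in> R_class M x"
  by (simp_all add: A_class_coset R_class_coset vs.subspace_0 subspace_dO)

lemma dif_A: "x \<in> space \<Longrightarrow> dif (A_mod V M) (A_class V M x) = A_class V M (mod_diff M x)"
  using presented_space.quotient_dif[OF presented_underlying subspace_dO _ dO_subset, where x = x and d = "mod_diff M"] diff_dO subspace_dO
  by (simp add: A_mod_def A_class_def zhu_O_eq vs.subspace_0 underlying_def diff_in diff_sub)

lemma dif_R: "x \<in> space \<Longrightarrow> dif (R_mod V M) (R_class M x) = R_class M (mod_diff M x)"
  using presented_space.quotient_dif[OF presented_underlying subspace_dO _ dO_subset, where x = x and d = "mod_diff M"] diff_dO subspace_dO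
  by (simp add: R_mod_def R_class_def C2_eq vs.subspace_0 underlying_def diff_in diff_sub)

lemma fil_A: "fil (A_mod V M) p = A_class V M ` mod_deg_le M p"
  and wgt_A: "wgt (A_mod V M) n = A_class V M ` mod_wt_le M n"
  and fil_R: "fil (R_mod V M) p = R_class M ` mod_deg_le M p"
  and wgt_R: "wgt (R_mod V M) n = R_class M ` mod_wt M n"
  by (simp_all add: A_mod_def A_class_def R_mod_def R_class_def quotient_by_def underlying_def)

lemma dprod_cong:
  assumes "v - u \<in> dO V (adjoint_module V) t" "y - x \<in> dO V M t" "x \<in> space" "y \<in> space"
  shows "dprod V M t 1 v y - dprod V M t 1 u x \<in> dO V M t"
proof -
  have "dprod V M t 1 v y = dprod V M t 1 (v - u) y + dprod V M t 1 u y"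
    using dprod_add_left[of y t 1 "v - u" u] assms by simp
  moreover have "dprod V M t 1 u y = dprod V M t 1 u (y - x) + dprod V M t 1 u x"
    using dprod_add_right[of "y - x" x t 1 u] assms dg.U_diff by simp
  ultimately show ?thesis using dO_add[OF dO_dprod[OF assms(1,4)] dprod_dO[OF assms(2), of u]] by simp
qed

end

context voa_module
begin

lemma act_A:
  assumes x: "x \<in> space" shows "act (A_mod V M) (vclass u) (A_class V M x) = A_class V M (dprod V M 1 1 u x)"
  unfolding A_mod_def quotient_by_def filt_mod.simps
proof (rule descend2_eqI)
  show "vclass u \<noteq> {}" "A_class V M x \<noteq> {}"
    using A_class_self[OF x] V.self.A_class_self[of u] by auto
  fix v y assume "v \<in> vclass u" "y \<in> A_class V M x"
  then have vy: "v - u \<in> dO V (adjoint_module V) 1" "y - x \<in> dO V M 1" "y \<in> space"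
    using x by (auto simp: A_class_coset V.self.A_class_coset)
  have "A_class V M (dprod V M 1 1 v y) = A_class V M (dprod V M 1 1 u x)"
    using presented_space.\<pi>_eq_iff[OF presented_A] dprod_cong[OF vy(1,2) x vy(3)] dprod_in x vy(3) by blast
  then show "zhu_O V M +>\<^bsub>underlying M (mod_wt_le M)\<^esub> zhu_prod V M 1 v y = A_class V M (dprod V M 1 1 u x)"
    by (simp add: A_class_def zhu_prod_eq)
qed

lemma act_R:
  assumes x: "x \<in> space"
  shows "act (R_mod V M) (R_class (adjoint_module V) u) (R_class M x) = R_class M (mod_Y M u (-1) x)"
  unfolding R_mod_def quotient_by_def filt_mod.simps
proof (rule descend2_eqI)
  show "R_class (adjoint_module V) u \<noteq> {}" "R_class M x \<noteq> {}"
    using R_class_self[OF x] V.self.R_class_self[of u] by auto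
  fix v y assume "v \<in> R_class (adjoint_module V) u" "y \<in> R_class M x"
  then have vy: "v - u \<in> dO V (adjoint_module V) 0" "y - x \<in> dO V M 0" "y \<in> space"
    using x by (auto simp: R_class_coset V.self.R_class_coset)
  have "mod_Y M v (-1) y - mod_Y M u (-1) x \<in> dO V M 0"
    using dprod_cong[OF vy(1,2) x vy(3)] x vy(3) by (simp add: dprod_0)
  then have "R_class M (mod_Y M v (-1) y) = R_class M (mod_Y M u (-1) x)"
    using presented_space.\<pi>_eq_iff[OF presented_R] act_in x vy(3) by blast
  then show "C2 M +>\<^bsub>underlying M (mod_wt M)\<^esub> mod_Y M v (-1) y = R_class M (mod_Y M u (-1) x)"
    by (simp add: R_class_def)
qed

abbreviation wt_le :: "rat \<Rightarrow> 'm set" where "wt_le n \<equiv> bi.supported (fst -` {..n})"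

text \<open>The kernel of the map from the vectors of weight at most \<open>n\<close> to the weight \<open>n\<close> part of the associated
  graded space of \<open>A(M)\<close>; that map is \<open>piece n\<close>.\<close>

definition lead_ker :: "rat \<Rightarrow> 'm set" where
  "lead_ker n = {x \<in> wt_le n. \<exists>y\<in>dO V M 1. x - y \<in> wt_lt n}"

definition piece :: "rat \<Rightarrow> 'm \<Rightarrow> 'm set set" where
  "piece n x = wgt_below (A_mod V M) n +>\<^bsub>A_mod V M\<^esub> A_class V M x"

lemma wt_lt_subset: "wt_lt n \<subseteq> wt_le n"
  by (rule bi.supported_mono) auto

lemma wt_le_in: "x \<in> wt_le n \<Longrightarrow> x \<in> space"
  by (rule bi.supportedD)

lemma lead_kerI: "x \<in> wt_le n \<Longrightarrow> y \<in> dO V M 1 \<Longrightarrow> x - y \<in> wt_lt n \<Longrightarrow> x \<in> lead_ker n"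
  by (auto simp: lead_ker_def)

lemma wt_lt_lead_ker: "x \<in> wt_lt n \<Longrightarrow> x \<in> lead_ker n"
  using wt_lt_subset by (intro lead_kerI[of _ _ 0]) (auto simp: vs.subspace_0 subspace_dO)

lemma subspace_lead_ker: "vs.subspace (lead_ker n)"
proof (rule vs.subspaceI)
  show "0 \<in> lead_ker n" by (intro wt_lt_lead_ker vs.subspace_0 bi.subspace_supported)
next
  fix x x' assume "x \<in> lead_ker n" "x' \<in> lead_ker n"
  then obtain y y' where *: "x \<in> wt_le n" "y \<in> dO V M 1" "x - y \<in> wt_lt n"
    "x' \<in> wt_le n" "y' \<in> dO V M 1" "x' - y' \<in> wt_lt n" by (auto simp: lead_ker_def)
  show "x + x' \<in> lead_ker n"
  proof (rule lead_kerI[of _ _ "y + y'"])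
    have "(x - y) + (x' - y') \<in> wt_lt n" using * by (intro vs.subspace_add bi.subspace_supported)
    then show "x + x' - (y + y') \<in> wt_lt n" by (simp add: algebra_simps)
  qed (use * in \<open>auto intro: dO_add vs.subspace_add bi.subspace_supported\<close>)
next
  fix c x assume "x \<in> lead_ker n"
  then obtain y where *: "x \<in> wt_le n" "y \<in> dO V M 1" "x - y \<in> wt_lt n" by (auto simp: lead_ker_def)
  show "scal c x \<in> lead_ker n"
  proof (rule lead_kerI[of _ _ "scal c y"])
    have "scal c (x - y) \<in> wt_lt n" using * by (intro vs.subspace_scale bi.subspace_supported)
    then show "scal c x - scal c y \<in> wt_lt n" by (simp add: vs.scale_right_diff_distrib)
  qed (use * in \<open>auto intro: dO_scale vs.subspace_scale bi.subspace_supported\<close>)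
qed

lemma lead_ker_subset: "lead_ker n \<subseteq> wt_le n"
  by (auto simp: lead_ker_def)

text \<open>Weights are half-integers, so \<open>W\<^bsub><n\<^esub>\<close> is itself a step of the weight filtration.\<close>

lemma wt_lt_eq: "n \<in> half_ints \<Longrightarrow> wt_lt n = wt_le (n - 1 / 2)"
proof -
  assume n: "n \<in> half_ints"
  have "k < n \<longleftrightarrow> k \<le> n - 1 / 2" if k: "k \<in> half_ints" for k
  proof -
    obtain a b :: int where ab: "n = of_int a / 2" "k = of_int b / 2" using n k by (auto simp: half_ints_def)
    have "n - 1 / 2 = of_int (a - 1) / 2" by (simp add: ab diff_divide_distrib)
    then have "k \<le> n - 1 / 2 \<longleftrightarrow> b \<le> a - 1"
      by (simp add: ab(2) divide_le_cancel del: of_int_diff)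
    moreover have "k < n \<longleftrightarrow> b < a" by (simp add: ab divide_less_cancel)
    ultimately show ?thesis by linarith
  qed
  then have "fst -` {..<n} \<inter> half_ints \<times> (UNIV :: int set) = fst -` {..n - 1 / 2} \<inter> half_ints \<times> UNIV"
    by auto
  then show ?thesis by (metis supported_half_ints)
qed

lemma half_half_ints: "1 / 2 \<in> half_ints"
  unfolding half_ints_def by (rule range_eqI[of _ _ 1]) simp

lemma wgt_below_A:
  assumes "n \<in> half_ints" shows "wgt_below (A_mod V M) n = A_class V M ` lead_ker n"
proof -
  interpret A: presented_space scal space "dO V M 1" "A_mod V M" "A_class V M" by (rule presented_A)
  have "wgt_below (A_mod V M) n = A_class V M ` wt_lt n"
  proof (intro equalityI subsetI)
    fix a assume "a \<in> wgt_below (A_mod V M) n"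
    then obtain m where "m < n" "a \<in> A_class V M ` wt_le m"
      by (auto simp: wgt_below_def wgt_A mod_wt_le_eq)
    moreover have "wt_le m \<subseteq> wt_lt n" using \<open>m < n\<close> by (intro bi.supported_mono) auto
    ultimately show "a \<in> A_class V M ` wt_lt n" by blast
  next
    fix a assume "a \<in> A_class V M ` wt_lt n"
    then have "a \<in> wgt (A_mod V M) (n - 1 / 2)" using wt_lt_eq[OF assms] by (simp add: wgt_A mod_wt_le_eq)
    moreover have "n - 1 / 2 \<in> half_ints" using assms half_half_ints by (rule half_ints_diff)
    ultimately show "a \<in> wgt_below (A_mod V M) n" by (auto simp: wgt_below_def intro!: bexI[of _ "n - 1 / 2"])
  qed
  also have "\<dots> = A_class V M ` lead_ker n"
  proof (intro equalityI subsetI)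
    fix a assume "a \<in> A_class V M ` lead_ker n"
    then obtain x y where *: "a = A_class V M x" "x \<in> wt_le n" "y \<in> dO V M 1" "x - y \<in> wt_lt n"
      by (auto simp: lead_ker_def)
    moreover have "A_class V M x = A_class V M (x - y)"
      using * subsetD[OF dO_subset *(3)]
      by (intro A.\<pi>_eq_iff[THEN iffD2]) (auto simp: wt_le_in intro: dg.U_diff)
    ultimately show "a \<in> A_class V M ` wt_lt n" by auto
  qed (use wt_lt_lead_ker in auto)
  finally show ?thesis .
qed

lemma diff_supported:
  assumes "x \<in> bi.supported B" "\<And>n p. (n, p) \<in> B \<Longrightarrow> (n, p + 1) \<in> D"
  shows "mod_diff M x \<in> bi.supported D"
  using assms(1)
proof (induction rule: bi.supported_induct)
  case zero then show ?case by (simp add: diff_zero vs.subspace_0 bi.subspace_supported)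
next
  case (add x y) then show ?case by (simp add: diff_add vs.subspace_add bi.subspace_supported)
next
  case (homogeneous i x)
  obtain n p where i: "i = (n, p)" by fastforce
  then have "mod_diff M x \<in> mod_wt M n \<inter> mod_deg M (p + 1)"
    using homogeneous weight_subcomplex_diff[of n] diff_degree[of p] by auto
  then have "mod_diff M x \<in> bi.supported {(n, p + 1)}" using i homogeneous bi_homogeneous[of n "p + 1"] by auto
  then show ?case using bi.supported_mono[of "{(n, p + 1)}" D] assms(2) i homogeneous by auto
qed

lemma diff_lead_ker:
  assumes "x \<in> lead_ker n" shows "mod_diff M x \<in> lead_ker n"
proof -
  obtain y where *: "x \<in> wt_le n" "y \<in> dO V M 1" "x - y \<in> wt_lt n" using assms by (auto simp: lead_ker_def)
  show ?thesis
  proof (rule lead_kerI[of _ _ "mod_diff M y"])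
    show "mod_diff M x \<in> wt_le n" by (rule diff_supported[OF *(1)]) auto
    have "mod_diff M (x - y) \<in> wt_lt n" by (rule diff_supported[OF *(3)]) auto
    then show "mod_diff M x - mod_diff M y \<in> wt_lt n"
      using * dO_subset by (subst (asm) diff_sub) (auto simp: wt_le_in)
  qed (use * diff_dO in auto)
qed

text \<open>The carrier of \<open>gr_piece\<close> is a quotient of \<open>W\<^sub>n\<close> and not of all of \<open>A(M)\<close>, so the presenting space
  shrinks to the vectors of weight at most \<open>n\<close>.\<close>

lemma
  assumes n: "n \<in> half_ints"
  shows presented_piece: "presented_space scal (wt_le n) (lead_ker n) (gr_piece (A_mod V M) n) (piece n)"
    and dif_piece: "x \<in> wt_le n \<Longrightarrow> dif (gr_piece (A_mod V M) n) (piece n x) = piece n (mod_diff M x)"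
    and fil_piece: "fil (gr_piece (A_mod V M) n) p =
      piece n ` {x \<in> wt_le n. \<exists>b\<in>mod_deg_le M p. x - b \<in> dO V M 1}"
    and piece_coset: "x \<in> wt_le n \<Longrightarrow> piece n x = A_class V M ` {y \<in> wt_le n. y - x \<in> lead_ker n}"
proof -
  interpret A: presented_space scal space "dO V M 1" "A_mod V M" "A_class V M" by (rule presented_A)
  let ?X = "A_mod V M\<lparr>carrier := wgt (A_mod V M) n, fil := (\<lambda>p. fil (A_mod V M) p \<inter> wgt (A_mod V M) n)\<rparr>"
  let ?H = "A_class V M ` lead_ker n"
  interpret X: presented_space scal "wt_le n" "dO V M 1 \<inter> wt_le n" ?X "A_class V M"
    by unfold_locales
      (auto simp: wgt_A mod_wt_le_eq bi.subspace_supported subspace_dO wt_le_in A.\<pi>_eq_iff A.zero_eq A.add_eq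
        A.smult_eq vs.subspace_inter intro: vs.subspace_diff)
  have sub: "dO V M 1 \<inter> wt_le n \<subseteq> lead_ker n"
    by (auto intro!: lead_kerI vs.subspace_0 bi.subspace_supported)
  have coset: "(\<lambda>x. ?H +>\<^bsub>?X\<^esub> A_class V M x) = piece n"
    unfolding piece_def wgt_below_A[OF n] by (simp add: a_r_coset_def r_coset_def)
  have grp: "gr_piece (A_mod V M) n = quotient_by ?X ?H undefined"
    by (simp add: gr_piece_def wgt_below_A[OF n])
  show "presented_space scal (wt_le n) (lead_ker n) (gr_piece (A_mod V M) n) (piece n)"
    unfolding grp using X.presented_quotient[OF subspace_lead_ker sub lead_ker_subset] by (simp only: coset)
  show "x \<in> wt_le n \<Longrightarrow> piece n x = A_class V M ` {y \<in> wt_le n. y - x \<in> lead_ker n}"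
    using X.coset_eq[OF subspace_lead_ker lead_ker_subset] fun_cong[OF coset, of x] by simp
  have d: "x \<in> wt_le n \<Longrightarrow> mod_diff M x \<in> wt_le n" for x by (erule diff_supported) auto
  show "x \<in> wt_le n \<Longrightarrow> dif (gr_piece (A_mod V M) n) (piece n x) = piece n (mod_diff M x)"
    using X.quotient_dif[OF subspace_lead_ker sub lead_ker_subset, of x "mod_diff M" undefined]
      diff_lead_ker d fun_cong[OF coset]
    by (simp add: grp dif_A wt_le_in diff_sub)
  have "fil ?X p = A_class V M ` {x \<in> wt_le n. \<exists>b\<in>mod_deg_le M p. x - b \<in> dO V M 1}"
  proof (intro equalityI subsetI)
    fix c assume "c \<in> fil ?X p"
    then obtain x b where *: "c = A_class V M x" "x \<in> wt_le n" "A_class V M x = A_class V M b" "b \<in> mod_deg_le M p"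
      by (auto simp: fil_A wgt_A mod_wt_le_eq)
    moreover have "b \<in> space" using *(4) by (auto simp: mod_deg_le_eq bi.supportedD)
    ultimately have "x - b \<in> dO V M 1" using A.\<pi>_eq_iff wt_le_in by blast
    then show "c \<in> A_class V M ` {x \<in> wt_le n. \<exists>b\<in>mod_deg_le M p. x - b \<in> dO V M 1}" using * by blast
  next
    fix c assume "c \<in> A_class V M ` {x \<in> wt_le n. \<exists>b\<in>mod_deg_le M p. x - b \<in> dO V M 1}"
    then obtain x b where *: "c = A_class V M x" "x \<in> wt_le n" "x - b \<in> dO V M 1" "b \<in> mod_deg_le M p" by blast
    moreover have "b \<in> space" using *(4) by (auto simp: mod_deg_le_eq bi.supportedD)
    ultimately have "c = A_class V M b" using A.\<pi>_eq_iff wt_le_in by blast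
    then show "c \<in> fil ?X p" using * by (auto simp: fil_A wgt_A mod_wt_le_eq)
  qed
  moreover have "fil (quotient_by ?X ?H undefined) p = (\<lambda>x. ?H +>\<^bsub>?X\<^esub> x) ` fil ?X p"
    by (simp add: quotient_by_def)
  ultimately show "fil (gr_piece (A_mod V M) n) p =
      piece n ` {x \<in> wt_le n. \<exists>b\<in>mod_deg_le M p. x - b \<in> dO V M 1}"
    unfolding grp by (simp only: image_image coset[symmetric])
qed

definition gr_class :: "'m \<Rightarrow> rat \<Rightarrow> 'm set set" where
  "gr_class x = (\<lambda>n\<in>half_ints. piece n (wt.part x n))"

definition gr_ker :: "'m set" where
  "gr_ker = {x \<in> space. \<forall>n\<in>half_ints. wt.part x n \<in> lead_ker n}"

lemma piece_eq_iff:
  "n \<in> half_ints \<Longrightarrow> x \<in> wt_le n \<Longrightarrow> y \<in> wt_le n \<Longrightarrow> piece n x = piece n y \<longleftrightarrow> x - y \<in> lead_ker n"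
  by (rule presented_space.\<pi>_eq_iff[OF presented_piece])

lemma mod_wt_le: "n \<in> half_ints \<Longrightarrow> x \<in> mod_wt M n \<Longrightarrow> x \<in> wt_le n"
  using bi.supported_mono[of "fst -` {n}" "fst -` {..n}"] by (auto simp: mod_wt_eq[of n, symmetric])

lemma wt_part_le: "x \<in> space \<Longrightarrow> n \<in> half_ints \<Longrightarrow> wt.part x n \<in> wt_le n"
  using mod_wt_le wt.part_in by blast

lemma subspace_gr_ker: "vs.subspace gr_ker"
  using subspace_lead_ker unfolding gr_ker_def
  by (intro vs.subspaceI) (auto simp: dg.U_zero dg.U_add dg.U_scale wt.part_add wt.part_scale
      vs.subspace_0 vs.subspace_add vs.subspace_scale)

lemma gr_class_eq_iff:
  assumes "x \<in> space" "y \<in> space" shows "gr_class x = gr_class y \<longleftrightarrow> x - y \<in> gr_ker"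
proof -
  have "gr_class x = gr_class y \<longleftrightarrow> (\<forall>n\<in>half_ints. piece n (wt.part x n) = piece n (wt.part y n))"
    by (auto simp: gr_class_def restrict_def fun_eq_iff)
  also have "\<dots> \<longleftrightarrow> (\<forall>n\<in>half_ints. wt.part x n - wt.part y n \<in> lead_ker n)"
    using piece_eq_iff wt_part_le assms by blast
  also have "\<dots> \<longleftrightarrow> x - y \<in> gr_ker" using assms by (simp add: gr_ker_def dg.U_diff wt.part_diff)
  finally show ?thesis .
qed

text \<open>The other components of \<open>x\<close> have smaller weight.\<close>

lemma piece_wt_part:
  assumes "n \<in> half_ints" "x \<in> wt_le n" shows "piece n (wt.part x n) = piece n x"
proof -
  have x: "x \<in> space" using assms by (simp add: wt_le_in)
  have "x - wt.part x n \<in> wt_lt n"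
    using assms x by (auto simp: bi.supported_def wt_part_eq bi.part_diff bi.proj_in_U dg.U_diff bi.part_proj split: if_splits)
  then have "x - wt.part x n \<in> lead_ker n" by (rule wt_lt_lead_ker)
  then show ?thesis using assms x by (metis piece_eq_iff wt_part_le)
qed

lemma gr_class_sum:
  assumes f: "f \<in> extensional half_ints" and J: "finite J" "J \<subseteq> half_ints"
    and z: "\<And>n. n \<in> J \<Longrightarrow> z n \<in> mod_wt M n \<and> f n = piece n (z n)"
    and f0: "\<And>n. n \<in> half_ints \<Longrightarrow> n \<notin> J \<Longrightarrow> f n = \<zero>\<^bsub>gr_piece (A_mod V M) n\<^esub>"
  shows "f = gr_class (sum z J)"
proof
  fix n
  show "f n = gr_class (sum z J) n"
  proof (cases "n \<in> half_ints")
    case True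
    have "wt.part (sum z J) n = (if n \<in> J then z n else 0)" using J z by (intro wt.part_sum) auto
    moreover have "piece n 0 = \<zero>\<^bsub>gr_piece (A_mod V M) n\<^esub>"
      using presented_space.zero_eq[OF presented_piece[OF True]] by simp
    ultimately show ?thesis using z f0 True by (auto simp: gr_class_def)
  qed (use f in \<open>auto simp: gr_class_def extensional_def\<close>)
qed

abbreviation gr_space :: "(rat \<Rightarrow> 'm set set) set" where
  "gr_space \<equiv> {f \<in> (\<Pi>\<^sub>E n\<in>half_ints. carrier (gr_piece (A_mod V M) n)).
     finite {n\<in>half_ints. f n \<noteq> \<zero>\<^bsub>gr_piece (A_mod V M) n\<^esub>}}"

lemma gr_class_in:
  assumes x: "x \<in> space" shows "gr_class x \<in> gr_space"
proof -
  have "{n \<in> half_ints. gr_class x n \<noteq> \<zero>\<^bsub>gr_piece (A_mod V M) n\<^esub>} \<subseteq> {n. wt.part x n \<noteq> 0}"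
    using presented_space.zero_eq[OF presented_piece] by (auto simp: gr_class_def)
  moreover have "finite {n. wt.part x n \<noteq> 0}" using x by (rule wt.finite_part)
  moreover have "gr_class x \<in> (\<Pi>\<^sub>E n\<in>half_ints. carrier (gr_piece (A_mod V M) n))"
    using presented_space.\<pi>_in[OF presented_piece] wt_part_le[OF x] by (auto simp: gr_class_def)
  ultimately show ?thesis using finite_subset by blast
qed

text \<open>Used for the whole space and for the steps of the filtration by degree.\<close>

lemma gr_class_lift:
  assumes f: "f \<in> gr_space" and T: "vs.subspace T"
    and lift: "\<And>n. n \<in> half_ints \<Longrightarrow> f n \<noteq> \<zero>\<^bsub>gr_piece (A_mod V M) n\<^esub> \<Longrightarrow> \<exists>z\<in>mod_wt M n \<inter> T. f n = piece n z"
  shows "f \<in> gr_class ` T"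
proof -
  let ?J = "{n\<in>half_ints. f n \<noteq> \<zero>\<^bsub>gr_piece (A_mod V M) n\<^esub>}"
  have "\<forall>n\<in>?J. \<exists>z. z \<in> mod_wt M n \<inter> T \<and> f n = piece n z" using lift by auto
  from bchoice[OF this] obtain z where z: "\<forall>n\<in>?J. z n \<in> mod_wt M n \<inter> T \<and> f n = piece n (z n)" ..
  have "f = gr_class (sum z ?J)"
  proof (rule gr_class_sum)
    show "f \<in> extensional half_ints" using f unfolding PiE_def by blast
    show "finite ?J" using f by blast
    show "z n \<in> mod_wt M n \<and> f n = piece n (z n)" if "n \<in> ?J" for n using z that by blast
  qed auto
  moreover have "sum z ?J \<in> T" using z by (intro vs.subspace_sum[OF T]) auto
  ultimately show ?thesis by blast
qed

lemma gr_class_surj: "gr_class ` space = gr_space"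
proof (intro equalityI subsetI)
  fix f assume f: "f \<in> gr_space"
  show "f \<in> gr_class ` space"
  proof (rule gr_class_lift[OF f dg.subspace_U])
    fix n assume n: "n \<in> half_ints"
    then have "f n \<in> carrier (gr_piece (A_mod V M) n)" using f by auto
    then obtain y where y: "y \<in> wt_le n" "f n = piece n y"
      using presented_space.carrier_eq[OF presented_piece[OF n]] by auto
    then show "\<exists>z\<in>mod_wt M n \<inter> space. f n = piece n z"
      using n piece_wt_part[OF n y(1)] wt.part_in wt.part_in_U wt_le_in
      by (intro bexI[of _ "wt.part y n"]) auto
  qed
qed (use gr_class_in in auto)

text \<open>The truncation by \<open>deg - 2 wt\<close> replaces a representative of weight at most \<open>n\<close>, known to be
  congruent to one of degree at most \<open>p\<close>, by one of weight \<open>n\<close> and degree at most \<open>p\<close>. The components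
  that are cut off have degree above \<open>p\<close> in weight \<open>n\<close>, so they are congruent to components of smaller weight.\<close>

lemma piece_fil_lift:
  assumes n: "n \<in> half_ints" and y: "y \<in> wt_le n" and b: "b \<in> mod_deg_le M p" and yb: "y - b \<in> dO V M 1"
  shows "\<exists>z\<in>mod_wt M n \<inter> mod_deg_le M p. piece n y = piece n z"
proof -
  define T where "T = charge -` {c. c + 2 * n > of_int p}"
  have ys: "y \<in> space" and bs: "b \<in> space" using y b by (auto simp: wt_le_in mod_deg_le_eq bi.supportedD)
  let ?w = "y - bi.proj T y"
  let ?z = "wt.part ?w n"
  have Ty: "bi.proj T y \<in> wt_le n" using y ys
    by (auto simp: bi.supported_def bi.proj_in_U bi.part_proj split: if_splits)
  have z0: "?w \<in> wt_le n" using y Ty by (intro vs.subspace_diff bi.subspace_supported)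
  have "bi.proj T y \<in> lead_ker n"
  proof (rule lead_kerI[OF Ty])
    show "bi.proj T (y - b) \<in> dO V M 1" unfolding T_def by (rule proj_dO[OF yb])
    have "k \<in> T \<Longrightarrow> snd k \<le> p \<Longrightarrow> fst k < n" for k
      proof -
      assume "k \<in> T" "snd k \<le> p"
      then have "of_int p < of_int (snd k) - 2 * fst k + 2 * n" "(of_int (snd k) :: rat) \<le> of_int p"
        by (auto simp: T_def charge_def)
      then show "fst k < n" by linarith
    qed
    then have "bi.proj T b \<in> wt_lt n" using b bs
      by (auto simp: mod_deg_le_eq bi.supported_def bi.proj_in_U bi.part_proj split: if_splits)
    then show "bi.proj T y - bi.proj T (y - b) \<in> wt_lt n" using ys bs by (simp add: bi.proj_diff)
  qed
  then have "piece n y = piece n ?w" using n y z0 by (simp add: piece_eq_iff)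
  also have "\<dots> = piece n ?z" using piece_wt_part[OF n z0] by simp
  finally have "piece n y = piece n ?z" .
  moreover have "?z \<in> mod_wt M n" using n z0 by (intro wt.part_in wt_le_in)
  moreover have "?z \<in> mod_deg_le M p"
  proof -
    have "bi.part ?z k = 0" if "snd k > p" for k
    proof (cases "fst k = n")
      case True
      then have "k \<in> T" using that by (simp add: T_def charge_def)
      then show ?thesis using True ys wt_le_in[OF z0]
        by (simp add: wt_part_eq bi.part_proj bi.part_diff bi.proj_in_U)
    qed (use wt_le_in[OF z0] in \<open>simp add: wt_part_eq bi.part_proj\<close>)
    then show ?thesis using wt.part_in_U[OF wt_le_in[OF z0]] by (force simp: mod_deg_le_eq bi.supported_def)
  qed
  ultimately show ?thesis by blast
qed

lemma wt_part_mod_deg_le: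
  assumes "x \<in> mod_deg_le M p" shows "wt.part x n \<in> mod_deg_le M p"
proof -
  have "x \<in> space" using assms by (simp add: mod_deg_le_eq bi.supportedD)
  then show ?thesis using assms
    by (auto simp: mod_deg_le_eq bi.supported_def wt_part_eq bi.part_proj bi.proj_in_U split: if_splits)
qed

lemma gr_class_fil:
  "{f \<in> gr_space. \<forall>n\<in>half_ints. f n \<in> fil (gr_piece (A_mod V M) n) p} = gr_class ` mod_deg_le M p" (is "?L = ?R")
proof (intro equalityI subsetI)
  fix f assume f: "f \<in> ?L"
  show "f \<in> ?R"
  proof (rule gr_class_lift)
    show "vs.subspace (mod_deg_le M p)" by (simp add: mod_deg_le_eq bi.subspace_supported)
    fix n assume n: "n \<in> half_ints"
    then have "f n \<in> fil (gr_piece (A_mod V M) n) p" using f by auto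
    then obtain y b where "y \<in> wt_le n" "f n = piece n y" "b \<in> mod_deg_le M p" "y - b \<in> dO V M 1"
      by (auto simp: fil_piece[OF n])
    then show "\<exists>z\<in>mod_wt M n \<inter> mod_deg_le M p. f n = piece n z" using piece_fil_lift[OF n] by metis
  qed (use f in auto)
next
  fix f assume "f \<in> ?R"
  then obtain x where x: "x \<in> mod_deg_le M p" "f = gr_class x" by blast
  then have xs: "x \<in> space" by (simp add: mod_deg_le_eq bi.supportedD)
  have "f n \<in> fil (gr_piece (A_mod V M) n) p" if n: "n \<in> half_ints" for n
  proof -
    have "wt.part x n - wt.part x n \<in> dO V M 1" using subspace_dO by (simp add: vs.subspace_0)
    then have "wt.part x n \<in> {x \<in> wt_le n. \<exists>b\<in>mod_deg_le M p. x - b \<in> dO V M 1}"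
      using wt_part_le[OF xs n] wt_part_mod_deg_le[OF x(1)] by blast
    then show ?thesis using n x(2) unfolding fil_piece[OF n] by (simp add: gr_class_def)
  qed
  then show "f \<in> ?L" using gr_class_in[OF xs] x by blast
qed

lemma gr_class_wgt:
  assumes k: "k \<in> half_ints"
  shows "{f \<in> gr_space. \<forall>n\<in>half_ints. n \<noteq> k \<longrightarrow> f n = \<zero>\<^bsub>gr_piece (A_mod V M) n\<^esub>} = gr_class ` mod_wt M k" (is "?L = ?R")
proof (intro equalityI subsetI)
  fix f assume f: "f \<in> ?L"
  then have "f \<in> gr_class ` space" unfolding gr_class_surj by simp
  then obtain x where x: "x \<in> space" "f = gr_class x" by blast
  have "f = gr_class (sum (wt.part x) {k})"
    by (rule gr_class_sum) (use f x k wt.part_in in \<open>auto simp: gr_class_def\<close>)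
  then show "f \<in> ?R" using wt.part_in[OF x(1) k] by simp
next
  fix f assume "f \<in> ?R"
  then obtain x where x: "x \<in> mod_wt M k" "f = gr_class x" by blast
  have "x \<in> space" using mod_wt_in[OF k x(1)] .
  moreover have "f n = \<zero>\<^bsub>gr_piece (A_mod V M) n\<^esub>" if "n \<in> half_ints" "n \<noteq> k" for n
    using that x k wt.part_homogeneous[OF k x(1)] presented_space.zero_eq[OF presented_piece[OF that(1)]]
    by (simp add: gr_class_def)
  ultimately show "f \<in> ?L" using x gr_class_in by blast
qed

lemma wt_part_diff:
  assumes "x \<in> space" shows "wt.part (mod_diff M x) n = mod_diff M (wt.part x n)"
  using assms
proof (induction rule: wt.homogeneous_induct)
  case zero then show ?case by (simp add: diff_zero)
next
  case (add x y) then show ?case by (simp add: diff_add wt.part_add diff_in wt.part_in_U)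
next
  case (homogeneous i x)
  then have "mod_diff M x \<in> mod_wt M i" using weight_subcomplex_diff by blast
  then show ?case using homogeneous by (simp add: wt.part_homogeneous diff_zero)
qed

end

section \<open>The action on the associated graded space\<close>

text \<open>A quotient of the underlying space of \<open>M\<close> by a bigraded subspace, with all the
  structure of a weight graded differential filtered space coming from \<open>M\<close>.\<close>

locale presentation = voa_module V M + presented_space scal space K X \<pi>
  for V :: "'v::ab_group_add dg_voa" and M :: "('v, 'm::ab_group_add) dg_mod" and K :: "'m set"
    and X :: "('b, 'x) filt_mod" and \<pi> :: "'m \<Rightarrow> 'x" +
  assumes dif_eq: "x \<in> space \<Longrightarrow> dif X (\<pi> x) = \<pi> (mod_diff M x)"
    and fil_eq: "fil X p = \<pi> ` mod_deg_le M p"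
    and wgt_eq: "n \<in> half_ints \<Longrightarrow> wgt X n = \<pi> ` mod_wt M n"
    and kernel_part: "x \<in> K \<Longrightarrow> bi.part x k \<in> K"

context voa_module
begin

lemma wt_part_bi_part:
  assumes "x \<in> space" shows "wt.part (bi.part x k) n = (if n = fst k then bi.part x k else 0)"
  by (rule bi.eq_by_part)
    (use assms in \<open>auto simp: wt_part_eq bi.part_in_U bi.part_proj bi.part_part bi.proj_in_U dg.U_zero\<close>)

text \<open>Projection to the charge of a bidegree \<open>(n, p)\<close> preserves \<open>O(M)\<close> and the weight filtration, and on
  vectors of weight \<open>n\<close> it is the projection to degree \<open>p\<close>.\<close>

lemma gr_ker_part:
  assumes "x \<in> gr_ker" shows "bi.part x k \<in> gr_ker"
proof -
  have x: "x \<in> space" using assms by (simp add: gr_ker_def)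
  obtain n p where k: "k = (n, p)" by fastforce
  have "bi.part x k \<in> lead_ker n" if n: "n \<in> half_ints"
  proof -
    let ?w = "wt.part x n" and ?B = "charge -` {charge k}"
    have w: "?w \<in> space" using x by (rule wt.part_in_U)
    obtain y where y: "y \<in> dO V M 1" "?w - y \<in> wt_lt n"
      using assms n by (auto simp: gr_ker_def lead_ker_def)
    have ys: "y \<in> space" using y dO_subset by blast
    have eq: "bi.proj ?B ?w = bi.part x k"
      by (rule bi.eq_by_part)
        (use x w in \<open>auto simp: bi.part_in_U wt_part_eq bi.part_proj bi.part_part bi.proj_in_U k charge_def split: if_splits\<close>)
    show ?thesis
    proof (rule lead_kerI)
      show "bi.part x k \<in> wt_le n" using x
        by (auto simp: bi.supported_def bi.part_in_U bi.part_part k split: if_splits)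
      show "bi.proj ?B y \<in> dO V M 1" by (rule proj_dO[OF y(1)])
      have "bi.proj ?B (?w - y) \<in> wt_lt n" using y(2)
        by (auto simp: bi.supported_def bi.proj_in_U bi.part_proj split: if_splits)
      then show "bi.part x k - bi.proj ?B y \<in> wt_lt n" using w ys by (simp add: bi.proj_diff eq)
    qed
  qed
  then show ?thesis
    using x bi.part_in_U vs.subspace_0[OF subspace_lead_ker] by (simp add: gr_ker_def wt_part_bi_part k)
qed

lemma gr_mod_simps:
  "carrier (gr A (A_mod V M)) = gr_space"
  "\<zero>\<^bsub>gr A (A_mod V M)\<^esub> = (\<lambda>n\<in>half_ints. \<zero>\<^bsub>gr_piece (A_mod V M) n\<^esub>)"
  "f \<oplus>\<^bsub>gr A (A_mod V M)\<^esub> g = (\<lambda>n\<in>half_ints. f n \<oplus>\<^bsub>gr_piece (A_mod V M) n\<^esub> g n)"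
  "c \<odot>\<^bsub>gr A (A_mod V M)\<^esub> f = (\<lambda>n\<in>half_ints. c \<odot>\<^bsub>gr_piece (A_mod V M) n\<^esub> f n)"
  "act (gr A (A_mod V M)) = gr_act A (A_mod V M)"
  "fil (gr A (A_mod V M)) p = {f \<in> gr_space. \<forall>n\<in>half_ints. f n \<in> fil (gr_piece (A_mod V M) n) p}"
  "dif (gr A (A_mod V M)) f = (\<lambda>n\<in>half_ints. dif (gr_piece (A_mod V M) n) (f n))"
  "wgt (gr A (A_mod V M)) k = {f \<in> gr_space. \<forall>n\<in>half_ints. n \<noteq> k \<longrightarrow> f n = \<zero>\<^bsub>gr_piece (A_mod V M) n\<^esub>}"
  by (simp_all add: gr_def Let_def)

lemma presentation_gr: "presentation V M gr_ker (gr A (A_mod V M)) gr_class"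
proof unfold_locales
  show "vs.subspace gr_ker" by (rule subspace_gr_ker)
  show "gr_ker \<subseteq> space" by (auto simp: gr_ker_def)
  show "carrier (gr A (A_mod V M)) = gr_class ` space" by (simp add: gr_mod_simps gr_class_surj)
  show "(gr_class x = gr_class y) = (x - y \<in> gr_ker)" if "x \<in> space" "y \<in> space" for x y
    using that by (rule gr_class_eq_iff)
  show "\<zero>\<^bsub>gr A (A_mod V M)\<^esub> = gr_class 0"
    unfolding gr_mod_simps gr_class_def
    using presented_space.zero_eq[OF presented_piece] by (intro restrict_ext) simp
  show "gr_class x \<oplus>\<^bsub>gr A (A_mod V M)\<^esub> gr_class y = gr_class (x + y)" if "x \<in> space" "y \<in> space" for x y
    unfolding gr_mod_simps gr_class_def
    using presented_space.add_eq[OF presented_piece] wt_part_le that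
    by (intro restrict_ext) (simp add: wt.part_add)
  show "c \<odot>\<^bsub>gr A (A_mod V M)\<^esub> gr_class x = gr_class (scal c x)" if "x \<in> space" for c x
    unfolding gr_mod_simps gr_class_def
    using presented_space.smult_eq[OF presented_piece] wt_part_le that
    by (intro restrict_ext) (simp add: wt.part_scale)
  show "dif (gr A (A_mod V M)) (gr_class x) = gr_class (mod_diff M x)" if "x \<in> space" for x
    unfolding gr_mod_simps gr_class_def
    using dif_piece wt_part_le that
    by (intro restrict_ext) (simp add: wt_part_diff)
  show "fil (gr A (A_mod V M)) p = gr_class ` mod_deg_le M p" for p
    unfolding gr_mod_simps by (rule gr_class_fil)
  show "wgt (gr A (A_mod V M)) n = gr_class ` mod_wt M n" if "n \<in> half_ints" for n
    unfolding gr_mod_simps by (rule gr_class_wgt[OF that])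
  show "bi.part x k \<in> gr_ker" if "x \<in> gr_ker" for x k using that by (rule gr_ker_part)
qed (rule dg.subspace_U)

abbreviation vwt_le :: "rat \<Rightarrow> 'v set" where "vwt_le n \<equiv> vsupp (fst -` {..n})"

lemma dprod_wt_le: "u \<in> vwt_le n \<Longrightarrow> x \<in> wt_le r \<Longrightarrow> dprod V M t 1 u x \<in> wt_le (n + r)"
  by (rule dprod_supported) auto

lemma act_wt_le: "u \<in> vwt_le n \<Longrightarrow> x \<in> wt_le r \<Longrightarrow> mod_Y M u (-1) x \<in> wt_le (n + r)"
  by (rule act_supported) auto

lemma dprod_act_wt_lt:
  "u \<in> vwt_le n \<Longrightarrow> x \<in> wt_le r \<Longrightarrow> dprod V M t 1 u x - mod_Y M u (-1) x \<in> wt_lt (n + r)"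
  using dprod_leading_term[of u "fst -` {..n}" x "fst -` {..r}" 1 "fst -` {..<n + r}" t] by auto

lemma dprod_lead_ker_right:
  assumes "u \<in> vwt_le n" "x \<in> lead_ker r" shows "dprod V M 1 1 u x \<in> lead_ker (n + r)"
proof -
  obtain y where y: "x \<in> wt_le r" "y \<in> dO V M 1" "x - y \<in> wt_lt r" using assms by (auto simp: lead_ker_def)
  show ?thesis
  proof (rule lead_kerI)
    show "dprod V M 1 1 u x \<in> wt_le (n + r)" using assms(1) y(1) by (rule dprod_wt_le)
    show "dprod V M 1 1 u y \<in> dO V M 1" by (rule dprod_dO[OF y(2)])
    have "dprod V M 1 1 u (x - y) \<in> wt_lt (n + r)" by (rule dprod_supported[OF assms(1) y(3)]) auto
    then show "dprod V M 1 1 u x - dprod V M 1 1 u y \<in> wt_lt (n + r)"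
      using dprod_add_right[of "x - y" y 1 1 u] y wt_le_in dO_subset dg.U_diff by (auto simp: subset_iff)
  qed
qed

end

context voa_module
begin

lemma dprod_lead_ker_left:
  assumes "u \<in> V.self.lead_ker n" "x \<in> wt_le r" shows "dprod V M 1 1 u x \<in> lead_ker (n + r)"
proof -
  obtain y where y: "u \<in> vwt_le n" "y \<in> dO V (adjoint_module V) 1" "u - y \<in> V.adj.wt_lt n"
    using assms by (auto simp: V.self.lead_ker_def)
  have x: "x \<in> space" using assms(2) by (rule wt_le_in)
  show ?thesis
  proof (rule lead_kerI)
    show "dprod V M 1 1 u x \<in> wt_le (n + r)" using y(1) assms(2) by (rule dprod_wt_le)
    show "dprod V M 1 1 y x \<in> dO V M 1" by (rule dO_dprod[OF y(2) x])
    have "dprod V M 1 1 (u - y) x \<in> wt_lt (n + r)" by (rule dprod_supported[OF y(3) assms(2)]) auto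
    then show "dprod V M 1 1 u x - dprod V M 1 1 y x \<in> wt_lt (n + r)"
      using dprod_add_left[of x 1 1 "u - y" y] x by simp
  qed
qed

lemma lead_ker_congI:
  "x - y \<in> wt_lt n \<Longrightarrow> x \<in> lead_ker n \<Longrightarrow> y \<in> lead_ker n"
  using vs.subspace_diff[OF subspace_lead_ker, of x n "x - y"] wt_lt_lead_ker by simp

lemma act_lead_ker:
  assumes "u \<in> vwt_le n" "x \<in> wt_le r" "u \<in> V.self.lead_ker n \<or> x \<in> lead_ker r"
  shows "mod_Y M u (-1) x \<in> lead_ker (n + r)"
  using assms dprod_lead_ker_left dprod_lead_ker_right
  by (intro lead_ker_congI[OF dprod_act_wt_lt[of u n x r 1]]) auto

lemma wt_part_act:
  assumes i: "i \<in> half_ints" and u: "u \<in> voa_wt V i" and x: "x \<in> space"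
  shows "wt.part (mod_Y M u (-1) x) n = mod_Y M u (-1) (wt.part x (n - i))"
  using x
proof (induction rule: wt.homogeneous_induct)
  case zero then show ?case by (simp add: act_zero_right)
next
  case (add x y) then show ?case by (simp add: act_add_right wt.part_add act_in wt.part_in_U)
next
  case (homogeneous r x)
  have "mod_Y M u (-1) x \<in> mod_wt M (r + i)" using homogeneous i u Y_weight[of i r u "-1"] by auto
  moreover have "r + i \<in> half_ints" using homogeneous i half_ints_add by blast
  ultimately show ?case using homogeneous
    by (auto simp: wt.part_homogeneous act_zero_right)
qed

lemma wt_part_act_sum:
  assumes x: "x \<in> space"
  shows "wt.part (mod_Y M u (-1) x) n = (\<Sum>i | vpart u i \<noteq> 0. mod_Y M (vpart u i) (-1) (wt.part x (n - i)))"
proof -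
  have "mod_Y M u (-1) x = mod_Y M (\<Sum>i | vpart u i \<noteq> 0. vpart u i) (-1) x" by (simp add: sum_vpart)
  also have "\<dots> = (\<Sum>i | vpart u i \<noteq> 0. mod_Y M (vpart u i) (-1) x)" using x by (rule act_sum_left)
  finally have "wt.part (mod_Y M u (-1) x) n = (\<Sum>i | vpart u i \<noteq> 0. wt.part (mod_Y M (vpart u i) (-1) x) n)"
    using x by (simp add: wt.part_sum_general act_in)
  also have "\<dots> = (\<Sum>i | vpart u i \<noteq> 0. mod_Y M (vpart u i) (-1) (wt.part x (n - i)))"
  proof (rule sum.cong[OF refl])
    fix i assume i: "i \<in> {i. vpart u i \<noteq> 0}"
    then have "i \<in> half_ints" using vpart_outside by blast
    then show "wt.part (mod_Y M (vpart u i) (-1) x) n = mod_Y M (vpart u i) (-1) (wt.part x (n - i))"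
      using vpart_in x by (intro wt_part_act)
  qed
  finally show ?thesis .
qed

lemma vpart_le: "i \<in> half_ints \<Longrightarrow> vpart u i \<in> vwt_le i"
  using V.self.wt_part_le[of u i] by simp

text \<open>Every weight component of the product is a sum of products of components, and in each of these
  one factor vanishes in the associated graded space.\<close>

lemma act_gr_ker:
  assumes x: "x \<in> space" and ker: "u \<in> V.self.gr_ker \<or> x \<in> gr_ker"
  shows "mod_Y M u (-1) x \<in> gr_ker"
proof -
  have "mod_Y M (vpart u i) (-1) (wt.part x (n - i)) \<in> lead_ker n"
    if n: "n \<in> half_ints" and i: "vpart u i \<noteq> 0" for n i
  proof -
    have i': "i \<in> half_ints" using vpart_outside i by blast
    then have "n - i \<in> half_ints" using n half_ints_diff by blast
    then show ?thesis
      using act_lead_ker[of "vpart u i" i "wt.part x (n - i)" "n - i"] ker i' x wt_part_le vpart_le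
      by (auto simp: gr_ker_def V.self.gr_ker_def)
  qed
  then show ?thesis using x
    by (auto simp: gr_ker_def act_in wt_part_act_sum intro!: vs.subspace_sum[OF subspace_lead_ker])
qed

text \<open>Since \<open>u \<circ> x\<close> has leading term \<open>u\<^bsub>-2\<^esub> x\<close>, the \<open>C\<^sub>2\<close>-subspace lies in the kernel.\<close>

lemma C2_gr_ker: "dO V M 0 \<subseteq> gr_ker"
proof
  fix y assume y: "y \<in> dO V M 0"
  show "y \<in> gr_ker"
  proof (rule dO_induct[OF y subspace_gr_ker, of "\<lambda>x. x"])
    fix u x assume x: "x \<in> space"
    show "dprod V M 0 2 u x \<in> gr_ker"
    proof (rule biadditive_mem[OF _ _ vs.subspace_0[OF subspace_gr_ker] vs.subspace_add[OF subspace_gr_ker] _ x])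
      fix n r :: rat and p q u x
      assume *: "n \<in> half_ints" "r \<in> half_ints" "u \<in> vhom n p" "x \<in> mod_wt M r" "x \<in> mod_deg M q"
      let ?y = "mod_Y M u (-2) x" and ?N = "r + n + 1"
      have x: "x \<in> space" using *(2,4) by (rule mod_wt_in)
      have N: "?N \<in> half_ints" using * by (intro half_ints_add) auto
      have yN: "?y \<in> mod_wt M ?N" using * Y_weight[of n r u "-2"] by (auto simp: algebra_simps)
      have lt: "dprod V M 1 2 u x - mod_Y M u (- 2) x \<in> wt_lt ?N"
      proof (rule dprod_leading_term)
        show "u \<in> vsupp {(n, p)}" "x \<in> bi.supported {(r, q)}"
          using * bi_homogeneous[of r q] V.adj.bi_homogeneous[of n p] by auto
      qed auto
      have "?y \<in> lead_ker ?N"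
      proof (rule lead_kerI)
        show "?y \<in> wt_le ?N" using N yN by (rule mod_wt_le)
        show "dprod V M 1 2 u x \<in> dO V M 1" using x by (rule dprod_2_in_dO)
        show "?y - dprod V M 1 2 u x \<in> wt_lt ?N"
          using vs.subspace_neg[OF bi.subspace_supported lt] by simp
      qed
      then have "?y \<in> gr_ker" using x N yN vs.subspace_0[OF subspace_lead_ker]
        by (auto simp: gr_ker_def act_in wt.part_homogeneous)
      then show "dprod V M 0 2 u x \<in> gr_ker" using x by (simp add: dprod_0)
    qed (simp_all add: dprod_add_left dprod_add_right)
  qed auto
qed

abbreviation vpiece :: "rat \<Rightarrow> 'v \<Rightarrow> 'v set set" where "vpiece \<equiv> V.self.piece"

text \<open>Changing representatives changes the product by products with elements of \<open>lead_ker\<close>, and replacing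
  \<open>u \<ast> x\<close> by its leading term changes it by a vector of smaller weight.\<close>

lemma descend2_piece:
  assumes i: "i \<in> half_ints" "r \<in> half_ints" and u: "u \<in> vwt_le i" and x: "x \<in> wt_le r"
  shows "descend2 (A_mod V M) (wgt_below (A_mod V M) (i + r)) (act (A_mod V M)) (vpiece i u) (piece r x)
    = piece (i + r) (mod_Y M u (-1) x)"
proof (rule descend2_eqI)
  have u0: "u - u \<in> V.self.lead_ker i" using V.adj.vs.subspace_0[OF V.self.subspace_lead_ker] by simp
  have x0: "x - x \<in> lead_ker r" using vs.subspace_0[OF subspace_lead_ker] by simp
  show "vpiece i u \<noteq> {}" unfolding V.self.piece_coset[OF i(1) u] using u u0 by blast
  show "piece r x \<noteq> {}" unfolding piece_coset[OF i(2) x] using x x0 by blast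
  fix a y assume "a \<in> vpiece i u" "y \<in> piece r x"
  then obtain v z where v: "a = vclass v" "v \<in> vwt_le i" "v - u \<in> V.self.lead_ker i"
    and z: "y = A_class V M z" "z \<in> wt_le r" "z - x \<in> lead_ker r"
    unfolding piece_coset[OF i(2) x] V.self.piece_coset[OF i(1) u] by blast
  have ir: "i + r \<in> half_ints" using i by (rule half_ints_add)
  have sp: "z \<in> space" "x \<in> space" using z(2) x by (auto simp: wt_le_in)
  let ?d = "dprod V M 1 1"
  have "?d v z - mod_Y M u (-1) x = ?d (v - u) z + ?d u (z - x) + (?d u x - mod_Y M u (-1) x)"
    using dprod_add_left[of z 1 1 "v - u" u] dprod_add_right[of "z - x" x 1 1 u] sp dg.U_diff by simp
  also have "\<dots> \<in> lead_ker (i + r)"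
    using dprod_lead_ker_left[OF v(3) z(2)] dprod_lead_ker_right[OF u z(3)]
      wt_lt_lead_ker[OF dprod_act_wt_lt[OF u x]] by (intro vs.subspace_add[OF subspace_lead_ker])
  finally have "piece (i + r) (?d v z) = piece (i + r) (mod_Y M u (-1) x)"
    using ir v z u x dprod_wt_le act_wt_le by (simp add: piece_eq_iff)
  then show "wgt_below (A_mod V M) (i + r) +>\<^bsub>A_mod V M\<^esub> act (A_mod V M) a y = piece (i + r) (mod_Y M u (-1) x)"
    unfolding v(1) z(1) act_A[OF sp(1)] by (simp add: piece_def)
qed

lemma act_gr:
  assumes x: "x \<in> space"
  shows "gr_act (A_mod V (adjoint_module V)) (A_mod V M) (V.self.gr_class u) (gr_class x) = gr_class (mod_Y M u (-1) x)"
  unfolding gr_act_def gr_class_def[of "mod_Y M u (-1) x"]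
proof (rule restrict_ext)
  fix n :: rat assume n: "n \<in> half_ints"
  let ?A = "A_mod V (adjoint_module V)" and ?X = "A_mod V M"
  let ?f = "V.self.gr_class u" and ?g = "gr_class x"
  let ?J = "{i\<in>half_ints. ?f i \<noteq> \<zero>\<^bsub>gr_piece ?A i\<^esub> \<and> ?g (n - i) \<noteq> \<zero>\<^bsub>gr_piece ?X (n - i)\<^esub>}"
  let ?h = "\<lambda>i. mod_Y M (vpart u i) (-1) (wt.part x (n - i))"
  interpret P: presented_space scal "wt_le n" "lead_ker n" "gr_piece ?X n" "piece n"
    by (rule presented_piece[OF n])
  have f: "?f i = vpiece i (vpart u i)" if "i \<in> half_ints" for i using that by (simp add: V.self.gr_class_def)
  have g: "?g (n - i) = piece (n - i) (wt.part x (n - i))" if "i \<in> half_ints" for i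
    using half_ints_diff[OF n that] by (simp add: gr_class_def)
  have h_in: "?h i \<in> wt_le n" if "i \<in> half_ints" for i
    using act_wt_le[OF vpart_le[OF that] wt_part_le[OF x half_ints_diff[OF n that]]] by simp
  have sub: "?J \<subseteq> {i. vpart u i \<noteq> 0}"
    using f presented_space.zero_eq[OF V.self.presented_piece] by auto
  then have finJ: "finite ?J" using finite_vpart finite_subset by blast
  have "(\<Oplus>\<^bsub>gr_piece ?X n\<^esub>i\<in>?J. descend2 ?X (wgt_below ?X n) (act ?X) (?f i) (?g (n - i)))
      = (\<Oplus>\<^bsub>gr_piece ?X n\<^esub>i\<in>?J. piece n (?h i))"
  proof (rule P.finsum_cong')
    fix i assume "i \<in> ?J"
    then have i: "i \<in> half_ints" by simp
    show "descend2 ?X (wgt_below ?X n) (act ?X) (?f i) (?g (n - i)) = piece n (?h i)"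
      using descend2_piece[OF i half_ints_diff[OF n i] vpart_le[OF i] wt_part_le[OF x half_ints_diff[OF n i]], of u]
      by (simp add: f[OF i] g[OF i])
  qed (use h_in P.\<pi>_in in auto)
  also have "\<dots> = piece n (sum ?h ?J)" using finJ h_in by (intro P.finsum_eq) auto
  also have "\<dots> = piece n (wt.part (mod_Y M u (-1) x) n)"
  proof -
    \<comment> \<open>The sum defining the action skips the indices at which one of the two classes vanishes. The
      products of the corresponding components need not vanish, but their classes do.\<close>
    have "sum ?h {i. vpart u i \<noteq> 0} - sum ?h ?J = sum ?h ({i. vpart u i \<noteq> 0} - ?J)"
      using sum_diff[OF finite_vpart sub, of ?h] by simp
    also have "\<dots> \<in> lead_ker n"
    proof (rule vs.subspace_sum[OF subspace_lead_ker])
      fix i assume "i \<in> {i. vpart u i \<noteq> 0} - ?J"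
      then have i: "i \<in> half_ints" and z: "?f i = \<zero>\<^bsub>gr_piece ?A i\<^esub> \<or> ?g (n - i) = \<zero>\<^bsub>gr_piece ?X (n - i)\<^esub>"
        using vpart_outside by auto
      have ni: "n - i \<in> half_ints" using half_ints_diff[OF n i] .
      have "vpart u i \<in> V.self.lead_ker i \<or> wt.part x (n - i) \<in> lead_ker (n - i)"
        using z f[OF i] g[OF i] presented_space.\<pi>_zero_iff[OF presented_piece[OF ni] wt_part_le[OF x ni]]
          presented_space.\<pi>_zero_iff[OF V.self.presented_piece[OF i] vpart_le[OF i]] by auto
      then show "?h i \<in> lead_ker n"
        using act_lead_ker[OF vpart_le[OF i] wt_part_le[OF x ni]] by simp
    qed
    finally have "wt.part (mod_Y M u (-1) x) n - sum ?h ?J \<in> lead_ker n"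
      by (simp add: wt_part_act_sum[OF x])
    then have "piece n (wt.part (mod_Y M u (-1) x) n) = piece n (sum ?h ?J)"
      using n h_in wt_part_le[OF act_in[OF x] n]
      by (subst piece_eq_iff) (auto intro: vs.subspace_sum[OF bi.subspace_supported])
    then show ?thesis by simp
  qed
  finally show "(\<Oplus>\<^bsub>gr_piece ?X n\<^esub>i\<in>?J. descend2 ?X (wgt_below ?X n) (act ?X) (?f i) (?g (n - i)))
      = piece n (wt.part (mod_Y M u (-1) x) n)" .
qed

end

section \<open>The base change along the map to the associated graded algebra\<close>

lemma as_algebra_simps [simp]:
  "carrier (as_algebra X e) = carrier X" "\<zero>\<^bsub>as_algebra X e\<^esub> = \<zero>\<^bsub>X\<^esub>" "x \<oplus>\<^bsub>as_algebra X e\<^esub> y = x \<oplus>\<^bsub>X\<^esub> y"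
  "c \<odot>\<^bsub>as_algebra X e\<^esub> x = c \<odot>\<^bsub>X\<^esub> x" "act (as_algebra X e) = act X" "fil (as_algebra X e) = fil X"
  "dif (as_algebra X e) = dif X" "wgt (as_algebra X e) = wgt X" "x \<otimes>\<^bsub>as_algebra X e\<^esub> y = act X x y"
  "\<one>\<^bsub>as_algebra X e\<^esub> = e"
  by (simp_all add: as_algebra_def)

lemma as_algebra_coset [simp]: "a_r_coset (as_algebra X e) = a_r_coset X"
  by (intro ext) (simp add: a_r_coset_def r_coset_def)

lemma wgt_below_as_algebra [simp]: "wgt_below (as_algebra X e) = wgt_below X"
  by (intro ext) (simp add: wgt_below_def)

lemma gr_piece_as_algebra [simp]: "gr_piece (as_algebra X e) = gr_piece X"
  by (intro ext)
    (simp add: gr_piece_def quotient_by_def A_RCOSETS_def RCOSETS_def set_add_def set_mult_def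
      descend_def[abs_def] a_r_coset_def[abs_def] r_coset_def[abs_def] as_algebra_def
      wgt_below_as_algebra[unfolded as_algebra_def])

text \<open>The associated graded space is built from addition, scalars, action, differential and filtrations,
  which \<open>as_algebra\<close> leaves alone.\<close>

lemma gr_as_algebra: "gr (as_algebra A e) X = gr A X" "gr A (as_algebra Y e') = gr A Y"
  by (simp_all add: gr_def gr_act_def[abs_def] descend2_def)

context presented_space
begin

lemma span_of_image:
  assumes G: "G \<subseteq> S" shows "span_of X (\<pi> ` G) = \<pi> ` span (P \<union> G)"
proof -
  have sub: "span (P \<union> G) \<subseteq> S" using G P_subset subspace_S by (intro span_minimal) auto
  have "\<pi> ` span (P \<union> G) \<subseteq> T" if T: "is_subspace X T" "\<pi> ` G \<subseteq> T" for T
  proof -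
    have T': "submodule T complex_ring X" using T(1) by (simp add: is_subspace_def)
    have "\<pi> x \<in> T" if "x \<in> span (P \<union> G)" for x
    proof -
      have "x \<in> S \<and> \<pi> x \<in> T" using that
      proof (induction rule: span_induct_alt)
        case base
        have "\<zero>\<^bsub>X\<^esub> \<in> T" using T' submodule.axioms(1) subgroup.one_closed by fastforce
        then show ?case by (simp add: S_0 zero_eq)
      next
        case (step c g y)
        have g: "g \<in> S" using step(1) G P_subset by blast
        have "\<pi> g \<in> T"
        proof (cases "g \<in> P")
          case True
          then have "\<pi> g = \<zero>\<^bsub>X\<^esub>" using \<pi>_zero_iff[OF g] by simp
          then show ?thesis using T' submodule.axioms(1) subgroup.one_closed by fastforce
        qed (use step T in blast)
        then have "c \<odot>\<^bsub>X\<^esub> \<pi> g \<oplus>\<^bsub>X\<^esub> \<pi> y \<in> T"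
          using submoduleE(4,5)[OF T'] step by (simp add: complex_ring_def)
        then show ?case using g step by (simp add: smult_eq add_eq S_scale S_add)
      qed
      then show ?thesis ..
    qed
    then show ?thesis by blast
  qed
  moreover have "is_subspace X (\<pi> ` span (P \<union> G))" by (rule is_subspace_image[OF subspace_span sub])
  moreover have "\<pi> ` G \<subseteq> \<pi> ` span (P \<union> G)" using span_superset by blast
  ultimately show ?thesis unfolding span_of_def by (intro hull_unique)
qed

end

lemma presentation_as_algebra:
  "presentation V M K X \<pi> \<Longrightarrow> presentation V M K (as_algebra X e) \<pi>"
  by (simp add: presentation_def presentation_axioms_def presented_space_def presented_space_axioms_def)

context voa_module
begin

lemma gr_single_eq:
  assumes n: "n \<in> half_ints" and x: "x \<in> mod_wt M n"
  shows "gr_single (A_mod V M) n (A_class V M x) = gr_class x"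
  unfolding gr_single_def gr_class_def
  using presented_space.zero_eq[OF presented_piece] wt.part_homogeneous[OF n x]
  by (intro restrict_ext) (auto simp: piece_def)

end

context voa
begin

lemma grA_alg_eq:
  "grA_alg V = as_algebra (gr (A_mod V (adjoint_module V)) (A_mod V (adjoint_module V))) (self.gr_class (va_vac V))"
proof -
  have "gr_single (A_alg V) 0 (A_unit V) = gr_single (A_mod V (adjoint_module V)) 0 (A_unit V)"
    unfolding gr_single_def A_alg_def by (intro restrict_ext) auto
  also have "\<dots> = self.gr_class (va_vac V)"
    using self.gr_single_eq[of 0 "va_vac V"] vac_weight by (simp add: A_unit_def)
  finally show ?thesis by (simp add: grA_alg_def A_alg_def gr_as_algebra)
qed

lemma presentation_grA_alg: "presentation V (adjoint_module V) self.gr_ker (grA_alg V) self.gr_class"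
  unfolding grA_alg_eq by (rule presentation_as_algebra[OF self.presentation_gr])

lemma carrier_R_alg: "carrier (R_alg V) = range (R_class (adjoint_module V))"
  using presented_space.carrier_eq[OF self.presented_R] by (simp add: R_alg_def)

lemma eta_R_class: "eta V (R_class (adjoint_module V) u) = self.gr_class u"
  unfolding eta_def self.gr_class_def A_alg_def wgt_below_as_algebra
proof (rule restrict_ext)
  fix n :: rat assume n: "n \<in> half_ints"
  show "descend (as_algebra (A_mod V (adjoint_module V)) (A_unit V)) (wgt_below (A_mod V (adjoint_module V)) n)
      (\<lambda>u. A_class V (adjoint_module V) (component half_ints (voa_wt V) u n)) (R_class (adjoint_module V) u)
    = self.piece n (component half_ints (mod_wt (adjoint_module V)) u n)"
  proof (rule descend_eqI)
    show "R_class (adjoint_module V) u \<noteq> {}" using self.R_class_self[of u] by auto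
    fix v assume "v \<in> R_class (adjoint_module V) u"
    then have "v - u \<in> self.gr_ker" using self.R_class_coset[of u] self.C2_gr_ker by auto
    then have "self.gr_class v = self.gr_class u" using self.gr_class_eq_iff[of v u] by simp
    from fun_cong[OF this, of n]
    have "self.piece n (component half_ints (mod_wt (adjoint_module V)) v n) =
        self.piece n (component half_ints (mod_wt (adjoint_module V)) u n)"
      using n by (simp add: self.gr_class_def)
    then show "wgt_below (A_mod V (adjoint_module V)) n +>\<^bsub>as_algebra (A_mod V (adjoint_module V)) (A_unit V)\<^esub>
        A_class V (adjoint_module V) (component half_ints (voa_wt V) v n)
      = self.piece n (component half_ints (mod_wt (adjoint_module V)) u n)"
      by (simp add: self.piece_def)
  qed
qed

lemma eta_ker_eq: "eta_ker V = R_class (adjoint_module V) ` self.gr_ker"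
proof -
  interpret G: presentation V "adjoint_module V" self.gr_ker "grA_alg V" self.gr_class
    by (rule presentation_grA_alg)
  have "eta V (R_class (adjoint_module V) u) = \<zero>\<^bsub>grA_alg V\<^esub> \<longleftrightarrow> u \<in> self.gr_ker" for u
    using G.\<pi>_zero_iff[of u] by (simp add: eta_R_class)
  then show ?thesis by (auto simp: eta_ker_def carrier_R_alg)
qed

end

context voa_module
begin

lemma diff_gr_ker: "x \<in> gr_ker \<Longrightarrow> mod_diff M x \<in> gr_ker"
  using diff_lead_ker by (simp add: gr_ker_def wt_part_diff diff_in)

end

context voa_module
begin

text \<open>The preimage in \<open>M\<close> of the product of \<open>Ker eta\<close> with \<open>R(M)\<close>.\<close>

definition etaR_ker :: "'m set" where
  "etaR_ker = vs.span (dO V M 0 \<union> {mod_Y M u (-1) x | u x. u \<in> V.self.gr_ker \<and> x \<in> space})"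

lemma subspace_etaR_ker: "vs.subspace etaR_ker"
  unfolding etaR_ker_def by (rule vs.subspace_span)

lemma C2_etaR_ker: "x \<in> dO V M 0 \<Longrightarrow> x \<in> etaR_ker"
  unfolding etaR_ker_def by (rule vs.span_base) blast

lemma gr_ker_act: "u \<in> V.self.gr_ker \<Longrightarrow> x \<in> space \<Longrightarrow> mod_Y M u (-1) x \<in> etaR_ker"
  unfolding etaR_ker_def by (rule vs.span_base) blast

lemma etaR_ker_subset: "etaR_ker \<subseteq> space"
  unfolding etaR_ker_def using dO_subset act_in by (intro vs.span_minimal dg.subspace_U) auto

lemma etaR_ker_gr_ker: "etaR_ker \<subseteq> gr_ker"
  unfolding etaR_ker_def using C2_gr_ker act_gr_ker by (intro vs.span_minimal subspace_gr_ker) auto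

lemma etaR_ker_induct:
  assumes y: "y \<in> etaR_ker" and K: "vs.subspace K"
    and "\<And>x. x \<in> dO V M 0 \<Longrightarrow> f x \<in> K"
    and "\<And>u x. u \<in> V.self.gr_ker \<Longrightarrow> x \<in> space \<Longrightarrow> f (mod_Y M u (-1) x) \<in> K"
    and add: "\<And>x y. x \<in> space \<Longrightarrow> y \<in> space \<Longrightarrow> f (x + y) = f x + f y"
    and scale: "\<And>c x. x \<in> space \<Longrightarrow> f (scal c x) = scal c (f x)"
  shows "f y \<in> K"
proof (rule dg.linear_span_mem[where t = scal and f = f, OF _ _ _ add scale vector_space K])
  show "y \<in> vs.span (dO V M 0 \<union> {mod_Y M u (-1) x | u x. u \<in> V.self.gr_ker \<and> x \<in> space})"
    using y by (simp add: etaR_ker_def)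
qed (use assms(3,4) subsetD[OF dO_subset] act_in in auto)

text \<open>The kernel of \<open>eta\<close> is bigraded, so its products with \<open>M\<close> can be tested on homogeneous
  elements of that kernel.\<close>

lemma gr_ker_act_homogeneous:
  assumes u: "u \<in> V.self.gr_ker" and x: "x \<in> space" and K: "vs.subspace K"
    and add: "\<And>x y. x \<in> space \<Longrightarrow> y \<in> space \<Longrightarrow> f (x + y) = f x + f y"
    and hom: "\<And>n p r q u x. n \<in> half_ints \<Longrightarrow> r \<in> half_ints \<Longrightarrow> u \<in> vhom n p \<Longrightarrow> u \<in> V.self.gr_ker \<Longrightarrow>
      x \<in> mod_wt M r \<Longrightarrow> x \<in> mod_deg M q \<Longrightarrow> f (mod_Y M u (-1) x) \<in> K"
  shows "f (mod_Y M u (-1) x) \<in> K"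
proof -
  have f0: "f 0 = 0" using add[of 0 0] dg.U_zero by simp
  have hom': "f (mod_Y M (V.adj.bi.part u i) (-1) x) \<in> K" for i
  proof (cases "i \<in> half_ints \<times> UNIV")
    case True
    then have ui: "V.adj.bi.part u i \<in> vhom (fst i) (snd i)" using V.adj.bi.part_in[of u i] by auto
    show ?thesis using x
    proof (induction rule: bi.homogeneous_induct)
      case zero then show ?case using K f0 by (simp add: act_zero_right vs.subspace_0)
    next
      case (add x y) then show ?case using K assms(4) by (simp add: act_add_right act_in vs.subspace_add)
    next
      case (homogeneous k x)
      then show ?case using hom[OF _ _ ui V.self.gr_ker_part[OF u], of "fst k" x "snd k"] True by auto
    qed
  next
    case False
    then show ?thesis using V.adj.bi.part_outside[of u i] x K f0 by (simp add: act_zero_left vs.subspace_0)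
  qed
  have fsum: "f (sum g J) = (\<Sum>j\<in>J. f (g j))" if "\<And>j. j \<in> J \<Longrightarrow> g j \<in> space" for g :: "rat \<times> int \<Rightarrow> 'm" and J
    using that by (induction J rule: infinite_finite_induct) (auto simp: f0 add dg.U_sum)
  let ?J = "{i. V.adj.bi.part u i \<noteq> 0}"
  have "mod_Y M u (-1) x = (\<Sum>i\<in>?J. mod_Y M (V.adj.bi.part u i) (-1) x)"
    using act_sum_left[OF x, of "V.adj.bi.part u" ?J] V.adj.bi.sum_part[of u] by simp
  then have "f (mod_Y M u (-1) x) = (\<Sum>i\<in>?J. f (mod_Y M (V.adj.bi.part u i) (-1) x))"
    using x by (simp add: fsum act_in)
  then show ?thesis using hom' K by (simp add: vs.subspace_sum)
qed

lemma etaR_ker_part: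
  assumes "x \<in> etaR_ker" shows "bi.part x k \<in> etaR_ker"
proof (rule etaR_ker_induct[OF assms subspace_etaR_ker])
  show "x \<in> dO V M 0 \<Longrightarrow> bi.part x k \<in> etaR_ker" for x by (intro C2_etaR_ker part_dO_0)
  fix u x assume u: "u \<in> V.self.gr_ker" and x: "x \<in> space"
  show "bi.part (mod_Y M u (-1) x) k \<in> etaR_ker"
  proof (rule gr_ker_act_homogeneous[OF u x subspace_etaR_ker])
    fix n r :: rat and p q u x
    assume *: "n \<in> half_ints" "r \<in> half_ints" "u \<in> vhom n p" "u \<in> V.self.gr_ker" "x \<in> mod_wt M r" "x \<in> mod_deg M q"
    let ?k = "(n + r - of_int (- 1) - 1, p + q - 2 * (- 1) - 2)"
    have "mod_Y M u (-1) x \<in> bi.supported (id -` {?k})"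
      using act_bihomogeneous[OF *(1-3,5,6), of "-1"] by simp
    then have "bi.part (mod_Y M u (-1) x) k = (if ?k \<in> {k} then mod_Y M u (-1) x else 0)"
      using bi.proj_on_supported[of _ id ?k "{k}"] by (simp add: bi.proj_single)
    then show "bi.part (mod_Y M u (-1) x) k \<in> etaR_ker"
      using gr_ker_act[OF *(4) mod_wt_in[OF *(2,5)]] vs.subspace_0[OF subspace_etaR_ker] by simp
  qed (rule bi.part_add)
qed (simp_all add: bi.part_add bi.part_scale)

lemma diff_etaR_ker:
  assumes "x \<in> etaR_ker" shows "mod_diff M x \<in> etaR_ker"
proof (rule etaR_ker_induct[OF assms subspace_etaR_ker])
  show "x \<in> dO V M 0 \<Longrightarrow> mod_diff M x \<in> etaR_ker" for x by (intro C2_etaR_ker diff_dO)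
  fix u x assume u: "u \<in> V.self.gr_ker" and x: "x \<in> space"
  show "mod_diff M (mod_Y M u (-1) x) \<in> etaR_ker"
  proof (rule gr_ker_act_homogeneous[OF u x subspace_etaR_ker])
    fix n r :: rat and p q u x
    assume *: "n \<in> half_ints" "r \<in> half_ints" "u \<in> vhom n p" "u \<in> V.self.gr_ker" "x \<in> mod_wt M r" "x \<in> mod_deg M q"
    have x: "x \<in> space" using *(2,5) by (rule mod_wt_in)
    have "va_diff V u \<in> V.self.gr_ker" using V.self.diff_gr_ker[OF *(4)] by simp
    then show "mod_diff M (mod_Y M u (-1) x) \<in> etaR_ker"
      using act_diff[of u p x "-1"] * x
      by (auto intro!: vs.subspace_add[OF subspace_etaR_ker] vs.subspace_scale[OF subspace_etaR_ker]
          gr_ker_act diff_in)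
  qed (rule diff_add)
qed (simp_all add: diff_add diff_scale)

text \<open>Modulo \<open>C\<^sub>2(M)\<close> the vector \<open>u\<^bsub>-1\<^esub> (v\<^bsub>-1\<^esub> x)\<close> is \<open>(u\<^bsub>-1\<^esub> v)\<^bsub>-1\<^esub> x\<close>, and \<open>u\<^bsub>-1\<^esub> v\<close> stays in the kernel.\<close>

lemma act_etaR_ker:
  assumes "x \<in> etaR_ker" shows "mod_Y M u (-1) x \<in> etaR_ker"
proof (rule etaR_ker_induct[OF assms subspace_etaR_ker])
  fix x assume x: "x \<in> dO V M 0"
  then have "dprod V M 0 1 u x \<in> dO V M 0" by (rule dprod_dO)
  then show "mod_Y M u (-1) x \<in> etaR_ker" using subsetD[OF dO_subset x] C2_etaR_ker by (simp add: dprod_0)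
next
  fix v x assume v: "v \<in> V.self.gr_ker" and x: "x \<in> space"
  have uv: "va_Y V u (-1) v \<in> V.self.gr_ker" using V.self.act_gr_ker[of v u] v by simp
  have "mod_Y M (va_Y V u (-1) v) (-1) x - mod_Y M u (-1) (mod_Y M v (-1) x) \<in> dO V M 0"
    using associator[OF x, of 1 0 u v] x V.self.dprod_0[of v 1 u] by (simp add: dprod_0 act_in)
  then have "mod_Y M (va_Y V u (-1) v) (-1) x -
      (mod_Y M (va_Y V u (-1) v) (-1) x - mod_Y M u (-1) (mod_Y M v (-1) x)) \<in> etaR_ker"
    by (intro vs.subspace_diff[OF subspace_etaR_ker] gr_ker_act uv x C2_etaR_ker)
  then show "mod_Y M u (-1) (mod_Y M v (-1) x) \<in> etaR_ker" by simp
qed (simp_all add: act_add_right act_scale_right)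

lemma eta_ker_times_eq: "eta_ker_times V (R_mod V M) = R_class M ` etaR_ker"
proof -
  interpret R: presented_space scal space "dO V M 0" "R_mod V M" "R_class M" by (rule presented_R)
  let ?G = "{mod_Y M u (-1) x | u x. u \<in> V.self.gr_ker \<and> x \<in> space}"
  have "{act (R_mod V M) r w |r w. r \<in> eta_ker V \<and> w \<in> carrier (R_mod V M)} = R_class M ` ?G"
  proof (intro equalityI subsetI)
    fix c assume "c \<in> R_class M ` ?G"
    then obtain u x where "c = act (R_mod V M) (R_class (adjoint_module V) u) (R_class M x)"
      "u \<in> V.self.gr_ker" "x \<in> space" using act_R by auto
    then show "c \<in> {act (R_mod V M) r w |r w. r \<in> eta_ker V \<and> w \<in> carrier (R_mod V M)}"
      unfolding V.eta_ker_eq R.carrier_eq by blast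
  next
    fix c assume "c \<in> {act (R_mod V M) r w |r w. r \<in> eta_ker V \<and> w \<in> carrier (R_mod V M)}"
    then obtain u x where "c = act (R_mod V M) (R_class (adjoint_module V) u) (R_class M x)"
      "u \<in> V.self.gr_ker" "x \<in> space" unfolding V.eta_ker_eq R.carrier_eq by blast
    then show "c \<in> R_class M ` ?G" using act_R by blast
  qed
  moreover have "?G \<subseteq> space" using act_in by auto
  ultimately show ?thesis
    unfolding eta_ker_times_def by (simp add: R.span_of_image etaR_ker_def)
qed

lemma etaR_class_eq: "etaR_class V M x = R_class M ` etaR_ker +>\<^bsub>R_mod V M\<^esub> R_class M x"
  by (simp add: etaR_class_def eta_ker_times_eq)

lemma presentation_etaR: "presentation V M etaR_ker (etaR_mod V M) (etaR_class V M)"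
proof -
  interpret R: presented_space scal space "dO V M 0" "R_mod V M" "R_class M" by (rule presented_R)
  have sub: "dO V M 0 \<subseteq> etaR_ker" using C2_etaR_ker by blast
  obtain ac where ac: "etaR_mod V M = quotient_by (R_mod V M) (R_class M ` etaR_ker) ac"
    unfolding etaR_mod_def eta_mod_def eta_ker_times_eq by blast
  have cl: "etaR_class V M = (\<lambda>x. R_class M ` etaR_ker +>\<^bsub>R_mod V M\<^esub> R_class M x)"
    by (rule ext) (rule etaR_class_eq)
  have "presented_space scal space etaR_ker (etaR_mod V M) (etaR_class V M)"
    unfolding ac cl by (rule R.presented_quotient[OF subspace_etaR_ker sub etaR_ker_subset])
  then interpret E: presented_space scal space etaR_ker "etaR_mod V M" "etaR_class V M" .
  show ?thesis
  proof unfold_locales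
    show "dif (etaR_mod V M) (etaR_class V M x) = etaR_class V M (mod_diff M x)" if "x \<in> space" for x
      unfolding ac cl
      using that dif_R diff_in diff_sub diff_etaR_ker
      by (intro R.quotient_dif[OF subspace_etaR_ker sub etaR_ker_subset])
    show "fil (etaR_mod V M) p = etaR_class V M ` mod_deg_le M p" for p
      unfolding ac cl by (simp add: quotient_by_def fil_R image_image)
    show "wgt (etaR_mod V M) n = etaR_class V M ` mod_wt M n" for n
      unfolding ac cl by (simp add: quotient_by_def wgt_R image_image)
  qed (rule etaR_ker_part)
qed

lemma act_etaR:
  assumes x: "x \<in> space"
  shows "act (etaR_mod V M) (V.self.gr_class u) (etaR_class V M x) = etaR_class V M (mod_Y M u (-1) x)"
proof -
  interpret R: presented_space scal space "dO V M 0" "R_mod V M" "R_class M" by (rule presented_R)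
  have sub: "dO V M 0 \<subseteq> etaR_ker" using C2_etaR_ker by blast
  let ?H = "eta_ker_times V (R_mod V M)"
  let ?I = "{r \<in> carrier (R_alg V). eta V r = V.self.gr_class u}"
  have "descend (R_mod V M) ?H (act (R_mod V M) r) (etaR_class V M x) = etaR_class V M (mod_Y M u (-1) x)"
    if r: "r \<in> ?I" for r
  proof -
    obtain v where v: "r = R_class (adjoint_module V) v" using r by (auto simp: V.carrier_R_alg)
    then have vu: "v - u \<in> V.self.gr_ker" using r V.self.gr_class_eq_iff[of v u] by (simp add: V.eta_R_class)
    show ?thesis
      unfolding etaR_class_eq eta_ker_times_eq
    proof (rule R.descend_coset[OF subspace_etaR_ker etaR_ker_subset x])
      fix y assume y: "y \<in> space" "y - x \<in> etaR_ker"
      have "mod_Y M v (-1) y - mod_Y M u (-1) x = mod_Y M (v - u) (-1) y + mod_Y M u (-1) (y - x)"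
        using act_add_left[of y "v - u" u "-1"] act_add_right[of "y - x" x u "-1"] x y(1) dg.U_diff by simp
      also have "\<dots> \<in> etaR_ker"
        using gr_ker_act[OF vu y(1)] act_etaR_ker[OF y(2)] by (intro vs.subspace_add[OF subspace_etaR_ker])
      finally show "R_class M ` etaR_ker +>\<^bsub>R_mod V M\<^esub> act (R_mod V M) r (R_class M y) =
          R_class M ` etaR_ker +>\<^bsub>R_mod V M\<^esub> R_class M (mod_Y M u (-1) x)"
        unfolding v act_R[OF y(1)]
        using R.coset_cong_iff[OF subspace_etaR_ker sub etaR_ker_subset] x y act_in by blast
    qed
  qed
  moreover have "R_class (adjoint_module V) u \<in> ?I" by (simp add: V.carrier_R_alg V.eta_R_class)
  ultimately have "(\<Union>r\<in>?I. descend (R_mod V M) ?H (act (R_mod V M) r) (etaR_class V M x))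
      = etaR_class V M (mod_Y M u (-1) x)" by blast
  then show ?thesis by (simp add: etaR_mod_def eta_mod_def quotient_by_def)
qed

end

section \<open>Presented spaces are weight graded differential filtered modules\<close>

context voa_module
begin

text \<open>If \<open>u\<close> has components of degree below \<open>i\<close>, the sign \<open>(-1)\<^sup>i\<close> is wrong for them, but the error
  \<open>u\<^bsub>-1\<^esub> d x\<close> then has degree at most \<open>(i - 1) + (j + 1)\<close>.\<close>

lemma leibniz:
  assumes u: "u \<in> mod_deg_le (adjoint_module V) i" and x: "x \<in> mod_deg_le M j"
  shows "mod_diff M (mod_Y M u (-1) x) -
      (mod_Y M (va_diff V u) (-1) x + scal ((-1) powi i) (mod_Y M u (-1) (mod_diff M x))) \<in> mod_deg_le M (i + j)"
    (is "?f u x \<in> _")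
  unfolding mod_deg_le_eq
proof (rule biadditive_supported[where f = "\<lambda>u x. ?f u x"])
  show "u \<in> vsupp (snd -` {..i})" using u V.adj.mod_deg_le_eq by simp
  show "x \<in> bi.supported (snd -` {..j})" using x by (simp add: mod_deg_le_eq)
  show "0 \<in> bi.supported (snd -` {..i + j})" by (rule bi.supported_0)
  note lin = act_add_left act_add_right diff_add diff_in act_in vs.scale_right_distrib dg.U_add
    V.adj.diff_add[simplified]
  show "?f (u + v) x = ?f u x + ?f v x" if "x \<in> space" for u v x
    using that by (simp add: lin)
  show "?f u (x + y) = ?f u x + ?f u y" if "x \<in> space" "y \<in> space" for u x y
    using that by (simp add: lin)
  show "a + b \<in> bi.supported (snd -` {..i + j})"
    if "a \<in> bi.supported (snd -` {..i + j})" "b \<in> bi.supported (snd -` {..i + j})" for a b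
    using that by (rule bi.supported_add)
  fix n r :: rat and p q u x
  assume *: "n \<in> half_ints" "r \<in> half_ints" "(n, p) \<in> snd -` {..i}" "(r, q) \<in> snd -` {..j}"
    "u \<in> vhom n p" "x \<in> mod_wt M r" "x \<in> mod_deg M q"
  have x: "x \<in> space" using *(7) by (rule mod_deg_in)
  have f: "?f u x = scal ((-1) powi p - (-1) powi i) (mod_Y M u (-1) (mod_diff M x))"
    using *(5) act_diff[of u p x "-1"] x by (simp add: vs.scale_left_diff_distrib)
  have "p \<le> i" "q \<le> j" using * by auto
  have "?f u x \<in> bi.supported (snd -` {..i + j})"
  proof (cases "p = i")
    case True then show ?thesis unfolding f by (simp add: vs.subspace_0 bi.subspace_supported)
  next
    case False
    have "mod_diff M x \<in> mod_deg M (q + 1)" using *(7) diff_degree by auto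
    then have "mod_Y M u (-1) (mod_diff M x) \<in> mod_deg M (q + 1 + (p - 2 * (-1) - 2))"
      using *(5) Y_degree[of u p "-1" "q + 1"] by blast
    then have "mod_Y M u (-1) (mod_diff M x) \<in> bi.supported (snd -` {p + q + 1})"
      using mod_deg_eq[of "p + q + 1"] by (simp add: algebra_simps)
    moreover have "bi.supported (snd -` {p + q + 1}) \<subseteq> bi.supported (snd -` {..i + j})"
      using False \<open>p \<le> i\<close> \<open>q \<le> j\<close> by (intro bi.supported_mono) auto
    ultimately show ?thesis unfolding f by (intro vs.subspace_scale[OF bi.subspace_supported]) blast
  qed
  then show "?f u x \<in> bi.supported (snd -` {..i + j})" .
qed

lemma act_deg_le:
  assumes "u \<in> mod_deg_le (adjoint_module V) i" "x \<in> mod_deg_le M j"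
  shows "mod_Y M u (-1) x \<in> mod_deg_le M (i + j)"
proof -
  have "u \<in> vsupp (snd -` {..i})" using assms(1) V.adj.mod_deg_le_eq by simp
  moreover have "x \<in> bi.supported (snd -` {..j})" using assms(2) by (simp add: mod_deg_le_eq)
  ultimately show ?thesis unfolding mod_deg_le_eq by (rule act_supported) auto
qed

lemma subspace_deg_le: "vs.subspace (mod_deg_le M i)"
  by (simp add: mod_deg_le_eq bi.subspace_supported)

lemma deg_le_in: "x \<in> mod_deg_le M i \<Longrightarrow> x \<in> space"
  by (simp add: mod_deg_le_eq bi.supportedD)

lemma deg_le_exhaust:
  assumes "x \<in> space" shows "\<exists>i. x \<in> mod_deg_le M i"
proof -
  have "finite (snd ` {k. bi.part x k \<noteq> 0})" using bi.finite_part[OF assms] by simp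
  then have "bi.part x k \<noteq> 0 \<Longrightarrow> snd k \<le> Max (insert 0 (snd ` {k. bi.part x k \<noteq> 0}))" for k
    by (intro Max_ge) auto
  then have "x \<in> mod_deg_le M (Max (insert 0 (snd ` {k. bi.part x k \<noteq> 0})))"
    using assms by (auto simp: mod_deg_le_eq bi.supported_def)
  then show ?thesis ..
qed

lemma diff_deg_le: "x \<in> mod_deg_le M i \<Longrightarrow> mod_diff M x \<in> mod_deg_le M (i + 1)"
  unfolding mod_deg_le_eq by (erule diff_supported) auto

end

context presentation
begin

lemma kernel_proj: "x \<in> K \<Longrightarrow> bi.proj B x \<in> K"
  unfolding bi.proj_def by (intro S_sum vs.subspace_sum[OF subspace_P] kernel_part)

lemma K_in: "x \<in> K \<Longrightarrow> x \<in> space"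
  using P_subset by blast

lemma kernel_wt_part: "x \<in> K \<Longrightarrow> wt.part x n \<in> K"
  using kernel_proj K_in by (simp add: wt_part_eq)

lemma weight_graded_space_X: "weight_graded_space X"
  unfolding weight_graded_space_def
proof (intro conjI ballI)
  show "Module.module complex_ring X" by (rule module_X)
  show "is_subspace X (wgt X n)" if "n \<in> half_ints" for n
    unfolding wgt_eq[OF that] using that wt.subspace_S wt.S_subset by (intro is_subspace_image)
  fix x assume "x \<in> carrier X"
  then obtain y where y: "y \<in> space" "x = \<pi> y" by (auto simp: carrier_eq)
  let ?P = "\<lambda>f. f \<in> (\<Pi>\<^sub>E n\<in>half_ints. wgt X n) \<and> finite {n \<in> half_ints. f n \<noteq> \<zero>\<^bsub>X\<^esub>} \<and>
      x = (\<Oplus>\<^bsub>X\<^esub>n\<in>{n \<in> half_ints. f n \<noteq> \<zero>\<^bsub>X\<^esub>}. f n)"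
  let ?f = "\<lambda>n\<in>half_ints. \<pi> (wt.part y n)"
  let ?J = "{n \<in> half_ints. ?f n \<noteq> \<zero>\<^bsub>X\<^esub>}" and ?I = "{n. wt.part y n \<noteq> 0}"
  have sub: "?J \<subseteq> ?I" by (auto simp: zero_eq)
  then have fin: "finite ?J" using wt.finite_part[OF y(1)] finite_subset by blast
  show "\<exists>!f. ?P f"
  proof (rule ex1I[of _ ?f])
    have "sum (wt.part y) ?I - sum (wt.part y) ?J = sum (wt.part y) (?I - ?J)"
      using sum_diff[OF wt.finite_part[OF y(1)] sub, of "wt.part y"] by simp
    also have "\<dots> \<in> K"
    proof (rule vs.subspace_sum[OF subspace_P])
      fix n assume "n \<in> ?I - ?J"
      then have "n \<in> half_ints" "\<pi> (wt.part y n) = \<zero>\<^bsub>X\<^esub>" using wt.part_outside[OF y(1)] by auto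
      then show "wt.part y n \<in> K" using \<pi>_zero_iff wt.part_in_U[OF y(1)] by blast
    qed
    finally have "x = \<pi> (sum (wt.part y) ?J)"
      using y wt.part_in_U by (simp add: wt.sum_part \<pi>_eq_iff S_sum)
    also have "\<dots> = (\<Oplus>\<^bsub>X\<^esub>n\<in>?J. \<pi> (wt.part y n))"
      using fin wt.part_in_U[OF y(1)] by (intro finsum_eq[symmetric])
    also have "\<dots> = (\<Oplus>\<^bsub>X\<^esub>n\<in>?J. ?f n)"
      using wt.part_in_U[OF y(1)] \<pi>_in by (intro finsum_cong') auto
    finally have "x = (\<Oplus>\<^bsub>X\<^esub>n\<in>?J. ?f n)" .
    then show "?P ?f" using fin wt.part_in[OF y(1)] by (auto simp: wgt_eq)
  next
    fix g assume g: "?P g"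
    let ?L = "{n \<in> half_ints. g n \<noteq> \<zero>\<^bsub>X\<^esub>}"
    have "\<forall>n\<in>?L. \<exists>z. z \<in> mod_wt M n \<and> g n = \<pi> z" using g wgt_eq by (auto simp: PiE_def Pi_def)
    from bchoice[OF this] obtain z where z: "\<forall>n\<in>?L. z n \<in> mod_wt M n \<and> g n = \<pi> (z n)" ..
    have zs: "z n \<in> space" if "n \<in> ?L" for n using z that mod_wt_in by blast
    have finL: "finite ?L" using g by blast
    have "x = (\<Oplus>\<^bsub>X\<^esub>n\<in>?L. g n)" using g by blast
    also have "\<dots> = (\<Oplus>\<^bsub>X\<^esub>n\<in>?L. \<pi> (z n))" using z zs \<pi>_in by (intro finsum_cong') auto
    also have "\<dots> = \<pi> (sum z ?L)" using finL zs by (rule finsum_eq)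
    finally have "\<pi> y = \<pi> (sum z ?L)" using y by simp
    moreover have zS: "sum z ?L \<in> space" using zs by (rule S_sum)
    ultimately have yz: "y - sum z ?L \<in> K" using y \<pi>_eq_iff by blast
    show "g = ?f"
    proof
      fix n
      show "g n = ?f n"
      proof (cases "n \<in> half_ints")
        case n: True
        have "wt.part (sum z ?L) n = (if n \<in> ?L then z n else 0)"
        proof (rule wt.part_sum[OF finL])
          show "i \<in> half_ints" if "i \<in> ?L" for i using that by blast
          show "z i \<in> mod_wt M i" if "i \<in> ?L" for i using bspec[OF z that] by blast
        qed
        then have "wt.part y n - (if n \<in> ?L then z n else 0) \<in> K"
          using kernel_wt_part[OF yz, of n] y zS by (simp add: wt.part_diff)
        then have "\<pi> (wt.part y n) = \<pi> (if n \<in> ?L then z n else 0)"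
          using zs S_0 by (intro \<pi>_eq_iff[THEN iffD2] wt.part_in_U[OF y(1)]) simp_all
        moreover have "g n = \<pi> (if n \<in> ?L then z n else 0)"
        proof (cases "n \<in> ?L")
          case True
          then show ?thesis using bspec[OF z True] by (simp only: if_True)
        next
          case False
          then have "g n = \<zero>\<^bsub>X\<^esub>" using n by blast
          then show ?thesis using False by (simp only: if_False zero_eq)
        qed
        ultimately show ?thesis using n by (simp only: restrict_apply if_True)
      next
        case False
        then show ?thesis using g by (auto simp: PiE_def extensional_def)
      qed
    qed
  qed
qed

lemma fil_mono: "i \<le> j \<Longrightarrow> fil X i \<subseteq> fil X j"
  unfolding fil_eq mod_deg_le_eq by (intro image_mono bi.supported_mono) auto

lemma is_subspace_fil: "is_subspace X (fil X i)"
  unfolding fil_eq using subspace_deg_le deg_le_in by (intro is_subspace_image) auto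

text \<open>A class in all steps has, for every bidegree, a representative without component in it. As the
  kernel is bigraded, that component of any representative lies in the kernel.\<close>

lemma fil_separated: "(\<Inter>i. fil X i) = {\<zero>\<^bsub>X\<^esub>}"
proof (intro equalityI subsetI)
  fix x assume x: "x \<in> (\<Inter>i. fil X i)"
  then have "x \<in> fil X 0" by blast
  then obtain y where y: "y \<in> space" "x = \<pi> y" using deg_le_in by (auto simp: fil_eq)
  have "bi.part y k \<in> K" for k
  proof -
    have "x \<in> fil X (snd k - 1)" using x by blast
    then obtain z where z: "z \<in> mod_deg_le M (snd k - 1)" "x = \<pi> z" by (auto simp: fil_eq)
    then have "y - z \<in> K" using y \<pi>_eq_iff deg_le_in by metis
    then have "bi.part (y - z) k \<in> K" by (rule kernel_part)
    moreover have "bi.part z k = 0"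
      using z(1) unfolding mod_deg_le_eq by (rule bi.supportedD) simp
    ultimately show ?thesis using y z deg_le_in by (simp add: bi.part_diff)
  qed
  then have "y \<in> K" by (rule bi.in_subspace_if_part[OF subspace_P y(1)])
  then show "x \<in> {\<zero>\<^bsub>X\<^esub>}" using y \<pi>_zero_iff by simp
next
  fix x assume "x \<in> {\<zero>\<^bsub>X\<^esub>}"
  then show "x \<in> (\<Inter>i. fil X i)"
    using vs.subspace_0[OF subspace_deg_le] by (auto simp: fil_eq zero_eq)
qed

lemma fil_exhaustive: "(\<Union>i. fil X i) = carrier X"
  using deg_le_exhaust deg_le_in by (fastforce simp: fil_eq carrier_eq)

lemma linear_map_dif: "linear_map X X (dif X)"
  by (auto simp: linear_map_def carrier_eq dif_eq add_eq smult_eq diff_in S_add S_scale diff_add diff_scale)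

lemma dif_fil: "dif X ` fil X i \<subseteq> fil X (i + 1)"
  using diff_deg_le deg_le_in by (auto simp: fil_eq dif_eq)

lemma diff_filt_space_X: "diff_filt_space X"
  unfolding diff_filt_space_def
proof (intro conjI allI impI)
  show "(dif X \<circ> dif X) ` fil X i \<subseteq> fil X (i + 1)" for i
    using deg_le_in vs.subspace_0[OF subspace_deg_le] by (auto simp: fil_eq dif_eq diff_in diff_diff)
qed (use module_X is_subspace_fil fil_mono fil_separated fil_exhaustive linear_map_dif dif_fil in auto)

lemma weight_compatible_X: "weight_compatible X"
  unfolding weight_compatible_def
proof (intro conjI ballI allI)
  show "dif X ` wgt X n \<subseteq> wgt X n" if "n \<in> half_ints" for n
    using that weight_subcomplex_diff[OF that] mod_wt_in by (auto simp: wgt_eq dif_eq)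
  fix i
  let ?T = "\<Union>n\<in>half_ints. fil X i \<inter> wgt X n"
  show "fil X i = span_of X ?T"
  proof (intro equalityI)
    show "span_of X ?T \<subseteq> fil X i"
      unfolding span_of_def by (rule hull_minimal) (auto simp: is_subspace_fil)
    show "fil X i \<subseteq> span_of X ?T"
    proof
      fix x assume "x \<in> fil X i"
      then obtain y where y: "y \<in> mod_deg_le M i" "x = \<pi> y" by (auto simp: fil_eq)
      have ys: "y \<in> space" using y deg_le_in by simp
      let ?G = "wt.part y ` {n. wt.part y n \<noteq> 0}"
      have G: "\<pi> ` ?G \<subseteq> ?T"
      proof
        fix a assume "a \<in> \<pi> ` ?G"
        then obtain n where n: "wt.part y n \<noteq> 0" "a = \<pi> (wt.part y n)" by blast
        then have "n \<in> half_ints" using wt.part_outside[OF ys] by blast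
        then show "a \<in> ?T" using n wt.part_in[OF ys] wt_part_mod_deg_le[OF y(1)]
          by (auto simp: fil_eq wgt_eq)
      qed
      have "y = sum (wt.part y) {n. wt.part y n \<noteq> 0}" using wt.sum_part[OF ys] by simp
      also have "\<dots> \<in> vs.span (K \<union> ?G)" by (intro vs.span_sum vs.span_base) auto
      finally have "x \<in> span_of X (\<pi> ` ?G)"
        using y(2) span_of_image[of ?G] wt.part_in_U[OF ys] by auto
      then show "x \<in> span_of X ?T" using hull_mono[OF G] unfolding span_of_def by blast
    qed
  qed
qed

text \<open>The least integer exists because a nonzero element misses some step, by separatedness.\<close>

lemma in_fil_degree:
  assumes x: "x \<in> carrier X" "x \<noteq> \<zero>\<^bsub>X\<^esub>" shows "x \<in> fil X (fil_degree X x)"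
proof -
  obtain i where i: "x \<in> fil X i" using x fil_exhaustive by blast
  obtain j where j: "x \<notin> fil X j" using x fil_separated by blast
  have above: "j < k" if "x \<in> fil X k" for k using that j fil_mono[of k j] by force
  define m where "m = (LEAST m. x \<in> fil X (j + int m))"
  have "x \<in> fil X (j + int (nat (i - j)))" using i above[OF i] by simp
  then have m: "x \<in> fil X (j + int m)" unfolding m_def by (rule LeastI)
  have "fil_degree X x = j + int m"
    unfolding fil_degree_def
  proof (rule Least_equality)
    show "x \<in> fil X (j + int m)" by (rule m)
    fix k assume k: "x \<in> fil X k"
    then have "x \<in> fil X (j + int (nat (k - j)))" using above[OF k] by simp
    then have "m \<le> nat (k - j)" unfolding m_def by (rule Least_le)
    then show "j + int m \<le> k" using above[OF k] by linarith
  qed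
  then show ?thesis using m by simp
qed

end

text \<open>Presentations of an algebra and of a module over it in which the products are induced by
  \<open>u\<^bsub>-1\<^esub> x\<close>. They are associative because the kernels contain the \<open>C\<^sub>2\<close>-subspaces.\<close>

locale module_presentation = A: presentation V "adjoint_module V" L A \<alpha> + X: presentation V M K X \<pi>
  for V :: "'v::ab_group_add dg_voa" and M :: "('v, 'm::ab_group_add) dg_mod"
    and L :: "'v set" and A :: "('a, 'a) filt_mod" and \<alpha> :: "'v \<Rightarrow> 'a"
    and K :: "'m set" and X :: "('a, 'x) filt_mod" and \<pi> :: "'m \<Rightarrow> 'x" +
  assumes mult_eq: "\<alpha> u \<otimes>\<^bsub>A\<^esub> \<alpha> v = \<alpha> (va_Y V u (-1) v)"
    and one_eq: "\<one>\<^bsub>A\<^esub> = \<alpha> (va_vac V)"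
    and act_eq: "x \<in> mod_space M \<Longrightarrow> act X (\<alpha> u) (\<pi> x) = \<pi> (mod_Y M u (-1) x)"
    and C2_A: "dO V (adjoint_module V) 0 \<subseteq> L"
    and C2_X: "dO V M 0 \<subseteq> K"
begin

lemmas carrier_A = A.carrier_eq[simplified]
  and add_A = A.add_eq[simplified]
  and smult_A = A.smult_eq[simplified]

lemma associative_C2:
  assumes "x \<in> mod_space M"
  shows "\<pi> (mod_Y M (va_Y V u (-1) v) (-1) x) = \<pi> (mod_Y M u (-1) (mod_Y M v (-1) x))"
proof -
  have "mod_Y M (va_Y V u (-1) v) (-1) x - mod_Y M u (-1) (mod_Y M v (-1) x) \<in> dO V M 0"
    using X.associator[OF assms, of 1 0 u v] assms A.dprod_0[of v 1 u] by (simp add: X.dprod_0 X.act_in)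
  then show ?thesis using C2_X X.\<pi>_eq_iff X.act_in assms by blast
qed

lemma linear_map_act:
  "a \<in> carrier A \<Longrightarrow> linear_map X X (act X a)"
  "x \<in> carrier X \<Longrightarrow> linear_map A X (\<lambda>a. act X a x)"
  by (auto simp: linear_map_def carrier_A X.carrier_eq act_eq X.add_eq X.smult_eq add_A smult_A X.act_in
      X.S_add X.S_scale X.act_add_left X.act_add_right X.act_scale_left X.act_scale_right)

lemma act_assoc:
  "a \<in> carrier A \<Longrightarrow> b \<in> carrier A \<Longrightarrow> x \<in> carrier X \<Longrightarrow> act X (a \<otimes>\<^bsub>A\<^esub> b) x = act X a (act X b x)"
  by (auto simp: carrier_A X.carrier_eq mult_eq act_eq X.act_in associative_C2)

lemma act_one: "x \<in> carrier X \<Longrightarrow> act X \<one>\<^bsub>A\<^esub> x = x"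
  by (auto simp: X.carrier_eq one_eq act_eq X.Y_vac)

lemma act_wgt:
  assumes "m \<in> half_ints" "n \<in> half_ints" "a \<in> wgt A m" "x \<in> wgt X n"
  shows "act X a x \<in> wgt X (m + n)"
proof -
  obtain u where u: "a = \<alpha> u" "u \<in> voa_wt V m" using assms A.wgt_eq[of m] by auto
  obtain y where y: "x = \<pi> y" "y \<in> mod_wt M n" using assms X.wgt_eq[of n] by auto
  have "mod_Y M u (-1) y \<in> mod_wt M (m + n)"
    using X.Y_weight[of m n u "-1"] assms u y by (auto simp: add.commute)
  then show ?thesis
    using u y assms X.mod_wt_in by (simp add: act_eq X.wgt_eq half_ints_add)
qed

lemma act_fil: "a \<in> fil A i \<Longrightarrow> x \<in> fil X j \<Longrightarrow> act X a x \<in> fil X (i + j)"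
  using X.act_deg_le X.deg_le_in by (auto simp: A.fil_eq X.fil_eq act_eq)

lemma act_leibniz:
  assumes "a \<in> carrier A - {\<zero>\<^bsub>A\<^esub>}" "x \<in> carrier X - {\<zero>\<^bsub>X\<^esub>}"
  shows "dif X (act X a x) \<ominus>\<^bsub>X\<^esub>
    (act X (dif A a) x \<oplus>\<^bsub>X\<^esub> ((-1) powi fil_degree A a) \<odot>\<^bsub>X\<^esub> act X a (dif X x))
    \<in> fil X (fil_degree A a + fil_degree X x)"
proof -
  define i j where ij: "i = fil_degree A a" "j = fil_degree X x"
  obtain u where u: "a = \<alpha> u" "u \<in> mod_deg_le (adjoint_module V) i"
    using A.in_fil_degree[of a] assms(1) by (auto simp: A.fil_eq ij)
  obtain y where y: "x = \<pi> y" "y \<in> mod_deg_le M j"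
    using X.in_fil_degree[of x] assms(2) by (auto simp: X.fil_eq ij)
  have ys: "y \<in> mod_space M" using y X.deg_le_in by blast
  have du: "dif A (\<alpha> u) = \<alpha> (va_diff V u)" using A.dif_eq[of u] by simp
  have "dif X (act X a x) \<ominus>\<^bsub>X\<^esub> (act X (dif A a) x \<oplus>\<^bsub>X\<^esub> ((-1) powi i) \<odot>\<^bsub>X\<^esub> act X a (dif X x))
    = \<pi> (mod_diff M (mod_Y M u (-1) y) - (mod_Y M (va_diff V u) (-1) y
        + mod_scale M ((-1) powi i) (mod_Y M u (-1) (mod_diff M y))))"
    unfolding u(1) y(1)
    using ys by (simp add: du act_eq X.dif_eq X.act_in X.diff_in X.smult_eq X.add_eq X.S_scale X.S_add X.diff_eq)
  then show ?thesis unfolding ij[symmetric] using X.leibniz[OF u(2) y(2)] by (simp add: X.fil_eq)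
qed

end

context module_presentation
begin

lemma self_presentation:
  assumes "act A = monoid.mult A"
  shows "module_presentation V (adjoint_module V) L A \<alpha> L A \<alpha>"
proof -
  have "act A (\<alpha> u) (\<alpha> v) = \<alpha> (va_Y V u (-1) v)" for u v using mult_eq[of u v] assms by simp
  then show ?thesis using mult_eq one_eq C2_A
    by (intro module_presentation.intro module_presentation_axioms.intro A.presentation_axioms) simp_all
qed

end

text \<open>An algebra is a module over itself, so most axioms of algebras are those of modules.\<close>

locale algebra_presentation = module_presentation V "adjoint_module V" L A \<alpha> L A \<alpha>
  for V :: "'v::ab_group_add dg_voa" and L :: "'v set" and A :: "('a, 'a) filt_mod" and \<alpha> :: "'v \<Rightarrow> 'a" +
  assumes act_mult: "act A = monoid.mult A"
begin

lemma vac_act: "va_Y V (va_vac V) (-1) v = v" "va_Y V v (-1) (va_vac V) = v"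
  using A.V.Y_vac A.V.creation by simp_all

lemma ring_A: "ring A"
proof (rule ringI)
  show "abelian_group A" by (rule A.abelian_group_X)
  show "Group.monoid A"
    by (rule monoidI)
      (auto simp: carrier_A mult_eq one_eq vac_act intro: associative_C2[simplified])
  have Yl: "va_Y V (u + v) (-1) w = va_Y V u (-1) w + va_Y V v (-1) w"
    and Yr: "va_Y V w (-1) (u + v) = va_Y V w (-1) u + va_Y V w (-1) v" for u v w
    using A.V.adj.act_add_left[of w u v "-1"] A.V.adj.act_add_right[of u v w "-1"] by simp_all
  show "(x \<oplus>\<^bsub>A\<^esub> y) \<otimes>\<^bsub>A\<^esub> z = x \<otimes>\<^bsub>A\<^esub> z \<oplus>\<^bsub>A\<^esub> y \<otimes>\<^bsub>A\<^esub> z"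
    if "x \<in> carrier A" "y \<in> carrier A" "z \<in> carrier A" for x y z
    using that by (auto simp: carrier_A add_A mult_eq Yl)
  show "z \<otimes>\<^bsub>A\<^esub> (x \<oplus>\<^bsub>A\<^esub> y) = z \<otimes>\<^bsub>A\<^esub> x \<oplus>\<^bsub>A\<^esub> z \<otimes>\<^bsub>A\<^esub> y"
    if "x \<in> carrier A" "y \<in> carrier A" "z \<in> carrier A" for x y z
    using that by (auto simp: carrier_A add_A mult_eq Yr)
qed

lemma mult_scale:
  "a \<in> carrier A \<Longrightarrow> b \<in> carrier A \<Longrightarrow> (c \<odot>\<^bsub>A\<^esub> a) \<otimes>\<^bsub>A\<^esub> b = c \<odot>\<^bsub>A\<^esub> (a \<otimes>\<^bsub>A\<^esub> b)"
  "a \<in> carrier A \<Longrightarrow> b \<in> carrier A \<Longrightarrow> a \<otimes>\<^bsub>A\<^esub> (c \<odot>\<^bsub>A\<^esub> b) = c \<odot>\<^bsub>A\<^esub> (a \<otimes>\<^bsub>A\<^esub> b)"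
proof -
  have "va_Y V (va_scale V c u) (-1) v = va_scale V c (va_Y V u (-1) v)"
    "va_Y V u (-1) (va_scale V c v) = va_scale V c (va_Y V u (-1) v)" for u v
    using A.V.adj.act_scale_left A.V.adj.act_scale_right by simp_all
  then show "a \<in> carrier A \<Longrightarrow> b \<in> carrier A \<Longrightarrow> (c \<odot>\<^bsub>A\<^esub> a) \<otimes>\<^bsub>A\<^esub> b = c \<odot>\<^bsub>A\<^esub> (a \<otimes>\<^bsub>A\<^esub> b)"
    "a \<in> carrier A \<Longrightarrow> b \<in> carrier A \<Longrightarrow> a \<otimes>\<^bsub>A\<^esub> (c \<odot>\<^bsub>A\<^esub> b) = c \<odot>\<^bsub>A\<^esub> (a \<otimes>\<^bsub>A\<^esub> b)"
    by (auto simp: carrier_A smult_A mult_eq)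
qed

lemma graded_algebra_A: "graded_algebra A"
  unfolding graded_algebra_def
proof (intro conjI allI ballI)
  show "\<one>\<^bsub>A\<^esub> \<in> wgt A 0" using A.V.vac_weight A.wgt_eq[of 0] by (simp add: one_eq)
  show "a \<otimes>\<^bsub>A\<^esub> b \<in> wgt A (m + n)"
    if "m \<in> half_ints" "n \<in> half_ints" "a \<in> wgt A m" "b \<in> wgt A n" for m n a b
    using act_wgt[OF that] by (simp add: act_mult)
qed (simp_all add: ring_A A.weight_graded_space_X mult_scale)

lemma diff_filt_algebra_A: "diff_filt_algebra A"
  unfolding diff_filt_algebra_def
  using A.diff_filt_space_X ring_A mult_scale act_fil act_leibniz by (auto simp: act_mult)

end

context module_presentation
begin

theorem graded_diff_filt_module_X:
  assumes "act A = monoid.mult A" shows "graded_diff_filt_module A X"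
proof -
  interpret P: algebra_presentation V L A \<alpha>
    using assms self_presentation by (intro algebra_presentation.intro algebra_presentation_axioms.intro)
  have "graded_module A X"
    unfolding graded_module_def
    using P.graded_algebra_A X.weight_graded_space_X linear_map_act act_assoc act_one act_wgt by auto
  moreover have "diff_filt_module A X"
    unfolding diff_filt_module_def
    using P.diff_filt_algebra_A X.diff_filt_space_X linear_map_act act_assoc act_one act_fil act_leibniz by auto
  ultimately show ?thesis
    unfolding graded_diff_filt_module_def using A.weight_compatible_X X.weight_compatible_X by auto
qed

lemma graded_module_X: "act A = monoid.mult A \<Longrightarrow> graded_module A X"
  using graded_diff_filt_module_X by (simp add: graded_diff_filt_module_def)

end

section \<open>Functoriality and the natural transformation\<close>

text \<open>This covers the values of both functors on morphisms and, with \<open>f = id\<close>, the comparison map.\<close>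

lemma presented_module_hom:
  assumes "module_presentation V M L A \<alpha> K X \<pi>" "module_presentation V N L A \<alpha> K' X' \<pi>'"
    and A: "act A = monoid.mult A"
    and f: "graded_dg_module_hom M N f" and F: "\<And>x. x \<in> mod_space M \<Longrightarrow> F (\<pi> x) = \<pi>' (f x)"
  shows "graded_module_hom A X X' F"
proof -
  interpret P: module_presentation V M L A \<alpha> K X \<pi> by fact
  interpret Q: module_presentation V N L A \<alpha> K' X' \<pi>' by fact
  interpret H: voa_module_hom V M N f by unfold_locales (rule f)
  have "linear_map X X' F"
    by (auto simp: linear_map_def P.X.carrier_eq Q.X.carrier_eq F H.hom_in P.X.add_eq Q.X.add_eq
        P.X.smult_eq Q.X.smult_eq P.X.S_add P.X.S_scale H.hom_add H.hom_scale)
  moreover have "F (act X a x) = act X' a (F x)" if "a \<in> carrier A" "x \<in> carrier X" for a x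
    using that by (auto simp: P.carrier_A P.X.carrier_eq P.act_eq Q.act_eq F H.hom_in H.hom_act P.X.act_in)
  moreover have "F ` wgt X n \<subseteq> wgt X' n" if "n \<in> half_ints" for n
    using that H.hom_wt P.X.mod_wt_in by (auto simp: P.X.wgt_eq Q.X.wgt_eq F)
  ultimately show ?thesis
    unfolding graded_module_hom_def using P.graded_module_X[OF A] Q.graded_module_X[OF A] by blast
qed

lemma graded_dg_module_hom_id: "graded_dg_module_hom M M id"
  by (auto simp: graded_dg_module_hom_def linear_between_def)

lemma graded_dg_module_hom_comp:
  "graded_dg_module_hom L M f \<Longrightarrow> graded_dg_module_hom M N g \<Longrightarrow> graded_dg_module_hom L N (g \<circ> f)"
  by (auto simp: graded_dg_module_hom_def linear_between_def image_subset_iff)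

lemma functor_of_presentations:
  fixes F0 :: "('v::ab_group_add, 'm::ab_group_add) dg_mod \<Rightarrow> ('a, 'x) filt_mod"
  assumes pres: "\<And>M. graded_dg_module V M \<Longrightarrow> module_presentation V M L A \<alpha> (K M) (F0 M) (\<pi> M)"
    and A: "act A = monoid.mult A"
    and F1: "\<And>M N f x. graded_dg_module V M \<Longrightarrow> graded_dg_module V N \<Longrightarrow> graded_dg_module_hom M N f \<Longrightarrow>
      x \<in> mod_space M \<Longrightarrow> F1 M N f (\<pi> M x) = \<pi> N (f x)"
  shows "functor_to_graded_modules V A F0 F1"
proof -
  have carr: "carrier (F0 M) = \<pi> M ` mod_space M" if "graded_dg_module V M" for M
  proof -
    interpret module_presentation V M L A \<alpha> "K M" "F0 M" "\<pi> M" using that by (rule pres)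
    show ?thesis by (rule X.carrier_eq)
  qed
  have in_space: "f x \<in> mod_space N" if "graded_dg_module_hom M N f" "x \<in> mod_space M" for M N :: "('v, 'm) dg_mod" and f x
    using that by (auto simp: graded_dg_module_hom_def linear_between_def)
  show ?thesis
    unfolding functor_to_graded_modules_def
  proof (intro conjI allI impI ballI; (elim conjE)?)
    show "graded_module A (F0 M)" if "graded_dg_module V M" for M
      using module_presentation.graded_module_X[OF pres[OF that] A] .
    show "graded_module_hom A (F0 M) (F0 N) (F1 M N f)"
      if "graded_dg_module V M" "graded_dg_module V N" "graded_dg_module_hom M N f" for M N f
      by (rule presented_module_hom[OF pres[OF that(1)] pres[OF that(2)] A that(3)]) (rule F1[OF that])
    show "F1 M M id x = x" if "graded_dg_module V M" "x \<in> carrier (F0 M)" for M x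
      using that F1[OF that(1,1) graded_dg_module_hom_id] by (auto simp: carr)
    show "F1 L N (g \<circ> f) x = F1 M N g (F1 L M f x)"
      if h: "graded_dg_module V L" "graded_dg_module V M" "graded_dg_module V N"
        "graded_dg_module_hom L M f" "graded_dg_module_hom M N g" and x: "x \<in> carrier (F0 L)" for L M N f g x
    proof -
      obtain y where y: "y \<in> mod_space L" "x = \<pi> L y" using x carr[OF h(1)] by blast
      have "F1 L N (g \<circ> f) x = \<pi> N ((g \<circ> f) y)"
        unfolding y(2) by (rule F1[OF h(1,3) graded_dg_module_hom_comp[OF h(4,5)] y(1)])
      also have "\<dots> = F1 M N g (\<pi> M (f y))"
        using F1[OF h(2,3,5) in_space[OF h(4) y(1)]] by simp
      also have "\<pi> M (f y) = F1 L M f x" unfolding y(2) by (rule F1[OF h(1,2,4) y(1), symmetric])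
      finally show ?thesis .
    qed
  qed
qed

context voa_module_hom
begin

lemma hom_supported:
  assumes "x \<in> M.bi.supported B" shows "f x \<in> N.bi.supported B"
  using assms
proof (induction rule: M.bi.supported_induct)
  case zero then show ?case by (simp add: hom_zero N.vs.subspace_0 N.bi.subspace_supported)
next
  case (add x y) then show ?case by (simp add: hom_add N.vs.subspace_add N.bi.subspace_supported)
next
  case (homogeneous k x)
  obtain n p where k: "k = (n, p)" by fastforce
  have "f x \<in> mod_deg N p" using homogeneous k hom by (auto simp: graded_dg_module_hom_def)
  then have "f x \<in> N.bi.supported {k}" using homogeneous k hom_wt N.bi_homogeneous[of n p] by auto
  then show ?case using N.bi.supported_mono[of "{k}" B] homogeneous by auto
qed

lemma hom_lead_ker:
  assumes "x \<in> M.lead_ker n" shows "f x \<in> N.lead_ker n"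
proof -
  obtain y where y: "x \<in> M.wt_le n" "y \<in> dO V M 1" "x - y \<in> M.wt_lt n"
    using assms by (auto simp: M.lead_ker_def)
  show ?thesis
  proof (rule N.lead_kerI)
    show "f x \<in> N.wt_le n" by (rule hom_supported[OF y(1)])
    show "f y \<in> dO V N 1" by (rule hom_dO[OF y(2)])
    show "f x - f y \<in> N.wt_lt n"
      using hom_supported[OF y(3)] hom_sub[OF M.wt_le_in[OF y(1)] subsetD[OF M.dO_subset y(2)]] by simp
  qed
qed

lemma hom_etaR_ker:
  assumes "x \<in> M.etaR_ker" shows "f x \<in> N.etaR_ker"
proof (rule M.dg.linear_span_mem[where t = N.scal and f = f, OF _ _ _ hom_add hom_scale N.vector_space N.subspace_etaR_ker])
  show "x \<in> M.vs.span (dO V M 0 \<union> {mod_Y M u (-1) x | u x. u \<in> M.V.self.gr_ker \<and> x \<in> mod_space M})"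
    using assms by (simp add: M.etaR_ker_def)
  show "f g \<in> N.etaR_ker"
    if "g \<in> dO V M 0 \<union> {mod_Y M u (-1) x | u x. u \<in> M.V.self.gr_ker \<and> x \<in> mod_space M}" for g
    using that hom_dO N.C2_etaR_ker hom_act hom_in N.gr_ker_act by auto
qed (use subsetD[OF M.dO_subset] M.act_in in auto)

lemma A_map_class:
  assumes x: "x \<in> mod_space M" shows "A_map V N f (A_class V M x) = A_class V N (f x)"
  unfolding A_map_def
proof (rule descend_eqI)
  show "A_class V M x \<noteq> {}" using M.A_class_self[OF x] by blast
  fix y assume "y \<in> A_class V M x"
  then have y: "y \<in> mod_space M" "y - x \<in> dO V M 1" using x by (auto simp: M.A_class_coset)
  then have "f y - f x \<in> dO V N 1" using hom_dO x by (simp flip: hom_sub)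
  then have "A_class V N (f y) = A_class V N (f x)"
    using presented_space.\<pi>_eq_iff[OF N.presented_A] hom_in x y by blast
  then show "zhu_O V N +>\<^bsub>underlying N (mod_wt_le N)\<^esub> f y = A_class V N (f x)" by (simp add: A_class_def)
qed

lemma R_map_class:
  assumes x: "x \<in> mod_space M" shows "R_map N f (R_class M x) = R_class N (f x)"
  unfolding R_map_def
proof (rule descend_eqI)
  show "R_class M x \<noteq> {}" using M.R_class_self[OF x] by blast
  fix y assume "y \<in> R_class M x"
  then have y: "y \<in> mod_space M" "y - x \<in> dO V M 0" using x by (auto simp: M.R_class_coset)
  then have "f y - f x \<in> dO V N 0" using hom_dO x by (simp flip: hom_sub)
  then have "R_class N (f y) = R_class N (f x)"
    using presented_space.\<pi>_eq_iff[OF N.presented_R] hom_in x y by blast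
  then show "C2 N +>\<^bsub>underlying N (mod_wt N)\<^esub> f y = R_class N (f x)" by (simp add: R_class_def)
qed

lemma etaR_map_class:
  assumes x: "x \<in> mod_space M" shows "etaR_map V M N f (etaR_class V M x) = etaR_class V N (f x)"
proof -
  interpret R: presented_space M.scal M.space "dO V M 0" "R_mod V M" "R_class M" by (rule M.presented_R)
  interpret E: presentation V N N.etaR_ker "etaR_mod V N" "etaR_class V N" by (rule N.presentation_etaR)
  show ?thesis
    unfolding etaR_map_def eta_map_def M.etaR_class_eq
  proof (rule R.descend_coset[OF M.subspace_etaR_ker M.etaR_ker_subset x])
    fix y assume y: "y \<in> M.space" "y - x \<in> M.etaR_ker"
    then have "f y - f x \<in> N.etaR_ker" using hom_etaR_ker x by (simp flip: hom_sub)
    then have "etaR_class V N (f y) = etaR_class V N (f x)" using E.\<pi>_eq_iff hom_in x y by blast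
    then show "eta_ker_times V (R_mod V N) +>\<^bsub>R_mod V N\<^esub> R_map N f (R_class M y) = etaR_class V N (f x)"
      using y by (simp add: R_map_class etaR_class_def)
  qed
qed

lemma grA_map_class:
  assumes x: "x \<in> mod_space M" shows "grA_map V M N f (M.gr_class x) = N.gr_class (f x)"
  unfolding grA_map_def gr_map_def N.gr_class_def[of "f x"]
proof (rule restrict_ext)
  fix n :: rat assume n: "n \<in> half_ints"
  let ?x = "M.wt.part x n"
  have xn: "?x \<in> M.wt_le n" using M.wt_part_le[OF x n] .
  have x0: "?x - ?x \<in> M.lead_ker n" using M.vs.subspace_0[OF M.subspace_lead_ker] by simp
  have "descend (A_mod V N) (wgt_below (A_mod V N) n) (A_map V N f) (M.piece n ?x) = N.piece n (N.wt.part (f x) n)"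
  proof (rule descend_eqI)
    show "M.piece n ?x \<noteq> {}" unfolding M.piece_coset[OF n xn] using xn x0 by blast
    fix a assume "a \<in> M.piece n ?x"
    then obtain y where y: "a = A_class V M y" "y \<in> M.wt_le n" "y - ?x \<in> M.lead_ker n"
      unfolding M.piece_coset[OF n xn] by blast
    have "f y - f ?x \<in> N.lead_ker n"
      using hom_lead_ker[OF y(3)] hom_sub[OF M.wt_le_in[OF y(2)] M.wt_le_in[OF xn]] by simp
    then have "N.piece n (f y) = N.piece n (f ?x)"
      using N.piece_eq_iff[OF n] hom_supported y(2) xn by blast
    then show "wgt_below (A_mod V N) n +>\<^bsub>A_mod V N\<^esub> A_map V N f a = N.piece n (N.wt.part (f x) n)"
      unfolding y(1) A_map_class[OF M.wt_le_in[OF y(2)]] hom_wt_part[OF x, symmetric] N.piece_def[symmetric] .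
  qed
  then show "descend (A_mod V N) (wgt_below (A_mod V N) n) (A_map V N f) (M.gr_class x n) = N.piece n (N.wt.part (f x) n)"
    using n by (simp add: M.gr_class_def)
qed

end

context voa
begin

lemma act_grA_alg: "act (grA_alg V) = monoid.mult (grA_alg V)"
  by (simp add: grA_alg_eq as_algebra_def)

lemma act_grA_alg_eq: "act (grA_alg V) (self.gr_class u) (self.gr_class v) = self.gr_class (va_Y V u (-1) v)"
  using self.act_gr[of v u] by (simp add: grA_alg_eq gr_def Let_def)

end

context voa_module
begin

lemma module_presentation_gr:
  "module_presentation V M V.self.gr_ker (grA_alg V) V.self.gr_class gr_ker (grA_mod V M) gr_class"
proof (intro module_presentation.intro module_presentation_axioms.intro V.presentation_grA_alg)
  show "presentation V M gr_ker (grA_mod V M) gr_class"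
    unfolding grA_mod_def by (rule presentation_gr)
  show "V.self.gr_class u \<otimes>\<^bsub>grA_alg V\<^esub> V.self.gr_class v = V.self.gr_class (va_Y V u (-1) v)" for u v
    using V.act_grA_alg_eq by (simp add: V.act_grA_alg)
  show "\<one>\<^bsub>grA_alg V\<^esub> = V.self.gr_class (va_vac V)" by (simp add: V.grA_alg_eq)
  show "act (grA_mod V M) (V.self.gr_class u) (gr_class x) = gr_class (mod_Y M u (-1) x)" if "x \<in> space" for x u
    unfolding grA_mod_def A_alg_def gr_as_algebra(1)
    unfolding gr_mod_simps using that by (rule act_gr)
qed (rule V.self.C2_gr_ker C2_gr_ker)+

lemma module_presentation_etaR:
  "module_presentation V M V.self.gr_ker (grA_alg V) V.self.gr_class etaR_ker (etaR_mod V M) (etaR_class V M)"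
proof (intro module_presentation.intro module_presentation_axioms.intro V.presentation_grA_alg presentation_etaR)
  show "V.self.gr_class u \<otimes>\<^bsub>grA_alg V\<^esub> V.self.gr_class v = V.self.gr_class (va_Y V u (-1) v)" for u v
    using V.act_grA_alg_eq by (simp add: V.act_grA_alg)
  show "\<one>\<^bsub>grA_alg V\<^esub> = V.self.gr_class (va_vac V)" by (simp add: V.grA_alg_eq)
  show "act (etaR_mod V M) (V.self.gr_class u) (etaR_class V M x) = etaR_class V M (mod_Y M u (-1) x)"
    if "x \<in> space" for x u using that by (rule act_etaR)
qed (use V.self.C2_gr_ker C2_etaR_ker in auto)

text \<open>Any representative gives the same value because \<open>etaR_ker\<close> is contained in \<open>gr_ker\<close>.\<close>

definition comparison :: "'m set set \<Rightarrow> rat \<Rightarrow> 'm set set" where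
  "comparison C = gr_class (SOME x. x \<in> space \<and> etaR_class V M x = C)"

lemma comparison_eq:
  assumes x: "x \<in> space" shows "comparison (etaR_class V M x) = gr_class x"
proof -
  interpret E: presentation V M etaR_ker "etaR_mod V M" "etaR_class V M" by (rule presentation_etaR)
  let ?y = "SOME y. y \<in> space \<and> etaR_class V M y = etaR_class V M x"
  have y: "?y \<in> space \<and> etaR_class V M ?y = etaR_class V M x"
    by (rule someI[of _ x]) (simp add: x)
  then have "?y - x \<in> etaR_ker" using E.\<pi>_eq_iff x by blast
  then show ?thesis
    unfolding comparison_def using gr_class_eq_iff x y etaR_ker_gr_ker by blast
qed

lemma comparison_hom:
  "graded_diff_filt_module_hom (grA_alg V) (etaR_mod V M) (grA_mod V M) comparison"
proof -
  interpret E: module_presentation V M V.self.gr_ker "grA_alg V" V.self.gr_class etaR_ker "etaR_mod V M" "etaR_class V M"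
    by (rule module_presentation_etaR)
  interpret G: module_presentation V M V.self.gr_ker "grA_alg V" V.self.gr_class gr_ker "grA_mod V M" gr_class
    by (rule module_presentation_gr)
  have "graded_module_hom (grA_alg V) (etaR_mod V M) (grA_mod V M) comparison"
    by (rule presented_module_hom[OF E.module_presentation_axioms G.module_presentation_axioms V.act_grA_alg
          graded_dg_module_hom_id]) (simp add: comparison_eq)
  moreover have "comparison ` fil (etaR_mod V M) i \<subseteq> fil (grA_mod V M) i" for i
    using deg_le_in by (auto simp: E.X.fil_eq G.X.fil_eq comparison_eq)
  moreover have "(\<lambda>x. comparison (dif (etaR_mod V M) x) \<ominus>\<^bsub>grA_mod V M\<^esub> dif (grA_mod V M) (comparison x)) `
      fil (etaR_mod V M) i \<subseteq> fil (grA_mod V M) i" for i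
    using deg_le_in vs.subspace_0[OF subspace_deg_le]
    by (auto simp: E.X.fil_eq G.X.fil_eq comparison_eq E.X.dif_eq G.X.dif_eq diff_in G.X.diff_eq)
  ultimately show ?thesis
    unfolding graded_diff_filt_module_hom_def
    using E.graded_diff_filt_module_X[OF V.act_grA_alg] G.graded_diff_filt_module_X[OF V.act_grA_alg] by blast
qed

lemma comparison_surj: "comparison ` carrier (etaR_mod V M) = carrier (grA_mod V M)"
proof -
  interpret E: presentation V M etaR_ker "etaR_mod V M" "etaR_class V M" by (rule presentation_etaR)
  have "carrier (grA_mod V M) = gr_class ` space" unfolding grA_mod_def by (simp add: gr_mod_simps gr_class_surj)
  then show ?thesis by (simp add: E.carrier_eq image_image comparison_eq)
qed

end

theorem proposition8p4:
  fixes V :: "'v::ab_group_add dg_voa"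
  assumes "dg_vertex_operator_algebra V"
  shows "\<exists>\<phi> :: ('v, 'm::ab_group_add) dg_mod \<Rightarrow> 'm set set \<Rightarrow> (rat \<Rightarrow> 'm set set).
     natural_transformation V (grA_alg V)
       (etaR_mod V) (etaR_map V) (grA_mod V) (grA_map V) \<phi> \<and>
     (\<forall>M. graded_dg_module V M \<longrightarrow>
        graded_diff_filt_module_hom (grA_alg V) (etaR_mod V M) (grA_mod V M) (\<phi> M) \<and>
        \<phi> M ` carrier (etaR_mod V M) = carrier (grA_mod V M) \<and>
        (\<forall>n\<in>half_ints. \<forall>m\<in>mod_wt M n.
           \<phi> M (etaR_class V M m) = gr_single (A_mod V M) n (A_class V M m)))"
proof (intro exI[of _ "voa_module.comparison V"] conjI allI impI ballI)
  interpret voa V by (rule voa.intro) fact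
  have vm: "voa_module V M" if "graded_dg_module V M" for M :: "('v, 'm) dg_mod"
    using that by (intro voa_module.intro voa_axioms)
  have vh: "voa_module_hom V M N f"
    if "graded_dg_module V M" "graded_dg_module V N" "graded_dg_module_hom M N f" for M N :: "('v, 'm) dg_mod" and f
    using that vm by (intro voa_module_hom.intro voa_module_hom_axioms.intro)
  have F: "functor_to_graded_modules V (grA_alg V) (etaR_mod V) (etaR_map V :: ('v, 'm) dg_mod \<Rightarrow> _)"
    by (rule functor_of_presentations[OF voa_module.module_presentation_etaR[OF vm] act_grA_alg
          voa_module_hom.etaR_map_class[OF vh]])
  have G: "functor_to_graded_modules V (grA_alg V) (grA_mod V) (grA_map V :: ('v, 'm) dg_mod \<Rightarrow> _)"
    by (rule functor_of_presentations[OF voa_module.module_presentation_gr[OF vm] act_grA_alg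
          voa_module_hom.grA_map_class[OF vh]])
  have "voa_module.comparison V N (etaR_map V M N f x) = grA_map V M N f (voa_module.comparison V M x)"
    if h: "graded_dg_module V M" "graded_dg_module V N" "graded_dg_module_hom M N f"
      and x: "x \<in> carrier (etaR_mod V M)" for M N :: "('v, 'm) dg_mod" and f x
  proof -
    interpret voa_module_hom V M N f using h by (rule vh)
    interpret E: presentation V M M.etaR_ker "etaR_mod V M" "etaR_class V M" by (rule M.presentation_etaR)
    obtain y where "y \<in> M.space" "x = etaR_class V M y" using x by (auto simp: E.carrier_eq)
    then show ?thesis
      by (simp add: etaR_map_class grA_map_class M.comparison_eq N.comparison_eq hom_in)
  qed
  then show "natural_transformation V (grA_alg V) (etaR_mod V) (etaR_map V) (grA_mod V) (grA_map V)
      (voa_module.comparison V :: ('v, 'm) dg_mod \<Rightarrow> _)"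
    unfolding natural_transformation_def
    using F G voa_module.comparison_hom[OF vm] by (auto simp: graded_diff_filt_module_hom_def)
  fix M :: "('v, 'm) dg_mod" assume M: "graded_dg_module V M"
  interpret M: voa_module V M using M by (rule vm)
  show "graded_diff_filt_module_hom (grA_alg V) (etaR_mod V M) (grA_mod V M) (voa_module.comparison V M)"
    by (rule M.comparison_hom)
  show "voa_module.comparison V M ` carrier (etaR_mod V M) = carrier (grA_mod V M)"
    by (rule M.comparison_surj)
  show "voa_module.comparison V M (etaR_class V M m) = gr_single (A_mod V M) n (A_class V M m)"
    if "n \<in> half_ints" "m \<in> mod_wt M n" for n m
    using that M.mod_wt_in by (simp add: M.comparison_eq M.gr_single_eq)
qed

end
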